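(* Let $g$ be the gravitational acceleration, $h>0$, $\gamma\in\mathbb{R}$, let $n\ge1$ be an integer and $\alpha\in(0,1)$. Let $(\{\alpha_k\},\{\beta_k\})\in\mathcal{A}$, let $E^n_0$ be the associated space of almost periodic functions, and let $X=\mathbb{R}\times E^n_0$. Let $k_0$ be an index with $\alpha_{k_0}\neq\beta_k$ for all $k\in\mathbb{N}$. Consider the problem for $(\lambda,(\mu,w))\in\mathbb{R}\times X$ $$\Big\{\lambda+\gamma\Big(\mathcal{G}_h\big(\tfrac{w^2}{2}\big)-w-w\,\mathcal{G}_h(w)\Big)\Big\}^2=(\lambda^2+\mu-2gw)\big(w'^2+\mathcal{G}_h(w)^2+2\mathcal{G}_h(w)+1\big),\quad \overline{w}=0,\quad w>-h \text{ on }\mathbb{R}. \quad ( * )$$ Then one obtains the four bifurcation values $$\lambda_{1}=-\frac{\gamma\tanh(\alpha_{k_0}h)}{2\alpha_{k_0}}+\sqrt{\frac{\gamma^2\tanh^2(\alpha_{k_0}h)}{4\alpha_{k_0}^2}+g\frac{\tanh(\alpha_{k_0}h)}{\alpha_{k_0}}},$$ $$\lambda_{2}=-\frac{\gamma\tanh(\alpha_{k_0}h)}{2\alpha_{k_0}}-\sqrt{\frac{\gamma^2\tanh^2(\alpha_{k_0}h)}{4\alpha_{k_0}^2}+g\frac{\tanh(\alpha_{k_0}h)}{\alpha_{k_0}}},$$ $$\lambda_{3}=-\frac{\gamma\tanh(\beta_{k_0}h)}{2\beta_{k_0}}+\sqrt{\frac{\gamma^2\tanh^2(\beta_{k_0}h)}{4\beta_{k_0}^2}+g\frac{\tanh(\beta_{k_0}h)}{\beta_{k_0}}},$$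 $$\lambda_{4}=-\frac{\gamma\tanh(\beta_{k_0}h)}{2\beta_{k_0}}-\sqrt{\frac{\gamma^2\tanh^2(\beta_{k_0}h)}{4\beta_{k_0}^2}+g\frac{\tanh(\beta_{k_0}h)}{\beta_{k_0}}},$$ and solutions of $( * )$ with small amplitude exist near each of them: for each $j\in\{1,2,3,4\}$ there exist $\varepsilon>0$ and a continuous curve $\{(\lambda(s),(\mu(s),w(s))):|s|<\varepsilon\}\subset\mathbb{R}\times X$ of solutions of $( * )$ with $(\lambda(0),(\mu(0),w(0)))=(\lambda_j,(0,0))$ such that, in $X$ as $s\to0$, $$(\mu(s),w(s))=\big(o(s),\,s\cos(\alpha_{k_0}x)+o(s)\big)\ \text{ if } j\in\{1,2\},\qquad (\mu(s),w(s))=\big(o(s),\,s\sin(\beta_{k_0}x)+o(s)\big)\ \text{ if } j\in\{3,4\}.$$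
   Context: $\mathcal{B}^2(\mathbb{R})$ is the Besicovitch space of functions $u\in L^2_{loc}(\mathbb{R})$ with finite semi-norm $\|u\|_{\mathcal{B}^2}=\lim_{x\to\infty}\big(\frac1x\int_{-x}^x|u|^2dy\big)^{1/2}$, and $L_0$ is the set of functions with $\|u\|_{\mathcal{B}^2}=0$; elements of $\mathcal{B}^2(\mathbb{R})/L_0$ are the almost periodic functions considered. The mean of $u$ is $\overline{u}=\lim_{x\to\infty}\frac{1}{2x}\int_{-x}^{x}u(y)\,dy$. $C^{n,\alpha}$ denotes the standard Hölder space. $\mathcal{A}$ is the set of pairs of real sequences $(\{\alpha_k\}_{k\ge0},\{\beta_k\}_{k\ge0})$ such that: (i) there is some $k_0\in\mathbb{N}$ with $\alpha_{k_0}\neq\beta_k$ for all $k\in\mathbb{N}$; (ii) for any $k,l\in\mathbb{N}$ there are indices $k_1,\dots,k_6$ with $\alpha_k+\alpha_l=\alpha_{k_1}$, $\alpha_k-\alpha_l=\alpha_{k_2}$, $\beta_k+\beta_l=\alpha_{k_3}$, $\beta_k-\beta_l=\alpha_{k_4}$, $\alpha_k+\beta_l=\beta_{k_5}$, $\alpha_k-\beta_l=\beta_{k_6}$. For a pair in $\mathcal{A}$, $E^n$ is the subspace of $C^{n,\alpha}(\mathbb{R})\cap\mathcal{B}^2(\mathbb{R})/L_0$ of functions of the form $f=\overline{f}+\sum_{k}a_k\cos(\alpha_kx)+\sum_k b_k\sin(\beta_kx)$, and $E^n_0=\{f\in E^n:\overline{f}=0\}$. For $h>0$ let $\mathcal{R}_h=\{(x,y)\in\mathbb{R}^2:-h<y<0\}$.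 For $n\ge1$ and $w\in C^{n,\alpha}(\mathbb{R})\cap\mathcal{B}^2(\mathbb{R})/L_0$, let $W\in C^{n,\alpha}(\overline{\mathcal{R}_h})$ be the unique solution of $\Delta W=0$ in $\mathcal{R}_h$, $W(x,-h)=0$, $W(x,0)=w(x)$. The Dirichlet–Neumann operator is $\mathcal{G}_h(w)(x)=W_y(x,0)$.
   Formalization: The claims for λ_1 and λ_2 are made only when α_{k_0} ≠ 0; for α_{k_0} = 0, which the condition on k_0 allows, the formulas divide by zero and the profile s·cos(0) = s does not have zero mean. *)

theory Defs
  imports "HOL-Analysis.Analysis"
begin

section \<open>Besicovitch space\<close>

definition L2_loc :: "(real \<Rightarrow> real) set" where
  "L2_loc = {u. u \<in> borel_measurable lebesgue \<and>
     (\<forall>R. set_integrable lebesgue {-R..R} (\<lambda>t. (u t)\<^sup>2))}"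

definition B2_average :: "(real \<Rightarrow> real) \<Rightarrow> real \<Rightarrow> real" where
  "B2_average u x = sqrt (1 / x * (LINT t:{-x..x}|lebesgue. (u t)\<^sup>2))"

text \<open>As in the source, the semi-norm is a genuine limit (not an upper limit), so membership
  includes its existence as a real number.\<close>

definition B2 :: "(real \<Rightarrow> real) set" where
  "B2 = {u \<in> L2_loc. \<exists>r. (B2_average u \<longlongrightarrow> r) at_top}"

definition B2_seminorm :: "(real \<Rightarrow> real) \<Rightarrow> real" where
  "B2_seminorm u = Lim at_top (B2_average u)"

definition has_mean :: "(real \<Rightarrow> real) \<Rightarrow> real \<Rightarrow> bool" where
  "has_mean u m \<longleftrightarrow>
     ((\<lambda>x. 1 / (2 * x) * (LINT t:{-x..x}|lebesgue. u t)) \<longlongrightarrow> m) at_top"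


section \<open>Hoelder spaces\<close>

definition holder :: "nat \<Rightarrow> real \<Rightarrow> (real \<Rightarrow> real) set" where
  "holder n a = {f.
     (\<forall>k<n. \<forall>x. ((deriv ^^ k) f) differentiable (at x)) \<and>
     (\<forall>k\<le>n. bounded (range ((deriv ^^ k) f))) \<and>
     (\<exists>C. \<forall>x y. \<bar>(deriv ^^ n) f x - (deriv ^^ n) f y\<bar> \<le> C * \<bar>x - y\<bar> powr a)}"

definition holder_norm :: "nat \<Rightarrow> real \<Rightarrow> (real \<Rightarrow> real) \<Rightarrow> real" where
  "holder_norm n a f =
     (\<Sum>k\<le>n. SUP x. \<bar>(deriv ^^ k) f x\<bar>) +
     (SUP (x, y) \<in> {(x, y). x \<noteq> y}.
        \<bar>(deriv ^^ n) f x - (deriv ^^ n) f y\<bar> / \<bar>x - y\<bar> powr a)"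

text \<open>\<open>D i j\<close> is the partial derivative of \<open>F\<close> of order \<open>i\<close> in the first and \<open>j\<close> in the second
  variable; together with continuity, this says that \<open>F\<close> is of class \<open>C^n\<close> on the open set \<open>S\<close>.\<close>

definition partials_on ::
  "nat \<Rightarrow> (real \<times> real) set \<Rightarrow> (real \<times> real \<Rightarrow> real) \<Rightarrow> (nat \<Rightarrow> nat \<Rightarrow> real \<times> real \<Rightarrow> real) \<Rightarrow> bool" where
  "partials_on n S F D \<longleftrightarrow>
     (\<forall>p\<in>S. D 0 0 p = F p) \<and>
     (\<forall>i j. i + j \<le> n \<longrightarrow> continuous_on S (D i j)) \<and>
     (\<forall>i j. i + j < n \<longrightarrow> (\<forall>x y. (x, y) \<in> S \<longrightarrow>
        ((\<lambda>t. D i j (t, y)) has_real_derivative D (Suc i) j (x, y)) (at x) \<and>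
        ((\<lambda>t. D i j (x, t)) has_real_derivative D i (Suc j) (x, y)) (at y)))"

text \<open>\<open>C^{n,a}\<close> up to the boundary of the open set \<open>S\<close>: all partial derivatives of order at most
  \<open>n\<close> extend to bounded continuous functions on the closure, those of order \<open>n\<close> are uniformly
  Hoelder continuous.\<close>

definition holder_closure :: "nat \<Rightarrow> real \<Rightarrow> (real \<times> real) set \<Rightarrow> (real \<times> real \<Rightarrow> real) set" where
  "holder_closure n a S = {F. \<exists>D. partials_on n S F D \<and>
     (\<forall>p\<in>closure S. D 0 0 p = F p) \<and>
     (\<forall>i j. i + j \<le> n \<longrightarrow> continuous_on (closure S) (D i j) \<and> bounded (D i j ` closure S)) \<and>
     (\<exists>C. \<forall>i j. i + j = n \<longrightarrow> (\<forall>p\<in>closure S. \<forall>q\<in>closure S.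
        \<bar>D i j p - D i j q\<bar> \<le> C * dist p q powr a))}"

definition harmonic2_on :: "(real \<times> real) set \<Rightarrow> (real \<times> real \<Rightarrow> real) \<Rightarrow> bool" where
  "harmonic2_on S F \<longleftrightarrow> (\<exists>D. partials_on 2 S F D \<and> (\<forall>p\<in>S. D 2 0 p + D 0 2 p = 0))"


section \<open>Dirichlet--Neumann operator of the strip\<close>

definition strip :: "real \<Rightarrow> (real \<times> real) set" where
  "strip h = {(x, y). -h < y \<and> y < 0}"

definition strip_solution ::
  "nat \<Rightarrow> real \<Rightarrow> real \<Rightarrow> (real \<Rightarrow> real) \<Rightarrow> (real \<times> real \<Rightarrow> real) \<Rightarrow> bool" where
  "strip_solution n a h w W \<longleftrightarrow>
     W \<in> holder_closure n a (strip h) \<and> harmonic2_on (strip h) W \<and>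
     (\<forall>x. W (x, -h) = 0) \<and> (\<forall>x. W (x, 0) = w x)"

text \<open>\<open>W\<close> is unique only on the closed strip, so the definite description is applied to the value
  of the one-sided normal derivative. The parameters \<open>n\<close> and \<open>a\<close> fix the class in which the
  Dirichlet problem is solved.\<close>

definition DN :: "nat \<Rightarrow> real \<Rightarrow> real \<Rightarrow> (real \<Rightarrow> real) \<Rightarrow> real \<Rightarrow> real" where
  "DN n a h w x = (THE d. \<exists>W. strip_solution n a h w W \<and>
     ((\<lambda>y. W (x, y)) has_real_derivative d) (at 0 within {-h..0}))"


section \<open>Spaces of almost periodic functions\<close>

definition freq_pairs :: "((nat \<Rightarrow> real) \<times> (nat \<Rightarrow> real)) set" where
  "freq_pairs = {(\<alpha>, \<beta>).
     (\<exists>k0. \<forall>k. \<alpha> k0 \<noteq> \<beta> k) \<and>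
     (\<forall>k l. \<exists>k1 k2 k3 k4 k5 k6.
        \<alpha> k + \<alpha> l = \<alpha> k1 \<and> \<alpha> k - \<alpha> l = \<alpha> k2 \<and>
        \<beta> k + \<beta> l = \<alpha> k3 \<and> \<beta> k - \<beta> l = \<alpha> k4 \<and>
        \<alpha> k + \<beta> l = \<beta> k5 \<and> \<alpha> k - \<beta> l = \<beta> k6)}"

text \<open>Elements are genuine Hoelder functions, so that pointwise conditions make sense. Their
  Fourier expansion is an identity in the quotient of \<open>B2\<close> by the functions of zero semi-norm,
  that is, the series converges to \<open>f\<close> in the Besicovitch semi-norm.\<close>

definition AP_space ::
  "(nat \<Rightarrow> real) \<Rightarrow> (nat \<Rightarrow> real) \<Rightarrow> nat \<Rightarrow> real \<Rightarrow> (real \<Rightarrow> real) set" where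
  "AP_space \<alpha> \<beta> n a = {f \<in> holder n a \<inter> B2. \<exists>m A B. has_mean f m \<and>
     (let r = (\<lambda>N x. f x - (m + (\<Sum>k<N. A k * cos (\<alpha> k * x)) + (\<Sum>k<N. B k * sin (\<beta> k * x))))
      in (\<forall>N. r N \<in> B2) \<and> (\<lambda>N. B2_seminorm (r N)) \<longlonglongrightarrow> 0)}"

definition AP_space0 ::
  "(nat \<Rightarrow> real) \<Rightarrow> (nat \<Rightarrow> real) \<Rightarrow> nat \<Rightarrow> real \<Rightarrow> (real \<Rightarrow> real) set" where
  "AP_space0 \<alpha> \<beta> n a = {f \<in> AP_space \<alpha> \<beta> n a. has_mean f 0}"


section \<open>The water wave problem\<close>

definition wave_solution ::
  "(nat \<Rightarrow> real) \<Rightarrow> (nat \<Rightarrow> real) \<Rightarrow> nat \<Rightarrow> real \<Rightarrow> real \<Rightarrow> real \<Rightarrow> real \<Rightarrow>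
   real \<Rightarrow> real \<Rightarrow> (real \<Rightarrow> real) \<Rightarrow> bool" where
  "wave_solution \<alpha> \<beta> n a g h \<gamma> lam mu w \<longleftrightarrow>
     w \<in> AP_space0 \<alpha> \<beta> n a \<and>
     (\<forall>x. (lam + \<gamma> * (DN n a h (\<lambda>t. (w t)\<^sup>2 / 2) x - w x - w x * DN n a h w x))\<^sup>2
        = (lam\<^sup>2 + mu - 2 * g * w x) *
          ((deriv w x)\<^sup>2 + (DN n a h w x)\<^sup>2 + 2 * DN n a h w x + 1)) \<and>
     (\<forall>x. w x > -h)"

text \<open>Bifurcation from the branch of trivial solutions \<open>(lam, (0, 0))\<close>.\<close>

definition bifurcation_value ::
  "(nat \<Rightarrow> real) \<Rightarrow> (nat \<Rightarrow> real) \<Rightarrow> nat \<Rightarrow> real \<Rightarrow> real \<Rightarrow> real \<Rightarrow> real \<Rightarrow> real \<Rightarrow> bool" where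
  "bifurcation_value \<alpha> \<beta> n a g h \<gamma> lam0 \<longleftrightarrow>
     (\<forall>lam. wave_solution \<alpha> \<beta> n a g h \<gamma> lam 0 (\<lambda>_. 0)) \<and>
     (\<forall>\<epsilon>>0. \<exists>lam mu w. wave_solution \<alpha> \<beta> n a g h \<gamma> lam mu w \<and>
        (mu, w) \<noteq> (0, \<lambda>_. 0) \<and> \<bar>lam - lam0\<bar> < \<epsilon> \<and> \<bar>mu\<bar> + holder_norm n a w < \<epsilon>)"

text \<open>A continuous curve of solutions through \<open>(lam0, (0, 0))\<close> with \<open>(mu s, w s) = (o(s), s \<phi> + o(s))\<close>.\<close>

definition solution_curve ::
  "(nat \<Rightarrow> real) \<Rightarrow> (nat \<Rightarrow> real) \<Rightarrow> nat \<Rightarrow> real \<Rightarrow> real \<Rightarrow> real \<Rightarrow> real \<Rightarrow> real \<Rightarrow> (real \<Rightarrow> real) \<Rightarrow> bool" where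
  "solution_curve \<alpha> \<beta> n a g h \<gamma> lam0 \<phi> \<longleftrightarrow>
     (\<exists>\<epsilon>>0. \<exists>(lam :: real \<Rightarrow> real) (mu :: real \<Rightarrow> real) (w :: real \<Rightarrow> real \<Rightarrow> real).
        (\<forall>s. \<bar>s\<bar> < \<epsilon> \<longrightarrow> wave_solution \<alpha> \<beta> n a g h \<gamma> (lam s) (mu s) (w s)) \<and>
        continuous_on {-\<epsilon><..<\<epsilon>} lam \<and>
        continuous_on {-\<epsilon><..<\<epsilon>} mu \<and>
        (\<forall>s0. \<bar>s0\<bar> < \<epsilon> \<longrightarrow> ((\<lambda>s. holder_norm n a (\<lambda>x. w s x - w s0 x)) \<longlongrightarrow> 0) (at s0)) \<and>
        lam 0 = lam0 \<and> mu 0 = 0 \<and> w 0 = (\<lambda>_. 0) \<and>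
        ((\<lambda>s. mu s / s) \<longlongrightarrow> 0) (at 0) \<and>
        ((\<lambda>s. holder_norm n a (\<lambda>x. w s x - s * \<phi> x) / s) \<longlongrightarrow> 0) (at 0))"

end

(* Multiples of the wave number of the leading mode are again admitted frequencies, so it suffices to
   construct periodic waves w = s W with W = cos (k (x + shift)) + v; the sine case is the cosine case
   shifted by a quarter period. On Fourier coefficients the Dirichlet-Neumann operator is the
   multiplier k coth (k h), and in spaces of coefficients with a polynomial weight all nonlinear terms
   are bounded bilinear maps. After division by s the equation for the corrections of mu / s, lambda
   and v is diagonal up to quadratic and O(s) terms: the mean determines mu / s, the critical mode
   determines lambda by transversality, and the remaining modes are invertible because k coth (k h)
   is strictly increasing. Hence it is a contraction for small s. Bounded solutions of the Dirichlet
   problem on the strip are unique by a maximum principle, which identifies the operator of the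
   statement with the multiplier. *)
theory Submission
  imports Defs
begin

section \<open>Uniqueness for the Dirichlet problem on the strip\<close>

text \<open>The obstacle is the loss of one derivative in the Dirichlet-Neumann operator. It is met
  by measuring the profile with weight exponent \<open>n + 3\<close> and the terms of the equation
  with exponent \<open>n + 2\<close>. Inverting the linear part gains this power back, because the
  gap between the symbols of mode k and mode 1 grows linearly in k and does not merely stay
  positive. Coefficients are stored already multiplied by their weight, so that both scales are the
  same space of bounded sequences and the iteration acts on one space. The exponent
  \<open>n + 3\<close> leaves two powers beyond the \<open>n + 1\<close> derivatives that are
  controlled, and these two make the series converge. The linear part is a multiple of the square of
  the bifurcation value, which is nonzero because g > 0.\<close>

lemma second_derivative_nonpos_at_local_max:
  fixes f f' :: "real \<Rightarrow> real"
  assumes e: "e > 0" and f: "\<And>t. \<bar>t - x\<bar> < e \<Longrightarrow> (f has_real_derivative f' t) (at t)"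
    and f': "(f' has_real_derivative d) (at x)"
    and max: "\<And>t. \<bar>t - x\<bar> < e \<Longrightarrow> f t \<le> f x"
  shows "d \<le> 0"
proof (rule ccontr)
  assume "\<not> d \<le> 0"
  have 0: "f' x = 0"
    using DERIV_local_max[OF f[of x] e] max e by (simp add: abs_minus_commute)
  \<comment> \<open>If \<open>d\<close> were positive, \<open>f'\<close> would be positive just to
    the right of its zero \<open>x\<close>, and by the mean value theorem \<open>f\<close> would
    exceed \<open>f x\<close> there.\<close>
  obtain r where r: "r > 0" "\<And>s. s > 0 \<Longrightarrow> s < r \<Longrightarrow> f' x < f' (x + s)"
    using DERIV_pos_inc_right[OF f'] \<open>\<not> d \<le> 0\<close> by auto
  define t where "t = min r e / 2"
  have t: "t > 0" "t < r" "t < e" using r(1) e by (auto simp: t_def)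
  have "\<exists>z>x. z < x + t \<and> f (x + t) - f x = (x + t - x) * f' z"
    using t by (intro MVT2 f) auto
  then obtain z where z: "x < z" "z < x + t" "f (x + t) - f x = (x + t - x) * f' z" by blast
  have "f' z > 0" using r(2)[of "z - x"] z t 0 by simp
  then have "f (x + t) > f x" using z t by (simp add: algebra_simps)
  with max[of "x + t"] t show False by simp
qed

lemma closure_strip:
  assumes "h > 0" shows "closure (strip h) = UNIV \<times> {-h..0}"
proof -
  have "strip h = UNIV \<times> {-h<..<0}" by (auto simp: strip_def)
  then show ?thesis using assms by (simp add: closure_Times)
qed

text \<open>The barrier \<open>b = x\<^sup>2 - 2 y\<^sup>2 + 2 h\<^sup>2\<close> is nonnegative on the strip, tends to infinity with \<open>x\<close>
  and satisfies \<open>\<Delta> b = - 2\<close>; thus \<open>u - \<epsilon> b\<close> has no interior maximum.\<close>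

lemma strip_max_principle:
  assumes h: "h > 0" and cont: "continuous_on (UNIV \<times> {-h..0}) u"
    and bnd: "\<And>p. p \<in> UNIV \<times> {-h..0} \<Longrightarrow> \<bar>u p\<bar> \<le> M"
    and harm: "harmonic2_on (strip h) u"
    and bot: "\<And>x. u (x, -h) = 0" and top: "\<And>x. u (x, 0) = 0"
    and y0: "-h \<le> y0" "y0 \<le> 0"
  shows "u (x0, y0) \<le> 0"
proof (rule ccontr)
  assume "\<not> u (x0, y0) \<le> 0"
  then have pos: "u (x0, y0) > 0" by simp
  obtain D where D: "partials_on 2 (strip h) u D" and lap: "\<And>p. p \<in> strip h \<Longrightarrow> D 2 0 p + D 0 2 p = 0"
    using harm unfolding harmonic2_on_def by blast
  define b where "b = (\<lambda>p::real\<times>real. (fst p)\<^sup>2 - 2 * (snd p)\<^sup>2 + 2 * h\<^sup>2)"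
  have b_ge: "b (x, y) \<ge> x\<^sup>2" if "-h \<le> y" "y \<le> 0" for x y
  proof -
    have "y\<^sup>2 \<le> h\<^sup>2" using that by (metis abs_le_square_iff abs_of_nonpos abs_of_pos h minus_le_iff)
    then show ?thesis by (simp add: b_def)
  qed
  \<comment> \<open>Small enough that \<open>\<epsilon> * b\<close> takes away at most half of the
    positive value at \<open>(x0, y0)\<close>; the added 1 covers
    \<open>b (x0, y0) = 0\<close>.\<close>
  define \<epsilon> where "\<epsilon> = u (x0, y0) / (2 * (b (x0, y0) + 1))"
  have b0: "b (x0, y0) \<ge> 0" using b_ge[OF y0, of x0] by (smt (verit) zero_le_power2)
  have \<epsilon>: "\<epsilon> > 0" unfolding \<epsilon>_def using pos b0 by simp
  have M: "M > 0" using bnd[of "(x0, y0)"] pos y0 by auto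
  define v where "v = (\<lambda>p. u p - \<epsilon> * b p)"
  have v0: "v (x0, y0) > 0"
  proof -
    have "\<epsilon> * b (x0, y0) \<le> \<epsilon> * (b (x0,y0) + 1)" using \<epsilon> by simp
    also have "\<dots> = u (x0, y0) / 2" unfolding \<epsilon>_def using b0 by (simp add: field_simps)
    finally show ?thesis using pos by (simp add: v_def)
  qed
  \<comment> \<open>On the sides \<open>\<bar>x\<bar> = R\<close> the barrier outweighs the bound
    \<open>M\<close>, and \<open>u\<close> vanishes at top and bottom, so a positive maximum of
    \<open>v\<close> over the rectangle is interior.\<close>
  define R where "R = \<bar>x0\<bar> + 1 + M / \<epsilon>"
  have R: "R > \<bar>x0\<bar>" "R \<ge> 1" "\<epsilon> * R\<^sup>2 \<ge> M"
  proof -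
    have "M / \<epsilon> > 0" using M \<epsilon> by simp
    then show "R > \<bar>x0\<bar>" "R \<ge> 1" unfolding R_def by auto
    then have "R * 1 \<le> R * R" by (intro mult_left_mono) auto
    moreover have "R \<ge> M / \<epsilon>" unfolding R_def by simp
    ultimately have "M / \<epsilon> \<le> R\<^sup>2" by (simp add: power2_eq_square)
    then show "\<epsilon> * R\<^sup>2 \<ge> M" using \<epsilon> by (simp add: field_simps)
  qed
  define K where "K = {-R..R} \<times> {-h..0}"
  have "compact K" by (simp add: K_def compact_Times)
  moreover have K0: "(x0, y0) \<in> K" using R y0 by (auto simp: K_def)
  moreover have "continuous_on K v" unfolding v_def b_def
    by (intro continuous_intros continuous_on_subset[OF cont]) (auto simp: K_def)
  ultimately obtain p where p: "p \<in> K" "\<And>q. q \<in> K \<Longrightarrow> v q \<le> v p"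
    using continuous_attains_sup[of K v] by blast
  obtain x1 y1 where xy: "p = (x1, y1)" by (cases p)
  have vp: "v (x1, y1) > 0" using p(2)[OF K0] v0 xy by simp
  have ub: "v (x1, y1) \<le> u (x1, y1) - \<epsilon> * x1\<^sup>2"
    using b_ge[of y1 x1] p(1) \<epsilon> xy by (auto simp: v_def K_def)
  have y1: "-h < y1" "y1 < 0"
  proof -
    have "0 \<le> \<epsilon> * x1\<^sup>2" using \<epsilon> by simp
    then have "u (x1, y1) > 0" using ub vp by linarith
    then have "y1 \<noteq> -h" "y1 \<noteq> 0" using bot[of x1] top[of x1] by auto
    then show "-h < y1" "y1 < 0" using p(1) xy by (auto simp: K_def)
  qed
  have x1: "-R < x1" "x1 < R"
  proof -
    have "x1\<^sup>2 \<noteq> R\<^sup>2" using ub vp R(3) bnd[of "(x1,y1)"] y1 by auto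
    then have "x1 \<noteq> R" "x1 \<noteq> -R" by auto
    then show "-R < x1" "x1 < R" using p(1) xy by (auto simp: K_def)
  qed
  have S: "(t, y1) \<in> strip h" for t using y1 by (simp add: strip_def)
  have D0: "\<And>p. p \<in> strip h \<Longrightarrow> D 0 0 p = u p"
    and Dx: "\<And>i j x y. i + j < 2 \<Longrightarrow> (x, y) \<in> strip h \<Longrightarrow>
      ((\<lambda>t. D i j (t, y)) has_real_derivative D (Suc i) j (x, y)) (at x)"
    and Dy: "\<And>i j x y. i + j < 2 \<Longrightarrow> (x, y) \<in> strip h \<Longrightarrow>
      ((\<lambda>t. D i j (x, t)) has_real_derivative D i (Suc j) (x, y)) (at y)"
    using D unfolding partials_on_def by blast+
  have "D 2 0 (x1, y1) - \<epsilon> * 2 \<le> 0"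
  proof (rule second_derivative_nonpos_at_local_max)
    show "min (R - x1) (x1 + R) > 0" using x1 by simp
    show "((\<lambda>t. D 0 0 (t, y1) - \<epsilon> * b (t, y1)) has_real_derivative D 1 0 (t, y1) - \<epsilon> * (2 * t)) (at t)" for t
      unfolding b_def by (auto intro!: derivative_eq_intros Dx[of 0 0, simplified] S)
    show "((\<lambda>t. D 1 0 (t, y1) - \<epsilon> * (2 * t)) has_real_derivative D 2 0 (x1, y1) - \<epsilon> * 2) (at x1)"
      using Dx[of 1 0 x1 y1] S by (auto intro!: derivative_eq_intros simp: numeral_2_eq_2)
    show "D 0 0 (t, y1) - \<epsilon> * b (t, y1) \<le> D 0 0 (x1, y1) - \<epsilon> * b (x1, y1)"
      if "\<bar>t - x1\<bar> < min (R - x1) (x1 + R)" for t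
      proof -
      have "(t, y1) \<in> K" using that y1 unfolding K_def by (simp add: abs_if split: if_splits)
      then show ?thesis using p(2) S D0 xy by (simp add: v_def)
    qed
  qed
  moreover have "D 0 2 (x1, y1) - \<epsilon> * (-4) \<le> 0"
  proof (rule second_derivative_nonpos_at_local_max)
    show "min (- y1) (y1 + h) > 0" using y1 by simp
    have S': "(x1, t) \<in> strip h" if "\<bar>t - y1\<bar> < min (- y1) (y1 + h)" for t
      using that by (auto simp: strip_def)
    show "((\<lambda>t. D 0 0 (x1, t) - \<epsilon> * b (x1, t)) has_real_derivative D 0 1 (x1, t) - \<epsilon> * (- 4 * t)) (at t)"
      if "\<bar>t - y1\<bar> < min (- y1) (y1 + h)" for t
      unfolding b_def using Dy[of 0 0, OF _ S'[OF that]] by (auto intro!: derivative_eq_intros)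
    show "((\<lambda>t. D 0 1 (x1, t) - \<epsilon> * (- 4 * t)) has_real_derivative D 0 2 (x1, y1) - \<epsilon> * (-4)) (at y1)"
      using Dy[of 0 1 x1 y1] S by (auto intro!: derivative_eq_intros simp: numeral_2_eq_2)
    show "D 0 0 (x1, t) - \<epsilon> * b (x1, t) \<le> D 0 0 (x1, y1) - \<epsilon> * b (x1, y1)"
      if "\<bar>t - y1\<bar> < min (- y1) (y1 + h)" for t
      proof -
      have "(x1, t) \<in> K" using that x1 unfolding K_def by (simp add: abs_if split: if_splits)
      then show ?thesis using p(2) S S'[OF that] D0 xy by (simp add: v_def)
    qed
  qed
  ultimately show False using lap[OF S, of x1] \<epsilon> by simp
qed

lemma partials_on_diff:
  assumes "partials_on n S F D" and "partials_on n S G E"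
  shows "partials_on n S (\<lambda>p. F p - G p) (\<lambda>i j p. D i j p - E i j p)"
  using assms unfolding partials_on_def by (auto intro!: continuous_intros derivative_intros)

lemma harmonic2_on_diff:
  assumes "harmonic2_on S F" and "harmonic2_on S G"
  shows "harmonic2_on S (\<lambda>p. F p - G p)"
proof -
  obtain D where D: "partials_on 2 S F D" "\<And>p. p \<in> S \<Longrightarrow> D 2 0 p + D 0 2 p = 0"
    using assms(1) unfolding harmonic2_on_def by blast
  obtain E where E: "partials_on 2 S G E" "\<And>p. p \<in> S \<Longrightarrow> E 2 0 p + E 0 2 p = 0"
    using assms(2) unfolding harmonic2_on_def by blast
  have "\<forall>p\<in>S. (D 2 0 p - E 2 0 p) + (D 0 2 p - E 0 2 p) = 0"
    using D(2) E(2) by (simp add: algebra_simps) (metis add_diff_cancel_left' add_diff_eq diff_0)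
  then show ?thesis unfolding harmonic2_on_def
    using partials_on_diff[OF D(1) E(1)] by (intro exI[of _ "\<lambda>i j p. D i j p - E i j p"]) auto
qed

lemma holder_closure_continuous_bounded:
  assumes "F \<in> holder_closure n a S"
  shows "continuous_on (closure S) F" and "bounded (F ` closure S)"
proof -
  obtain D where D: "\<forall>p\<in>closure S. D 0 0 p = F p"
      "\<forall>i j. i + j \<le> n \<longrightarrow> continuous_on (closure S) (D i j) \<and> bounded (D i j ` closure S)"
    using assms unfolding holder_closure_def by blast
  then have "continuous_on (closure S) (D 0 0)" "bounded (D 0 0 ` closure S)" by (metis add_0 le0)+
  note D = D(1) this
  show "continuous_on (closure S) F" using D continuous_on_cong by metis
  show "bounded (F ` closure S)" using D by (metis image_cong)
qed

text \<open>The Hoelder class supplies the boundedness without which the maximum principle fails on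
  the unbounded strip.\<close>

lemma strip_solution_le:
  assumes h: "h > 0" and W: "strip_solution n a h w W" and V: "strip_solution n a h w V"
    and y: "-h \<le> y" "y \<le> 0"
  shows "W (x, y) - V (x, y) \<le> 0"
proof -
  obtain A B where A: "\<forall>p\<in>closure (strip h). norm (W p) \<le> A" and B: "\<forall>p\<in>closure (strip h). norm (V p) \<le> B"
    using holder_closure_continuous_bounded(2) W V unfolding strip_solution_def bounded_iff by fastforce
  have AB: "\<bar>W p - V p\<bar> \<le> A + B" if "p \<in> UNIV \<times> {-h..0}" for p
    using A B that closure_strip[OF h] by (smt (verit) real_norm_def)
  have c: "continuous_on (UNIV \<times> {-h..0}) (\<lambda>p. W p - V p)"
    using holder_closure_continuous_bounded(1) W V closure_strip[OF h]
    unfolding strip_solution_def by (auto intro!: continuous_intros; metis)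
  have hm: "harmonic2_on (strip h) (\<lambda>p. W p - V p)"
    using W V harmonic2_on_diff unfolding strip_solution_def by blast
  show ?thesis
    using strip_max_principle[OF h c AB hm _ _ y] W V unfolding strip_solution_def by simp
qed

lemma strip_solution_unique:
  assumes "h > 0" and "strip_solution n a h w W" and "strip_solution n a h w V"
    and "-h \<le> y" "y \<le> 0"
  shows "W (x, y) = V (x, y)"
  using strip_solution_le[OF assms] strip_solution_le[OF assms(1,3,2,4,5)] by (smt (verit))

text \<open>Any solution agrees with \<open>W\<close> on the closed strip, and 0 is a limit point of
  \<open>{-h..0}\<close>, so one solution with its one-sided derivative settles the definite
  description.\<close>

lemma DN_eqI:
  assumes h: "h > 0" and W: "strip_solution n a h w W"
    and d: "((\<lambda>y. W (x, y)) has_real_derivative d) (at 0 within {-h..0})"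
  shows "DN n a h w x = d"
  unfolding DN_def
proof (rule the_equality)
  show "\<exists>W. strip_solution n a h w W \<and> ((\<lambda>y. W (x, y)) has_real_derivative d) (at 0 within {-h..0})"
    using W d by blast
next
  fix e
  assume "\<exists>W. strip_solution n a h w W \<and> ((\<lambda>y. W (x, y)) has_real_derivative e) (at 0 within {-h..0})"
  then obtain V where V: "strip_solution n a h w V"
    and e: "((\<lambda>y. V (x, y)) has_real_derivative e) (at 0 within {-h..0})" by blast
  have "((\<lambda>y. W (x, y)) has_real_derivative e) (at 0 within {-h..0})"
    by (rule has_field_derivative_transform_within[OF e, of 1])
      (use strip_solution_unique[OF h V W] h in auto)
  moreover have "at (0::real) within {-h..0} \<noteq> bot"
    using h by (simp add: at_within_Icc_at_left trivial_limit_at_left_real)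
  ultimately show "e = d" using d tendsto_unique unfolding has_field_derivative_iff by blast
qed

section \<open>Cosine series and the Dirichlet--Neumann operator\<close>

text \<open>Stated within a convex set in order to reach the one-sided vertical derivatives at the
  boundary of the strip.\<close>

lemma suminf_has_derivative_within:
  fixes f f' :: "nat \<Rightarrow> real \<Rightarrow> real"
  assumes S: "convex S"
    and f: "\<And>k x. x \<in> S \<Longrightarrow> (f k has_real_derivative f' k x) (at x within S)"
    and f': "\<And>k x. x \<in> S \<Longrightarrow> \<bar>f' k x\<bar> \<le> M k" and M: "summable M"
    and sm: "\<And>x. x \<in> S \<Longrightarrow> summable (\<lambda>k. f k x)" and x: "x \<in> S"
  shows "((\<lambda>x. \<Sum>k. f k x) has_real_derivative (\<Sum>k. f' k x)) (at x within S)"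
proof -
  have "uniform_limit S (\<lambda>n x. \<Sum>i<n. f' i x) (\<lambda>x. \<Sum>k. f' k x) sequentially"
    by (rule Weierstrass_m_test[OF _ M]) (use f' in auto)
  from has_field_derivative_series[OF S f this x sm[OF x]]
  obtain g where g: "\<And>x. x \<in> S \<Longrightarrow> (\<lambda>n. f n x) sums g x"
    "\<And>x. x \<in> S \<Longrightarrow> (g has_real_derivative (\<Sum>k. f' k x)) (at x within S)" by blast
  show ?thesis
    by (rule has_field_derivative_transform_within[OF g(2)[OF x] zero_less_one x])
      (use g(1) sums_unique in blast)
qed

text \<open>For \<open>d \<le> 1\<close> the Lipschitz bound is the stronger one, since then
  \<open>d \<le> d powr a\<close>; for larger \<open>d\<close> plain boundedness suffices.\<close>

lemma lipschitz_imp_holder_bound: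
  fixes d L a :: real
  assumes "0 < a" "a < 1" "0 \<le> d" "e \<le> L * d" "e \<le> L" "0 \<le> L"
  shows "e \<le> L * d powr a"
proof (cases "d \<le> 1")
  case True
  have "d \<le> d powr a"
  proof (cases "d = 0")
    case False
    then have "d powr 1 \<le> d powr a" using True assms by (intro powr_mono') auto
    then show ?thesis using False assms by simp
  qed simp
  then have "L * d \<le> L * d powr a" using assms by (intro mult_left_mono)
  then show ?thesis using assms by simp
next
  case False
  then have "1 \<le> d powr a" using assms by (intro ge_one_powr_ge_zero) auto
  then have "L * 1 \<le> L * d powr a" using assms by (intro mult_left_mono)
  then show ?thesis using assms by simp
qed

text \<open>The excess of \<open>cosh t\<close> over \<open>sinh t\<close> is
  \<open>exp (- t) \<le> 1\<close>, and \<open>sinh t \<ge> t\<close>.\<close>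

lemma coth_le:
  assumes "t > (0::real)" shows "cosh t / sinh t \<le> 1 + 1 / t"
proof -
  have s: "sinh t > 0" using assms by simp
  have ge: "t \<le> sinh t"
  proof -
    have "\<exists>z>0. z < t \<and> sinh t - sinh 0 = (t - 0) * cosh z"
      using assms by (intro MVT2) (auto intro!: derivative_eq_intros)
    then obtain z where "sinh t = t * cosh z" by auto
    then show ?thesis using assms cosh_real_ge_1[of z] mult_left_mono[of 1 "cosh z" t] by simp
  qed
  have "cosh t = sinh t + exp (- t)" using cosh_minus_sinh[of t] by simp
  moreover have "exp (- t) \<le> 1" using assms by simp
  moreover have "1 \<le> sinh t / t" using ge assms by simp
  ultimately have "cosh t \<le> sinh t + sinh t / t" by linarith
  then show ?thesis using s assms by (simp add: field_simps)
qed

section \<open>Cosine series and their Hoelder norms\<close>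

locale wave_frame =
  fixes \<kappa> \<theta> h a :: real and n :: nat
  assumes \<kappa>: "\<kappa> > 0" and h: "h > 0" and a: "0 < a" "a < 1" and n: "n \<ge> 1"
begin

text \<open>The \<open>m\<close>-th derivative of mode \<open>k\<close>; a phase of a quarter period
  per derivative lets one formula serve all orders.\<close>

definition cos_term :: "nat \<Rightarrow> nat \<Rightarrow> real \<Rightarrow> real" where
  "cos_term m k x = (real k * \<kappa>) ^ m * cos (real k * (\<kappa> * x + \<theta>) + real m * pi / 2)"

text \<open>The derivative of order \<open>j\<close> of the vertical profile of the harmonic extension of
  \<open>cos (k (\<kappa> x + \<theta>))\<close>; the mean \<open>k = 0\<close> extends linearly.\<close>

definition profile :: "nat \<Rightarrow> nat \<Rightarrow> real \<Rightarrow> real" where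
  "profile j k y =
     (if k = 0 then (if j = 0 then (y + h) / h else if j = 1 then 1 / h else 0)
      else (real k * \<kappa>) ^ j *
        ((if even j then sinh (real k * \<kappa> * (y + h)) else cosh (real k * \<kappa> * (y + h))) / sinh (real k * \<kappa> * h)))"

text \<open>Equal to \<open>real k * \<kappa>\<close> times coth of
  \<open>real k * \<kappa> * h\<close>, and to \<open>1 / h\<close> for the mean.\<close>

definition dn_symbol :: "nat \<Rightarrow> real" where
  "dn_symbol k = profile 1 k 0"

definition cos_series :: "(nat \<Rightarrow> real) \<Rightarrow> real \<Rightarrow> real" where
  "cos_series b x = (\<Sum>k. b k * cos (real k * (\<kappa> * x + \<theta>)))"

text \<open>One derivative more than \<open>n\<close> is summable, so that the \<open>n\<close>-th
  derivative is Lipschitz and therefore Hoelder for every exponent below 1.\<close>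

definition admissible :: "(nat \<Rightarrow> real) \<Rightarrow> bool" where
  "admissible b \<longleftrightarrow> summable (\<lambda>k. \<bar>b k\<bar> * (1 + real k) ^ (n + 1))"

definition coeff_norm :: "(nat \<Rightarrow> real) \<Rightarrow> real" where
  "coeff_norm b = (\<Sum>k. \<bar>b k\<bar> * (1 + real k) ^ (n + 1))"

text \<open>Bounds coth at all multiples of \<open>\<kappa> * h\<close> through
  \<open>coth_le\<close>; the summand \<open>1 / h\<close> accounts for the slope of the linear
  profile of the mean.\<close>

definition profile_bound :: real where
  "profile_bound = 1 + 1 / h + 1 / (\<kappa> * h)"

lemma profile_bound_ge: "profile_bound \<ge> 1" "profile_bound \<ge> 1 / h"
  using \<kappa> h by (auto simp: profile_bound_def)

lemma cos_term_deriv: "(cos_term m k has_real_derivative cos_term (Suc m) k x) (at x)"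
proof -
  have "cos (real k * (\<kappa> * x + \<theta>) + real (Suc m) * pi / 2) = - sin (real k * (\<kappa> * x + \<theta>) + real m * pi / 2)"
  proof -
    have "real k * (\<kappa> * x + \<theta>) + real (Suc m) * pi / 2 = real k * (\<kappa> * x + \<theta>) + real m * pi / 2 + pi / 2"
      by (simp add: field_simps)
    then show ?thesis by (simp only: cos_add) simp
  qed
  then show ?thesis unfolding cos_term_def
    by (auto intro!: derivative_eq_intros simp: algebra_simps)
qed

lemma profile_deriv: "(profile j k has_real_derivative profile (Suc j) k y) (at y)"
proof (cases "k = 0")
  case True
  then have "profile j k = (\<lambda>y. if j = 0 then (y + h) / h else if j = 1 then 1 / h else 0)"
    by (auto simp: profile_def)
  with True show ?thesis using h
    by (auto simp: profile_def intro!: derivative_eq_intros)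
next
  case False
  then have "profile j k = (\<lambda>y. (real k * \<kappa>) ^ j *
        ((if even j then sinh (real k * \<kappa> * (y + h)) else cosh (real k * \<kappa> * (y + h))) / sinh (real k * \<kappa> * h)))"
    by (auto simp: profile_def)
  with False \<kappa> h show ?thesis
    by (cases "even j") (auto simp: profile_def intro!: derivative_eq_intros)
qed

lemma cos_term_le: "\<bar>cos_term m k x\<bar> \<le> ((1 + \<kappa>) * (1 + real k)) ^ m"
proof -
  have "real k * \<kappa> \<le> (1 + real k) * (1 + \<kappa>)" using \<kappa> by (intro mult_mono) auto
  then have "(real k * \<kappa>) ^ m \<le> ((1 + \<kappa>) * (1 + real k)) ^ m"
    using \<kappa> by (intro power_mono) (auto simp: mult.commute)
  moreover have "\<bar>cos_term m k x\<bar> \<le> (real k * \<kappa>) ^ m * 1"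
    unfolding cos_term_def abs_mult using \<kappa> by (intro mult_mono) auto
  ultimately show ?thesis by simp
qed

lemma profile_le:
  assumes y: "-h \<le> y" "y \<le> 0"
  shows "\<bar>profile j k y\<bar> \<le> profile_bound * ((1 + \<kappa>) * (1 + real k)) ^ j"
proof (cases "k = 0")
  case True
  have 1: "(1 + \<kappa>) ^ j \<ge> 1" using \<kappa> by simp
  have "\<bar>profile j k y\<bar> \<le> max 1 (1 / h)"
  proof -
    have "0 \<le> (y + h) / h" "(y + h) / h \<le> 1" using y h by simp_all
    then show ?thesis using True h by (auto simp: profile_def le_max_iff_disj)
  qed
  also have "\<dots> \<le> profile_bound" using profile_bound_ge by simp
  also have "\<dots> \<le> profile_bound * (1 + \<kappa>) ^ j"
    using mult_left_mono[OF 1, of profile_bound] profile_bound_ge(1) by simp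
  finally show ?thesis using True by simp
next
  case False
  define t where "t = real k * \<kappa> * h"
  have k1: "real k \<ge> 1" using False by simp
  have t: "t > 0" using False \<kappa> h by (simp add: t_def)
  have tge: "\<kappa> * h \<le> t" using mult_right_mono[OF k1, of "\<kappa> * h"] \<kappa> h by (simp add: t_def mult.assoc)
  have r: "0 \<le> real k * \<kappa> * (y + h)" "real k * \<kappa> * (y + h) \<le> t"
    using y \<kappa> h by (auto simp: t_def intro!: mult_nonneg_nonneg mult_left_mono)
  have cc: "cosh (real k * \<kappa> * (y + h)) \<le> cosh t" using r t by (simp add: cosh_real_nonneg_le_iff)
  have ss: "\<bar>sinh (real k * \<kappa> * (y + h))\<bar> \<le> cosh t"
    using cc r sinh_le_cosh_real[of "real k * \<kappa> * (y + h)"] by simp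
  have "\<bar>(if even j then sinh (real k * \<kappa> * (y + h)) else cosh (real k * \<kappa> * (y + h))) / sinh t\<bar> \<le> cosh t / sinh t"
    using cc ss t by (auto simp: divide_right_mono)
  also have "\<dots> \<le> 1 + 1 / t" by (rule coth_le[OF t])
  also have "\<dots> \<le> profile_bound"
    unfolding profile_bound_def using tge \<kappa> h t
    by (smt (verit) divide_nonneg_pos frac_le mult_pos_pos)
  finally have 1: "\<bar>(if even j then sinh (real k * \<kappa> * (y + h)) else cosh (real k * \<kappa> * (y + h))) / sinh t\<bar>
      \<le> profile_bound" .
  have "real k * \<kappa> \<le> (1 + real k) * (1 + \<kappa>)" using \<kappa> by (intro mult_mono) auto
  then have "(real k * \<kappa>) ^ j \<le> ((1 + \<kappa>) * (1 + real k)) ^ j"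
    using \<kappa> by (intro power_mono) (auto simp: mult.commute)
  then have "(real k * \<kappa>) ^ j * \<bar>(if even j then sinh (real k * \<kappa> * (y + h)) else cosh (real k * \<kappa> * (y + h))) / sinh t\<bar>
     \<le> ((1 + \<kappa>) * (1 + real k)) ^ j * profile_bound"
    using 1 \<kappa> by (intro mult_mono) auto
  moreover have "\<bar>profile j k y\<bar> = (real k * \<kappa>) ^ j * \<bar>(if even j then sinh (real k * \<kappa> * (y + h)) else cosh (real k * \<kappa> * (y + h))) / sinh t\<bar>"
    using False \<kappa> by (simp add: profile_def abs_mult power_abs t_def)
  ultimately show ?thesis by (simp add: mult.commute)
qed

lemma cos_term_0: "cos_term 0 k x = cos (real k * (\<kappa> * x + \<theta>))"
  by (simp add: cos_term_def)

text \<open>Any factor that grows at most like the power \<open>n + 1\<close> of the mode is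
  absorbed by the weight. All bounds for derivatives of the series and of its extension are
  instances.\<close>

lemma admissible_bound:
  assumes b: "admissible b" and m: "m \<le> n + 1" and C: "C \<ge> 0"
    and f: "\<And>k. \<bar>f k\<bar> \<le> C * ((1 + \<kappa>) * (1 + real k)) ^ m"
  shows "\<bar>b k * f k\<bar> \<le> C * (1 + \<kappa>) ^ (n + 1) * (\<bar>b k\<bar> * (1 + real k) ^ (n + 1))" (is ?A)
    and "summable (\<lambda>k. b k * f k)" (is ?B)
    and "\<bar>\<Sum>k. b k * f k\<bar> \<le> C * (1 + \<kappa>) ^ (n + 1) * coeff_norm b" (is ?C)
proof -
  have A: "\<bar>b k * f k\<bar> \<le> C * (1 + \<kappa>) ^ (n + 1) * (\<bar>b k\<bar> * (1 + real k) ^ (n + 1))" for k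
  proof -
    have "1 * 1 \<le> (1 + \<kappa>) * (1 + real k)" using \<kappa> by (intro mult_mono) auto
    then have "((1 + \<kappa>) * (1 + real k)) ^ m \<le> ((1 + \<kappa>) * (1 + real k)) ^ (n + 1)"
      using m by (intro power_increasing) auto
    then have "C * ((1 + \<kappa>) * (1 + real k)) ^ m \<le> C * ((1 + \<kappa>) * (1 + real k)) ^ (n + 1)"
      using C by (rule mult_left_mono)
    then have "\<bar>f k\<bar> \<le> C * ((1 + \<kappa>) * (1 + real k)) ^ (n + 1)" using f[of k] by linarith
    then have "\<bar>b k\<bar> * \<bar>f k\<bar> \<le> \<bar>b k\<bar> * (C * ((1 + \<kappa>) * (1 + real k)) ^ (n + 1))"
      by (intro mult_left_mono) auto
    then show ?thesis by (simp add: abs_mult power_mult_distrib mult_ac)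
  qed
  have sm: "summable (\<lambda>k. C * (1 + \<kappa>) ^ (n + 1) * (\<bar>b k\<bar> * (1 + real k) ^ (n + 1)))"
    using b unfolding admissible_def by (rule summable_mult)
  show ?A by (rule A)
  show ?B by (rule summable_comparison_test'[OF sm, of 0]) (use A in auto)
  have "\<bar>\<Sum>k. b k * f k\<bar> \<le> (\<Sum>k. \<bar>b k * f k\<bar>)"
    by (rule summable_rabs, rule summable_comparison_test'[OF sm, of 0]) (use A in auto)
  also have "\<dots> \<le> (\<Sum>k. C * (1 + \<kappa>) ^ (n + 1) * (\<bar>b k\<bar> * (1 + real k) ^ (n + 1)))"
    by (rule suminf_le[OF A _ sm], rule summable_comparison_test'[OF sm, of 0]) (use A in auto)
  also have "\<dots> = C * (1 + \<kappa>) ^ (n + 1) * coeff_norm b"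
    unfolding coeff_norm_def using b unfolding admissible_def by (rule suminf_mult)
  finally show ?C .
qed

lemma coeff_norm_nonneg: "admissible b \<Longrightarrow> coeff_norm b \<ge> 0"
  unfolding coeff_norm_def admissible_def by (intro suminf_nonneg) auto

lemma cos_term_series:
  assumes "admissible b" and "m \<le> n + 1"
  shows "\<bar>b k * cos_term m k x\<bar> \<le> (1 + \<kappa>) ^ (n + 1) * (\<bar>b k\<bar> * (1 + real k) ^ (n + 1))"
    and "summable (\<lambda>k. b k * cos_term m k x)"
    and "\<bar>\<Sum>k. b k * cos_term m k x\<bar> \<le> (1 + \<kappa>) ^ (n + 1) * coeff_norm b"
  using admissible_bound[OF assms, of 1 "\<lambda>k. cos_term m k x"] cos_term_le by simp_all

definition cos_series_deriv :: "nat \<Rightarrow> (nat \<Rightarrow> real) \<Rightarrow> real \<Rightarrow> real" where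
  "cos_series_deriv m b x = (\<Sum>k. b k * cos_term m k x)"

lemma cos_series_deriv_0: "cos_series_deriv 0 b = cos_series b"
  by (simp add: cos_series_deriv_def cos_series_def cos_term_0 fun_eq_iff)

lemma cos_series_deriv_has_derivative:
  assumes b: "admissible b" and m: "m \<le> n"
  shows "(cos_series_deriv m b has_real_derivative cos_series_deriv (Suc m) b x) (at x)"
  unfolding cos_series_deriv_def
proof (rule suminf_has_derivative_within[where S = UNIV])
  show "summable (\<lambda>k. (1 + \<kappa>) ^ (n + 1) * (\<bar>b k\<bar> * (1 + real k) ^ (n + 1)))"
    using b unfolding admissible_def by (rule summable_mult)
  show "\<bar>b k * cos_term (Suc m) k x\<bar> \<le> (1 + \<kappa>) ^ (n + 1) * (\<bar>b k\<bar> * (1 + real k) ^ (n + 1))" for k x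
    using cos_term_series(1)[OF b, of "Suc m"] m by simp
  show "summable (\<lambda>k. b k * cos_term m k x)" for x
    using cos_term_series(2)[OF b, of m] m by simp
qed (auto intro!: derivative_eq_intros cos_term_deriv)

lemma deriv_cos_series:
  assumes b: "admissible b" and m: "m \<le> n + 1"
  shows "(deriv ^^ m) (cos_series b) = cos_series_deriv m b"
  using m
proof (induction m)
  case (Suc m)
  then show ?case using cos_series_deriv_has_derivative[OF b, of m]
    by (auto intro!: DERIV_imp_deriv)
qed (simp add: cos_series_deriv_0)

lemma cos_series_deriv_le:
  assumes "admissible b" and "m \<le> n + 1"
  shows "\<bar>cos_series_deriv m b x\<bar> \<le> (1 + \<kappa>) ^ (n + 1) * coeff_norm b"
  unfolding cos_series_deriv_def by (rule cos_term_series(3)[OF assms])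

lemma cos_series_deriv_holder:
  assumes b: "admissible b"
  shows "\<bar>cos_series_deriv n b x - cos_series_deriv n b y\<bar>
    \<le> 2 * ((1 + \<kappa>) ^ (n + 1) * coeff_norm b) * \<bar>x - y\<bar> powr a"
proof -
  define L where "L = (1 + \<kappa>) ^ (n + 1) * coeff_norm b"
  have L: "L \<ge> 0" unfolding L_def using coeff_norm_nonneg[OF b] \<kappa> by simp
  have le: "\<bar>cos_series_deriv m b x\<bar> \<le> L" if "m \<le> n + 1" for m x
    unfolding L_def by (rule cos_series_deriv_le[OF b that])
  have "norm (cos_series_deriv n b x - cos_series_deriv n b y) \<le> L * norm (x - y)"
    by (rule field_differentiable_bound[where S = UNIV and f' = "cos_series_deriv (Suc n) b"])
      (use cos_series_deriv_has_derivative[OF b, of n] le[of "Suc n"] in auto)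
  then have "\<bar>cos_series_deriv n b x - cos_series_deriv n b y\<bar> \<le> L * \<bar>x - y\<bar>" by simp
  also have "\<dots> \<le> 2 * L * \<bar>x - y\<bar>" using L by (intro mult_right_mono) auto
  finally have "\<bar>cos_series_deriv n b x - cos_series_deriv n b y\<bar> \<le> 2 * L * \<bar>x - y\<bar>" .
  moreover have "\<bar>cos_series_deriv n b x - cos_series_deriv n b y\<bar> \<le> 2 * L"
    using le[of n x] le[of n y] by simp
  ultimately show ?thesis
    using lipschitz_imp_holder_bound[OF a] L unfolding L_def[symmetric] by simp
qed

lemma cos_series_holder:
  assumes b: "admissible b" shows "cos_series b \<in> holder n a"
  unfolding holder_def
proof (intro CollectI conjI allI impI exI)
  fix k x assume "k < n"
  then show "((deriv ^^ k) (cos_series b)) differentiable (at x)"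
    using deriv_cos_series[OF b, of k] cos_series_deriv_has_derivative[OF b, of k x]
    by (auto simp: real_differentiable_def)
next
  fix k assume "k \<le> n"
  then show "bounded (range ((deriv ^^ k) (cos_series b)))"
    using deriv_cos_series[OF b, of k] cos_series_deriv_le[OF b, of k]
    unfolding bounded_iff by (intro exI[of _ "(1 + \<kappa>) ^ (n + 1) * coeff_norm b"]) auto
next
  fix x y
  show "\<bar>(deriv ^^ n) (cos_series b) x - (deriv ^^ n) (cos_series b) y\<bar>
      \<le> 2 * ((1 + \<kappa>) ^ (n + 1) * coeff_norm b) * \<bar>x - y\<bar> powr a"
    using cos_series_deriv_holder[OF b, of x y] deriv_cos_series[OF b, of n] by simp
qed

text \<open>Each of the \<open>n + 1\<close> suprema contributes one constant and the Hoelder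
  quotient two, whence \<open>real n + 3\<close>.\<close>

lemma holder_norm_cos_series_le:
  assumes b: "admissible b"
  shows "holder_norm n a (cos_series b) \<le> (real n + 3) * (1 + \<kappa>) ^ (n + 1) * coeff_norm b"
proof -
  let ?L = "(1 + \<kappa>) ^ (n + 1) * coeff_norm b"
  have "(\<Sum>k\<le>n. SUP x. \<bar>(deriv ^^ k) (cos_series b) x\<bar>) \<le> (\<Sum>k\<le>n. ?L)"
    using cos_series_deriv_le[OF b] deriv_cos_series[OF b]
    by (intro sum_mono cSUP_least) auto
  moreover have "(SUP (x, y) \<in> {(x, y). x \<noteq> y}.
      \<bar>(deriv ^^ n) (cos_series b) x - (deriv ^^ n) (cos_series b) y\<bar> / \<bar>x - y\<bar> powr a) \<le> 2 * ?L"
  proof (rule cSUP_least)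
    have "(0::real, 1) \<in> {(x, y). x \<noteq> y}" by simp
    then show "{(x::real, y). x \<noteq> y} \<noteq> {}" by blast
    show "(case p of (x, y) \<Rightarrow> \<bar>(deriv ^^ n) (cos_series b) x - (deriv ^^ n) (cos_series b) y\<bar> / \<bar>x - y\<bar> powr a) \<le> 2 * ?L"
      if "p \<in> {(x, y). x \<noteq> y}" for p
      using that cos_series_deriv_holder[OF b, of "fst p" "snd p"] deriv_cos_series[OF b, of n]
      by (auto simp: divide_le_eq)
  qed
  ultimately have "holder_norm n a (cos_series b) \<le> (\<Sum>k\<le>n. ?L) + 2 * ?L"
    unfolding holder_norm_def by linarith
  then show ?thesis by (simp add: algebra_simps)
qed

section \<open>Harmonic extension of a cosine series to the strip\<close>

definition extension :: "(nat \<Rightarrow> real) \<Rightarrow> nat \<Rightarrow> nat \<Rightarrow> real \<times> real \<Rightarrow> real" where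
  "extension b i j p = (\<Sum>k. b k * (cos_term i k (fst p) * profile j k (snd p)))"

lemma extension_term_le:
  assumes "-h \<le> y" "y \<le> 0"
  shows "\<bar>cos_term i k x * profile j k y\<bar> \<le> profile_bound * ((1 + \<kappa>) * (1 + real k)) ^ (i + j)"
proof -
  have "\<bar>cos_term i k x\<bar> * \<bar>profile j k y\<bar> \<le> ((1 + \<kappa>) * (1 + real k)) ^ i * (profile_bound * ((1 + \<kappa>) * (1 + real k)) ^ j)"
    using cos_term_le profile_le[OF assms] \<kappa> by (intro mult_mono) auto
  then show ?thesis by (simp add: abs_mult power_add mult_ac)
qed

lemma extension_series:
  assumes b: "admissible b" and y: "-h \<le> y" "y \<le> 0" and ij: "i + j \<le> n + 1"
  shows "\<bar>b k * (cos_term i k x * profile j k y)\<bar>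
      \<le> profile_bound * (1 + \<kappa>) ^ (n + 1) * (\<bar>b k\<bar> * (1 + real k) ^ (n + 1))"
    and "summable (\<lambda>k. b k * (cos_term i k x * profile j k y))"
    and "\<bar>extension b i j (x, y)\<bar> \<le> profile_bound * (1 + \<kappa>) ^ (n + 1) * coeff_norm b"
  using admissible_bound[OF b ij, of profile_bound "\<lambda>k. cos_term i k x * profile j k y"]
    extension_term_le[OF y] profile_bound_ge(1)
  by (simp_all add: extension_def)

lemma extension_majorant:
  "admissible b \<Longrightarrow> summable (\<lambda>k. profile_bound * (1 + \<kappa>) ^ (n + 1) * (\<bar>b k\<bar> * (1 + real k) ^ (n + 1)))"
  unfolding admissible_def by (rule summable_mult)

lemma extension_continuous:
  assumes b: "admissible b" and ij: "i + j \<le> n + 1"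
  shows "continuous_on (UNIV \<times> {-h..0}) (extension b i j)"
proof -
  have "uniform_limit (UNIV \<times> {-h..0}) (\<lambda>N p. \<Sum>k<N. b k * (cos_term i k (fst p) * profile j k (snd p)))
      (\<lambda>p. \<Sum>k. b k * (cos_term i k (fst p) * profile j k (snd p))) sequentially"
    by (rule Weierstrass_m_test[OF _ extension_majorant[OF b]])
      (use extension_series(1)[OF b _ _ ij] in auto)
  moreover have "continuous_on (UNIV \<times> {-h..0}) (\<lambda>p. \<Sum>k<N. b k * (cos_term i k (fst p) * profile j k (snd p)))" for N
  proof -
    have c: "continuous_on UNIV (cos_term i k)" "continuous_on UNIV (profile j k)" for k
      by (intro continuous_at_imp_continuous_on ballI DERIV_isCont[OF cos_term_deriv] DERIV_isCont[OF profile_deriv])+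
    have "continuous_on (UNIV \<times> {-h..0}) (\<lambda>p. cos_term i k (fst p))"
      "continuous_on (UNIV \<times> {-h..0}) (\<lambda>p. profile j k (snd p))" for k
      by (rule continuous_on_compose2[OF c(1)] continuous_on_compose2[OF c(2)];
          auto intro!: continuous_intros)+
    then show ?thesis by (intro continuous_intros)
  qed
  ultimately show ?thesis unfolding extension_def
    by (intro uniform_limit_theorem[of _ _ sequentially]) auto
qed

lemma extension_deriv_x:
  assumes b: "admissible b" and ij: "i + j \<le> n" and y: "-h \<le> y" "y \<le> 0"
  shows "((\<lambda>t. extension b i j (t, y)) has_real_derivative extension b (Suc i) j (x, y)) (at x)"
  unfolding extension_def
proof (rule suminf_has_derivative_within[where S = UNIV])
  show "\<bar>b k * (cos_term (Suc i) k (fst (x, y)) * profile j k (snd (x, y)))\<bar>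
      \<le> profile_bound * (1 + \<kappa>) ^ (n + 1) * (\<bar>b k\<bar> * (1 + real k) ^ (n + 1))" for k x
    using extension_series(1)[OF b y, of "Suc i" j] ij by simp
  show "summable (\<lambda>k. b k * (cos_term i k (fst (x, y)) * profile j k (snd (x, y))))" for x
    using extension_series(2)[OF b y, of i j] ij by simp
qed (use extension_majorant[OF b] in \<open>auto intro!: derivative_eq_intros cos_term_deriv\<close>)

lemma extension_deriv_y:
  assumes b: "admissible b" and ij: "i + j \<le> n" and y: "-h \<le> y" "y \<le> 0"
  shows "((\<lambda>t. extension b i j (x, t)) has_real_derivative extension b i (Suc j) (x, y)) (at y within {-h..0})"
  unfolding extension_def
proof (rule suminf_has_derivative_within[where S = "{-h..0}"])
  show "\<bar>b k * (cos_term i k (fst (x, y)) * profile (Suc j) k (snd (x, y)))\<bar>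
      \<le> profile_bound * (1 + \<kappa>) ^ (n + 1) * (\<bar>b k\<bar> * (1 + real k) ^ (n + 1))" if "y \<in> {-h..0}" for k y
    using extension_series(1)[OF b, of y i "Suc j"] ij that by simp
  show "summable (\<lambda>k. b k * (cos_term i k (fst (x, y)) * profile j k (snd (x, y))))" if "y \<in> {-h..0}" for y
    using extension_series(2)[OF b, of y i j] ij that by simp
qed (use extension_majorant[OF b] y in
  \<open>auto intro!: derivative_eq_intros has_field_derivative_at_within[OF profile_deriv]\<close>)

lemma extension_deriv_y_interior:
  assumes b: "admissible b" and ij: "i + j \<le> n" and y: "-h < y" "y < 0"
  shows "((\<lambda>t. extension b i j (x, t)) has_real_derivative extension b i (Suc j) (x, y)) (at y)"
  using extension_deriv_y[OF b ij, of y x] y at_within_interior[of y "{-h..0}"] by simp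

lemma extension_partials_on:
  assumes b: "admissible b" and m: "m \<le> n + 1"
  shows "partials_on m (strip h) (extension b 0 0) (extension b)"
  unfolding partials_on_def
proof (intro conjI allI impI ballI)
  show "continuous_on (strip h) (extension b i j)" if "i + j \<le> m" for i j
    by (rule continuous_on_subset[OF extension_continuous[OF b]]) (use that m in \<open>auto simp: strip_def\<close>)
qed (use m in \<open>auto simp: strip_def intro!: extension_deriv_x[OF b] extension_deriv_y_interior[OF b]\<close>)

lemma extension_holder_closure:
  assumes b: "admissible b"
  shows "extension b 0 0 \<in> holder_closure n a (strip h)"
  unfolding holder_closure_def closure_strip[OF h]
proof (intro CollectI conjI allI impI ballI exI)
  show "partials_on n (strip h) (extension b 0 0) (extension b)"
    using extension_partials_on[OF b] by simp
  show "continuous_on (UNIV \<times> {-h..0}) (extension b i j)" if "i + j \<le> n" for i j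
    using extension_continuous[OF b] that by simp
  show "bounded (extension b i j ` (UNIV \<times> {-h..0}))" if "i + j \<le> n" for i j
    unfolding bounded_iff using extension_series(3)[OF b] that
    by (intro exI[of _ "profile_bound * (1 + \<kappa>) ^ (n + 1) * coeff_norm b"]) auto
  fix i j and p q :: "real \<times> real"
  assume ij: "i + j = n" and p: "p \<in> UNIV \<times> {-h..0}" and q: "q \<in> UNIV \<times> {-h..0}"
  define L where "L = profile_bound * (1 + \<kappa>) ^ (n + 1) * coeff_norm b"
  have L: "L \<ge> 0" unfolding L_def using coeff_norm_nonneg[OF b] \<kappa> profile_bound_ge(1) by simp
  have le: "\<bar>extension b i j (x, y)\<bar> \<le> L" if "-h \<le> y" "y \<le> 0" "i + j \<le> n + 1" for i j x y
    unfolding L_def by (rule extension_series(3)[OF b that])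
  obtain x y x' y' where xy: "p = (x, y)" "q = (x', y')" by (cases p, cases q)
  have y: "-h \<le> y" "y \<le> 0" "-h \<le> y'" "y' \<le> 0" using p q xy by auto
  \<comment> \<open>The way from \<open>p\<close> to \<open>q\<close> consists of a horizontal and a
    vertical segment, both inside the closed strip; each is estimated by one more
    derivative.\<close>
  have "norm (extension b i j (x, y) - extension b i j (x', y)) \<le> L * norm (x - x')"
    by (rule field_differentiable_bound[where S = UNIV and f' = "\<lambda>x. extension b (Suc i) j (x, y)"])
      (use extension_deriv_x[OF b _ y(1,2), of i j] le[OF y(1,2), of "Suc i" j] ij in auto)
  moreover have "norm (extension b i j (x', y) - extension b i j (x', y')) \<le> L * norm (y - y')"
    by (rule field_differentiable_bound[where S = "{-h..0}" and f' = "\<lambda>y. extension b i (Suc j) (x', y)"])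
      (use extension_deriv_y[OF b, of i j] le[of _ i "Suc j"] ij y in auto)
  moreover have "norm (x - x') \<le> dist p q" "norm (y - y') \<le> dist p q"
    using dist_fst_le[of p q] dist_snd_le[of p q] by (simp_all add: xy dist_real_def)
  ultimately have "\<bar>extension b i j p - extension b i j q\<bar> \<le> L * dist p q + L * dist p q"
    using L mult_left_mono[of "norm (x - x')" "dist p q" L] mult_left_mono[of "norm (y - y')" "dist p q" L]
    unfolding xy by (smt (verit) real_norm_def)
  then have "\<bar>extension b i j p - extension b i j q\<bar> \<le> 2 * L * dist p q" by simp
  moreover have "\<bar>extension b i j p - extension b i j q\<bar> \<le> 2 * L"
    using le[OF y(1,2), of i j x] le[OF y(3,4), of i j x'] ij xy
    by (simp add: abs_le_iff)
  ultimately have "\<bar>extension b i j p - extension b i j q\<bar> \<le> 2 * L * dist p q powr a"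
    using L by (intro lipschitz_imp_holder_bound[OF a zero_le_dist]) auto
  then show "\<bar>extension b i j p - extension b i j q\<bar>
      \<le> 2 * (profile_bound * (1 + \<kappa>) ^ (n + 1) * coeff_norm b) * dist p q powr a"
    unfolding L_def .
qed auto

lemma extension_laplacian: "cos_term 2 k x * profile 0 k y + cos_term 0 k x * profile 2 k y = 0"
  by (simp add: cos_term_def profile_def)

text \<open>Second derivatives exist because \<open>2 \<le> n + 1\<close>; the Laplacian then
  vanishes term by term.\<close>

lemma extension_harmonic:
  assumes b: "admissible b"
  shows "harmonic2_on (strip h) (extension b 0 0)"
  unfolding harmonic2_on_def
proof (intro exI conjI ballI)
  show "partials_on 2 (strip h) (extension b 0 0) (extension b)"
    using extension_partials_on[OF b] n by simp
  fix p assume "p \<in> strip h"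
  then obtain x y where p: "p = (x, y)" "-h \<le> y" "y \<le> 0" by (auto simp: strip_def)
  have "extension b 2 0 p + extension b 0 2 p
      = (\<Sum>k. b k * (cos_term 2 k x * profile 0 k y) + b k * (cos_term 0 k x * profile 2 k y))"
    unfolding extension_def p(1) fst_conv snd_conv using n
    by (intro suminf_add extension_series(2)[OF b p(2,3)]) auto
  also have "\<dots> = 0" by (simp flip: distrib_left add: extension_laplacian)
  finally show "extension b 2 0 p + extension b 0 2 p = 0" .
qed

lemma extension_strip_solution:
  assumes b: "admissible b"
  shows "strip_solution n a h (cos_series b) (extension b 0 0)"
proof -
  have "profile 0 k (-h) = 0" "profile 0 k 0 = 1" for k
    using h \<kappa> by (auto simp: profile_def)
  then show ?thesis unfolding strip_solution_def
    using extension_holder_closure[OF b] extension_harmonic[OF b]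
    by (auto simp: extension_def cos_series_def cos_term_0)
qed

lemma DN_cos_series:
  assumes b: "admissible b"
  shows "DN n a h (cos_series b) x = (\<Sum>k. b k * dn_symbol k * cos (real k * (\<kappa> * x + \<theta>)))"
proof -
  have "((\<lambda>y. extension b 0 0 (x, y)) has_real_derivative extension b 0 1 (x, 0)) (at 0 within {-h..0})"
    using extension_deriv_y[OF b, of 0 0 0 x] h by simp
  from DN_eqI[OF h extension_strip_solution[OF b] this]
  show ?thesis by (simp add: extension_def dn_symbol_def cos_term_0 mult_ac)
qed

end

section \<open>Means and Besicovitch norms of periodic functions\<close>

lemma set_integral_symmetric_interval:
  fixes f F :: "real \<Rightarrow> real"
  assumes f: "continuous_on UNIV f" and F: "\<And>x. (F has_real_derivative f x) (at x)" and x: "x \<ge> 0"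
  shows "(LINT t:{-x..x}|lebesgue. f t) = F x - F (- x)"
proof -
  have "f absolutely_integrable_on {-x..x}"
    by (rule absolutely_integrable_continuous_real[OF continuous_on_subset[OF f]]) auto
  then have "(LINT t:{-x..x}|lebesgue. f t) = integral {-x..x} f"
    by (rule set_lebesgue_integral_eq_integral(2))
  also have "(f has_integral (F x - F (- x))) {-x..x}"
    using x F by (intro fundamental_theorem_of_calculus)
      (auto intro: has_field_derivative_at_within simp flip: has_real_derivative_iff_has_vector_derivative)
  then have "integral {-x..x} f = F x - F (- x)" by (rule integral_unique)
  finally show ?thesis .
qed

lemma continuous_has_antiderivative:
  fixes f :: "real \<Rightarrow> real"
  assumes "continuous_on UNIV f"
  obtains F where "\<And>x. (F has_real_derivative f x) (at x)"
proof
  fix x :: real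
  define b where "b = \<bar>x\<bar> + 1"
  have x: "x \<in> {-b<..<b}" and b: "b > 0" by (auto simp: b_def)
  have "((\<lambda>u. LBINT y=(0::real)..u. f y) has_vector_derivative f x) (at x within {-b..b})"
    using x b by (intro interval_integral_FTC2 continuous_on_subset[OF assms]) auto
  then show "((\<lambda>u. LBINT y=(0::real)..u. f y) has_real_derivative f x) (at x)"
    using x at_within_interior[of x "{-b..b}"]
    by (simp add: has_real_derivative_iff_has_vector_derivative)
qed

text \<open>The symmetric average differs from \<open>m\<close> by the difference of two values of
  the bounded function \<open>F x - m * x\<close>, divided by \<open>2 * x\<close>.\<close>

lemma has_mean_antiderivative:
  fixes f F :: "real \<Rightarrow> real"
  assumes f: "continuous_on UNIV f" and F: "\<And>x. (F has_real_derivative f x) (at x)"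
    and C: "\<And>x. \<bar>F x - m * x\<bar> \<le> C"
  shows "has_mean f m"
  unfolding has_mean_def
proof -
  have C0: "C \<ge> 0" using C[of 0] by linarith
  have "((\<lambda>x. 1 / (2 * x) * (LINT t:{-x..x}|lebesgue. f t) - m) \<longlongrightarrow> 0) at_top"
  proof (rule Lim_null_comparison)
    have "\<bar>1 / (2 * x) * (LINT t:{-x..x}|lebesgue. f t) - m\<bar> \<le> C / x" if "x > 0" for x
    proof -
      have "1 / (2 * x) * (LINT t:{-x..x}|lebesgue. f t) - m = ((F x - m * x) - (F (-x) - m * (-x))) / (2 * x)"
        using set_integral_symmetric_interval[OF f F, of x] that by (simp add: field_simps)
      moreover have "\<bar>(F x - m * x) - (F (-x) - m * (-x))\<bar> \<le> 2 * C"
        using C[of x] C[of "-x"] by linarith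
      ultimately show ?thesis using that by (simp add: divide_le_eq)
    qed
    then show "\<forall>\<^sub>F x in at_top. norm (1 / (2 * x) * (LINT t:{-x..x}|lebesgue. f t) - m) \<le> C / x"
      by (auto intro: eventually_mono[OF eventually_gt_at_top[of 0]])
    show "((\<lambda>x. C / x) \<longlongrightarrow> 0) at_top"
      by (rule real_tendsto_divide_at_top[OF tendsto_const filterlim_ident])
  qed
  then show "((\<lambda>x. 1 / (2 * x) * (LINT t:{-x..x}|lebesgue. f t)) \<longlongrightarrow> m) at_top"
    by (simp add: LIM_zero_iff)
qed

lemma periodic_reduce:
  fixes f :: "real \<Rightarrow> real"
  assumes per: "\<And>x. f (x + L) = f x" and L: "L > 0"
  shows "\<exists>t\<in>{0..L}. f x = f t"
proof -
  have shift: "f (y + real k * L) = f y" for y k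
  proof (induction k)
    case (Suc k)
    have "f (y + real (Suc k) * L) = f ((y + real k * L) + L)" by (simp add: algebra_simps)
    then show ?case using per Suc by simp
  qed simp
  define z where "z = \<lfloor>x / L\<rfloor>"
  have z: "of_int z * L \<le> x" "x < (of_int z + 1) * L"
    using L floor_divide_lower[OF L, of x] floor_divide_upper[OF L, of x] by (simp_all add: z_def)
  have "f (x - of_int z * L) = f x"
  proof (cases "z \<ge> 0")
    case True
    then show ?thesis using shift[of "x - of_int z * L" "nat z"] by simp
  next
    case False
    then show ?thesis using shift[of x "nat (- z)"] by simp
  qed
  then show ?thesis using z by (intro bexI[of _ "x - of_int z * L"]) (auto simp: algebra_simps)
qed

text \<open>With \<open>m\<close> the average over one period, \<open>F x - m * x\<close> is again
  periodic and hence bounded.\<close>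

lemma periodic_has_mean:
  fixes f :: "real \<Rightarrow> real"
  assumes f: "continuous_on UNIV f" and per: "\<And>x. f (x + L) = f x" and L: "L > 0"
  shows "\<exists>m. has_mean f m"
proof -
  obtain F where F: "\<And>x. (F has_real_derivative f x) (at x)"
    using continuous_has_antiderivative[OF f] by blast
  define m where "m = (F L - F 0) / L"
  define G where "G = (\<lambda>x. F x - m * x)"
  have "((\<lambda>x. F (x + L) - F x) has_real_derivative 0) (at x)" for x
    using F[of x] DERIV_shift[of F "f x" x L] F[of "x + L"] per[of x]
    by (auto intro!: derivative_eq_intros)
  then have sh: "F (x + L) - F x = F (0 + L) - F 0" for x
    using DERIV_isconst_all[of "\<lambda>x. F (x + L) - F x" x 0] by blast
  have "F (x + L) = F x + (F L - F 0)" for x using sh[of x] by simp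
  moreover have "m * (x + L) = m * x + (F L - F 0)" for x using L by (simp add: m_def distrib_left)
  ultimately have per': "G (x + L) = G x" for x by (simp add: G_def)
  have "continuous_on UNIV G" unfolding G_def
    by (intro continuous_intros continuous_at_imp_continuous_on) (use F DERIV_isCont in blast)
  then have "continuous_on {0..L} G" by (rule continuous_on_subset) simp
  then have "bounded (G ` {0..L})" by (intro compact_imp_bounded compact_continuous_image) auto
  then obtain C where C: "\<And>t. t \<in> {0..L} \<Longrightarrow> \<bar>G t\<bar> \<le> C"
    unfolding bounded_iff by (metis image_eqI real_norm_def)
  have "\<bar>G x\<bar> \<le> C" for x using periodic_reduce[of G L, OF per' L] C by metis
  then have "has_mean f m" unfolding G_def by (intro has_mean_antiderivative[OF f F])
  then show ?thesis ..
qed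

text \<open>By the mean value theorem every symmetric average is itself a value of
  \<open>f\<close>.\<close>

lemma has_mean_bounds:
  fixes f :: "real \<Rightarrow> real"
  assumes f: "continuous_on UNIV f" and m: "has_mean f m" and b: "\<And>x. l \<le> f x" "\<And>x. f x \<le> u"
  shows "l \<le> m" and "m \<le> u"
proof -
  obtain F where F: "\<And>x. (F has_real_derivative f x) (at x)"
    using continuous_has_antiderivative[OF f] by blast
  have "l \<le> 1 / (2 * x) * (LINT t:{-x..x}|lebesgue. f t) \<and> 1 / (2 * x) * (LINT t:{-x..x}|lebesgue. f t) \<le> u"
    if "x > 0" for x
  proof -
    have "\<exists>z>-x. z < x \<and> F x - F (-x) = (x - (-x)) * f z"
      using F that by (intro MVT2) auto
    then obtain z where "F x - F (-x) = (x - (-x)) * f z" by blast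
    then have "1 / (2 * x) * (LINT t:{-x..x}|lebesgue. f t) = f z"
      using set_integral_symmetric_interval[OF f F, of x] that by simp
    then show ?thesis using b by simp
  qed
  then have ev: "\<forall>\<^sub>F x in at_top. l \<le> 1 / (2 * x) * (LINT t:{-x..x}|lebesgue. f t)"
    "\<forall>\<^sub>F x in at_top. 1 / (2 * x) * (LINT t:{-x..x}|lebesgue. f t) \<le> u"
    by (auto intro: eventually_mono[OF eventually_gt_at_top[of 0]])
  show "l \<le> m" using tendsto_lowerbound[OF m[unfolded has_mean_def] ev(1)] by simp
  show "m \<le> u" using tendsto_upperbound[OF m[unfolded has_mean_def] ev(2)] by simp
qed

text \<open>Membership demands a genuine limit; it exists because the square is periodic and so has
  a mean. The factor \<open>sqrt 2\<close> stems from the normalisation by \<open>1 / x\<close> on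
  an interval of length \<open>2 * x\<close>.\<close>

lemma periodic_B2:
  fixes u :: "real \<Rightarrow> real"
  assumes u: "continuous_on UNIV u" and per: "\<And>x. u (x + L) = u x" and L: "L > 0"
    and c: "\<And>x. \<bar>u x\<bar> \<le> c"
  shows "u \<in> B2" and "0 \<le> B2_seminorm u" and "B2_seminorm u \<le> sqrt 2 * c"
proof -
  have u2: "continuous_on UNIV (\<lambda>x. (u x)\<^sup>2)" using u by (intro continuous_intros)
  have c0: "c \<ge> 0" using c[of 0] by linarith
  obtain m where m: "has_mean (\<lambda>x. (u x)\<^sup>2) m"
    using periodic_has_mean[OF u2 _ L] per by auto
  have le: "(u x)\<^sup>2 \<le> c\<^sup>2" for x using c[of x] c0 by (simp add: abs_le_square_iff[symmetric])
  have mb: "0 \<le> m" "m \<le> c\<^sup>2" using has_mean_bounds[OF u2 m _ le, of 0] by auto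
  have "((\<lambda>x. sqrt (2 * (1 / (2 * x) * (LINT t:{-x..x}|lebesgue. (u t)\<^sup>2)))) \<longlongrightarrow> sqrt (2 * m)) at_top"
    using m unfolding has_mean_def by (intro tendsto_intros)
  then have lim: "(B2_average u \<longlongrightarrow> sqrt (2 * m)) at_top"
    unfolding B2_average_def[abs_def] by simp
  have "u \<in> L2_loc" unfolding L2_loc_def
  proof (intro CollectI conjI allI)
    have "u \<in> borel_measurable lborel" using borel_measurable_continuous_onI[OF u] by simp
    then show "u \<in> borel_measurable lebesgue" by (rule measurable_completion)
    show "set_integrable lebesgue {-R..R} (\<lambda>t. (u t)\<^sup>2)" for R
      by (rule absolutely_integrable_continuous_real[OF continuous_on_subset[OF u2]]) auto
  qed
  then show "u \<in> B2" using lim unfolding B2_def by blast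
  have eq: "B2_seminorm u = sqrt (2 * m)" unfolding B2_seminorm_def
    by (rule tendsto_Lim[OF _ lim]) simp
  then show "0 \<le> B2_seminorm u" using mb by simp
  have "sqrt (2 * m) \<le> sqrt (2 * c\<^sup>2)" using mb by simp
  then show "B2_seminorm u \<le> sqrt 2 * c" using eq c0 by (simp add: real_sqrt_mult)
qed

context wave_frame
begin

text \<open>The equation for the frequency accompanies the identity of functions so that distinct
  modes of the same kind receive distinct indices.\<close>

definition freq_match :: "(nat \<Rightarrow> real) \<Rightarrow> (nat \<Rightarrow> real) \<Rightarrow> bool" where
  "freq_match \<alpha> \<beta> \<longleftrightarrow> (\<forall>k\<ge>1. \<exists>i \<sigma>.
     (real k * \<kappa> = \<bar>\<alpha> i\<bar> \<and> (\<forall>x. cos (real k * (\<kappa> * x + \<theta>)) = \<sigma> * cos (\<alpha> i * x))) \<or>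
     (real k * \<kappa> = \<bar>\<beta> i\<bar> \<and> (\<forall>x. cos (real k * (\<kappa> * x + \<theta>)) = \<sigma> * sin (\<beta> i * x))))"

lemma admissible_summable:
  assumes "admissible b" shows "summable (\<lambda>k. \<bar>b k\<bar>)"
proof (rule summable_comparison_test'[of _ 0])
  show "summable (\<lambda>k. \<bar>b k\<bar> * (1 + real k) ^ (n + 1))" using assms by (simp add: admissible_def)
  show "norm \<bar>b k\<bar> \<le> \<bar>b k\<bar> * (1 + real k) ^ (n + 1)" for k
    using mult_left_mono[of 1 "(1 + real k) ^ (n + 1)" "\<bar>b k\<bar>"] one_le_power[of "1 + real k" "n + 1"] by simp
qed

lemma cos_series_summable:
  assumes "admissible b" shows "summable (\<lambda>k. b k * cos (real k * (\<kappa> * x + \<theta>)))"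
  using cos_term_series(2)[OF assms, of 0] by (simp add: cos_term_0)

lemma cos_series_continuous: "admissible b \<Longrightarrow> continuous_on UNIV (cos_series b)"
  using cos_series_deriv_has_derivative[of b 0] DERIV_isCont
  by (intro continuous_at_imp_continuous_on) (auto simp: cos_series_deriv_0)

lemma cos_mode_periodic: "cos (real k * (\<kappa> * (x + 2 * pi / \<kappa>) + \<theta>)) = cos (real k * (\<kappa> * x + \<theta>))"
proof -
  have "real k * (\<kappa> * (x + 2 * pi / \<kappa>) + \<theta>) = real k * (\<kappa> * x + \<theta>) + real k * (2 * pi)"
    using \<kappa> by (simp add: field_simps)
  moreover have "cos (real k * (2 * pi)) = 1" "sin (real k * (2 * pi)) = 0"
    using cos_2npi[of k] sin_2npi[of k] by (simp_all add: mult_ac)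
  ultimately show ?thesis by (simp add: cos_add)
qed

lemma cos_series_has_mean:
  assumes b: "admissible b" and b0: "b 0 = 0"
  shows "has_mean (cos_series b) 0"
proof (rule has_mean_antiderivative[OF cos_series_continuous[OF b]])
  \<comment> \<open>At \<open>k = 0\<close> the quotient has divisor 0 and is 0 by convention, in
    accordance with \<open>b 0 = 0\<close>.\<close>
  define F where "F = (\<lambda>x. \<Sum>k. b k * (sin (real k * (\<kappa> * x + \<theta>)) / (real k * \<kappa>)))"
  have le: "\<bar>b k * (sin (real k * (\<kappa> * x + \<theta>)) / (real k * \<kappa>))\<bar> \<le> \<bar>b k\<bar> / \<kappa>" for k x
  proof (cases "k = 0")
    case False
    then have "\<bar>sin (real k * (\<kappa> * x + \<theta>)) / (real k * \<kappa>)\<bar> \<le> 1 / \<kappa>"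
      using \<kappa> by (simp add: abs_mult divide_le_eq)
        (metis abs_sin_le_one le_trans of_nat_1_eq_iff of_nat_le_iff of_nat_1 One_nat_def Suc_leI order_trans)
    then show ?thesis unfolding abs_mult using mult_left_mono[of _ "1 / \<kappa>" "\<bar>b k\<bar>"] by fastforce
  qed (use \<kappa> in simp)
  have sm: "summable (\<lambda>k. \<bar>b k\<bar> / \<kappa>)" using admissible_summable[OF b] by (rule summable_divide)
  have sF: "summable (\<lambda>k. \<bar>b k * (sin (real k * (\<kappa> * x + \<theta>)) / (real k * \<kappa>))\<bar>)" for x
    by (rule summable_comparison_test'[OF sm, of 0]) (use le in auto)
  show "(F has_real_derivative cos_series b x) (at x)" for x
    unfolding F_def cos_series_def
  proof (rule suminf_has_derivative_within[where S = UNIV])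
    show "((\<lambda>x. b k * (sin (real k * (\<kappa> * x + \<theta>)) / (real k * \<kappa>))) has_real_derivative
        b k * cos (real k * (\<kappa> * x + \<theta>))) (at x)" for k x
      using \<kappa> b0 by (cases "k = 0") (auto intro!: derivative_eq_intros)
    show "\<bar>b k * cos (real k * (\<kappa> * x + \<theta>))\<bar> \<le> \<bar>b k\<bar>" for k x
      unfolding abs_mult by (rule mult_left_le) auto
  qed (use admissible_summable[OF b] sF summable_rabs_cancel in auto)
  show "\<bar>F x - 0 * x\<bar> \<le> (\<Sum>k. \<bar>b k\<bar> / \<kappa>)" for x
    using order_trans[OF summable_rabs[OF sF] suminf_le[OF le sF sm]] by (simp add: F_def)
qed

text \<open>The expansion is truncated by the position of a frequency in the given lists, not by the
  mode number, so its partial sums are those of a rearranged series. Absolute convergence makes them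
  converge uniformly, hence in the Besicovitch semi-norm.\<close>

lemma cos_series_AP_space0:
  assumes b: "admissible b" and b0: "b 0 = 0" and match: "freq_match \<alpha> \<beta>"
  shows "cos_series b \<in> AP_space0 \<alpha> \<beta> n a"
proof -
  define e where "e = (\<lambda>k x. cos (real k * (\<kappa> * x + \<theta>)))"
  have "\<forall>k. \<exists>i \<sigma>. k \<ge> 1 \<longrightarrow> (real k * \<kappa> = \<bar>\<alpha> i\<bar> \<and> (\<forall>x. e k x = \<sigma> * cos (\<alpha> i * x))) \<or>
     (real k * \<kappa> = \<bar>\<beta> i\<bar> \<and> (\<forall>x. e k x = \<sigma> * sin (\<beta> i * x)))"
    using match unfolding freq_match_def e_def by blast
  then obtain idx \<sigma> where mode: "\<And>k. k \<ge> 1 \<Longrightarrow> (real k * \<kappa> = \<bar>\<alpha> (idx k)\<bar> \<and> (\<forall>x. e k x = \<sigma> k * cos (\<alpha> (idx k) * x))) \<or>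
     (real k * \<kappa> = \<bar>\<beta> (idx k)\<bar> \<and> (\<forall>x. e k x = \<sigma> k * sin (\<beta> (idx k) * x)))"
    by metis
  \<comment> \<open>A mode that can be written both ways is counted as a cosine; this makes
    \<open>P\<close> and \<open>Q\<close> disjoint.\<close>
  define P where "P = {k. k \<ge> 1 \<and> real k * \<kappa> = \<bar>\<alpha> (idx k)\<bar> \<and> (\<forall>x. e k x = \<sigma> k * cos (\<alpha> (idx k) * x))}"
  define Q where "Q = {k. k \<ge> 1} - P"
  have P: "real k * \<kappa> = \<bar>\<alpha> (idx k)\<bar>" "e k x = \<sigma> k * cos (\<alpha> (idx k) * x)" if "k \<in> P" for k x
    using that by (auto simp: P_def)
  have Q: "real k * \<kappa> = \<bar>\<beta> (idx k)\<bar>" "e k x = \<sigma> k * sin (\<beta> (idx k) * x)" if "k \<in> Q" for k x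
    using that mode[of k] by (auto simp: P_def Q_def)
  have inj: "inj_on idx P" "inj_on idx Q"
    using P(1) Q(1) \<kappa> by (intro inj_onI; metis mult_cancel_right of_nat_eq_iff less_irrefl)+
  \<comment> \<open>Injectivity leaves at most one mode in the index set; an index that represents
    no mode gets coefficient 0.\<close>
  define A where "A = (\<lambda>i. \<Sum>k\<in>{k\<in>P. idx k = i}. b k * \<sigma> k)"
  define B where "B = (\<lambda>i. \<Sum>k\<in>{k\<in>Q. idx k = i}. b k * \<sigma> k)"
  define PN where "PN = (\<lambda>N. {k\<in>P. idx k < N})"
  define QN where "QN = (\<lambda>N. {k\<in>Q. idx k < N})"
  have fin: "finite (PN N)" "finite (QN N)" for N
  proof -
    have "PN N = idx -` {..<N} \<inter> P" "QN N = idx -` {..<N} \<inter> Q" by (auto simp: PN_def QN_def)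
    then show "finite (PN N)" "finite (QN N)"
      using finite_vimage_IntI[OF finite_lessThan[of N] inj(1)] finite_vimage_IntI[OF finite_lessThan[of N] inj(2)]
      by simp_all
  qed
  define K where "K = (\<lambda>N. PN N \<union> QN N)"
  have finK: "finite (K N)" for N using fin by (simp add: K_def)
  have A: "(\<Sum>i<N. A i * cos (\<alpha> i * x)) = (\<Sum>k\<in>PN N. b k * e k x)" for N x
  proof -
    have "(\<Sum>i<N. A i * cos (\<alpha> i * x)) = (\<Sum>i<N. \<Sum>k\<in>{k\<in>PN N. idx k = i}. b k * e k x)"
    proof (rule sum.cong[OF refl])
      fix i assume "i \<in> {..<N}"
      then have "{k\<in>P. idx k = i} = {k\<in>PN N. idx k = i}" by (auto simp: PN_def)
      then show "A i * cos (\<alpha> i * x) = (\<Sum>k\<in>{k\<in>PN N. idx k = i}. b k * e k x)"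
        unfolding A_def sum_distrib_right by (intro sum.cong) (auto simp: PN_def P(2))
    qed
    also have "\<dots> = (\<Sum>k\<in>PN N. b k * e k x)"
      by (rule sum.group) (use fin in \<open>auto simp: PN_def\<close>)
    finally show ?thesis .
  qed
  have B: "(\<Sum>i<N. B i * sin (\<beta> i * x)) = (\<Sum>k\<in>QN N. b k * e k x)" for N x
  proof -
    have "(\<Sum>i<N. B i * sin (\<beta> i * x)) = (\<Sum>i<N. \<Sum>k\<in>{k\<in>QN N. idx k = i}. b k * e k x)"
    proof (rule sum.cong[OF refl])
      fix i assume "i \<in> {..<N}"
      then have "{k\<in>Q. idx k = i} = {k\<in>QN N. idx k = i}" by (auto simp: QN_def)
      then show "B i * sin (\<beta> i * x) = (\<Sum>k\<in>{k\<in>QN N. idx k = i}. b k * e k x)"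
        unfolding B_def sum_distrib_right by (intro sum.cong) (auto simp: QN_def Q(2))
    qed
    also have "\<dots> = (\<Sum>k\<in>QN N. b k * e k x)"
      by (rule sum.group) (use fin in \<open>auto simp: QN_def\<close>)
    finally show ?thesis .
  qed
  define r where "r = (\<lambda>N x. cos_series b x - (\<Sum>k\<in>K N. b k * e k x))"
  have r_eq: "cos_series b x - (0 + (\<Sum>k<N. A k * cos (\<alpha> k * x)) + (\<Sum>k<N. B k * sin (\<beta> k * x))) = r N x" for N x
    unfolding A B r_def K_def using fin
    by (subst sum.union_disjoint) (auto simp: PN_def QN_def Q_def)
  define S where "S = (\<Sum>k. \<bar>b k\<bar>)"
  \<comment> \<open>The total size of the modes not yet captured at stage \<open>N\<close>; it
    dominates the remainder uniformly in \<open>x\<close>.\<close>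
  define \<tau> where "\<tau> = (\<lambda>N. S - (\<Sum>k\<in>K N. \<bar>b k\<bar>))"
  have smb: "summable (\<lambda>k. \<bar>b k\<bar>)" by (rule admissible_summable[OF b])
  have r_le: "\<bar>r N x\<bar> \<le> \<tau> N" for N x
  proof -
    have s1: "(\<lambda>k. b k * e k x - (if k \<in> K N then b k * e k x else 0)) sums r N x"
      unfolding r_def cos_series_def e_def
      by (intro sums_diff summable_sums[OF cos_series_summable[OF b]] sums_If_finite_set finK)
    have s2: "(\<lambda>k. \<bar>b k\<bar> - (if k \<in> K N then \<bar>b k\<bar> else 0)) sums \<tau> N"
      unfolding \<tau>_def S_def by (intro sums_diff summable_sums[OF smb] sums_If_finite_set finK)
    have le: "\<bar>b k * e k x - (if k \<in> K N then b k * e k x else 0)\<bar> \<le> \<bar>b k\<bar> - (if k \<in> K N then \<bar>b k\<bar> else 0)" for k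
      by (auto simp: abs_mult e_def mult_left_le)
    have "norm (\<Sum>k. b k * e k x - (if k \<in> K N then b k * e k x else 0)) \<le> (\<Sum>k. \<bar>b k\<bar> - (if k \<in> K N then \<bar>b k\<bar> else 0))"
      by (rule norm_suminf_le) (use le sums_summable[OF s2] in simp_all)
    then show ?thesis using sums_unique[OF s1] sums_unique[OF s2] by simp
  qed
  have \<tau>0: "\<tau> \<longlonglongrightarrow> 0"
  proof (rule LIMSEQ_I)
    fix \<epsilon> :: real assume \<epsilon>: "\<epsilon> > 0"
    obtain M where M: "\<bar>(\<Sum>k<M. \<bar>b k\<bar>) - S\<bar> < \<epsilon>"
      using LIMSEQ_D[OF summable_LIMSEQ[OF smb] \<epsilon>] unfolding S_def by auto
    \<comment> \<open>Past the largest index used by the modes up to \<open>M\<close>, all of these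
      are captured.\<close>
    define N0 where "N0 = Suc (Max (idx ` {..M}))"
    have "norm (\<tau> N - 0) < \<epsilon>" if "N \<ge> N0" for N
    proof -
      have "k \<in> K N" if "k \<in> {1..<M}" for k
      proof -
        have "idx k \<le> Max (idx ` {..M})" using that by (intro Max_ge) auto
        then have "idx k < N" using \<open>N \<ge> N0\<close> by (simp add: N0_def)
        then show ?thesis using that by (auto simp: K_def PN_def QN_def Q_def)
      qed
      then have "(\<Sum>k\<in>{1..<M}. \<bar>b k\<bar>) \<le> (\<Sum>k\<in>K N. \<bar>b k\<bar>)" by (intro sum_mono2 finK) auto
      moreover have "(\<Sum>k<M. \<bar>b k\<bar>) = (\<Sum>k\<in>{1..<M}. \<bar>b k\<bar>)"
        by (rule sum.mono_neutral_right) (use b0 in \<open>auto simp: not_le\<close>)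
      moreover have "\<tau> N \<ge> 0" using r_le[of N 0] by linarith
      ultimately show ?thesis using M by (simp add: \<tau>_def)
    qed
    then show "\<exists>N0. \<forall>N\<ge>N0. norm (\<tau> N - 0) < \<epsilon>" by blast
  qed
  have "continuous_on UNIV (r N)" for N unfolding r_def e_def
    by (intro continuous_intros cos_series_continuous[OF b])
  moreover have "r N (x + 2 * pi / \<kappa>) = r N x" for N x
    unfolding r_def cos_series_def e_def by (simp only: cos_mode_periodic)
  moreover have "2 * pi / \<kappa> > 0" using \<kappa> by simp
  ultimately have r_B2: "r N \<in> B2" "0 \<le> B2_seminorm (r N)" "B2_seminorm (r N) \<le> sqrt 2 * \<tau> N" for N
    using periodic_B2[of "r N" "2 * pi / \<kappa>" "\<tau> N"] r_le by simp_all
  have "(\<lambda>N. sqrt 2 * \<tau> N) \<longlonglongrightarrow> sqrt 2 * 0" by (intro tendsto_intros \<tau>0)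
  then have lim0: "(\<lambda>N. sqrt 2 * \<tau> N) \<longlonglongrightarrow> 0" by simp
  have "(\<lambda>N. B2_seminorm (r N)) \<longlonglongrightarrow> 0"
    by (rule real_tendsto_sandwich[OF _ _ tendsto_const lim0]) (simp_all add: r_B2)
  moreover have "cos_series b \<in> B2"
  proof -
    have per: "cos_series b (x + 2 * pi / \<kappa>) = cos_series b x" for x
      unfolding cos_series_def by (simp only: cos_mode_periodic)
    have "2 * pi / \<kappa> > 0" using \<kappa> by simp
    moreover have "\<bar>cos_series b x\<bar> \<le> (1 + \<kappa>) ^ (n + 1) * coeff_norm b" for x
      using cos_series_deriv_le[OF b, of 0 x] by (simp add: cos_series_deriv_0)
    ultimately show ?thesis
      by (rule periodic_B2(1)[OF cos_series_continuous[OF b] per])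
  qed
  moreover have "(\<lambda>x. cos_series b x - (0 + (\<Sum>k<N. A k * cos (\<alpha> k * x)) + (\<Sum>k<N. B k * sin (\<beta> k * x)))) = r N" for N
    by (rule ext) (rule r_eq)
  ultimately have res: "cos_series b \<in> B2" "(\<lambda>N. B2_seminorm (r N)) \<longlonglongrightarrow> 0"
    "\<And>N. (\<lambda>x. cos_series b x - (0 + (\<Sum>k<N. A k * cos (\<alpha> k * x)) + (\<Sum>k<N. B k * sin (\<beta> k * x)))) = r N"
    by blast+
  have "\<exists>m A B. has_mean (cos_series b) m \<and>
     (let r = (\<lambda>N x. cos_series b x - (m + (\<Sum>k<N. A k * cos (\<alpha> k * x)) + (\<Sum>k<N. B k * sin (\<beta> k * x))))
      in (\<forall>N. r N \<in> B2) \<and> (\<lambda>N. B2_seminorm (r N)) \<longlonglongrightarrow> 0)"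
    unfolding Let_def
  proof (rule exI[of _ 0], rule exI[of _ A], rule exI[of _ B], intro conjI allI)
    show "has_mean (cos_series b) 0" by (rule cos_series_has_mean[OF b b0])
  qed (simp_all only: res r_B2(1))
  with res(1) show ?thesis
    unfolding AP_space0_def AP_space_def
    using cos_series_holder[OF b] cos_series_has_mean[OF b b0] by blast
qed

end

section \<open>Weighted sequence spaces\<close>

text \<open>A function \<open>\<Sum> c\<^sub>j exp (i j t)\<close> is represented by the bounded sequence \<open>u\<^sub>j = c\<^sub>j (1 + |j|)^r\<close>.\<close>

definition weight :: "int \<Rightarrow> real" where
  "weight j = 1 + \<bar>real_of_int j\<bar>"

lemma weight_ge_1: "weight j \<ge> 1" and weight_pos: "weight j > 0" and weight_nz: "weight j \<noteq> 0"
  by (auto simp: weight_def)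

lemma weight_minus [simp]: "weight (- j) = weight j" by (simp add: weight_def)

lemma weight_of_nat: "weight (int k) = 1 + real k" by (simp add: weight_def)

text \<open>Passes from unordered sums over the integers, where products are convenient, to the
  series over modes \<open>k \<ge> 0\<close>. Indexing the negative half by \<open>Suc k\<close>
  counts 0 only once.\<close>

lemma has_sum_int_sums:
  fixes f :: "int \<Rightarrow> 'a :: banach"
  assumes "(f has_sum S) UNIV"
  shows "(\<lambda>k. if k = 0 then f 0 else f (int k) + f (- int k)) sums S"
proof -
  have "f summable_on UNIV" using assms by (rule has_sum_imp_summable)
  then have "f summable_on range int" "f summable_on range (\<lambda>k. - int (Suc k))"
    by (auto intro: summable_on_subset_banach)
  then obtain A B where A: "(f has_sum A) (range int)" and B: "(f has_sum B) (range (\<lambda>k. - int (Suc k)))"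
    by (auto simp: summable_on_def)
  have "range int \<union> range (\<lambda>k. - int (Suc k)) = UNIV"
  proof -
    have "j \<in> range int \<union> range (\<lambda>k. - int (Suc k))" for j
    proof (cases "j \<ge> 0")
      case True then show ?thesis by (metis UnI1 nat_0_le rangeI)
    next
      case False
      then have "j = - int (Suc (nat (- j - 1)))" by simp
      then show ?thesis by blast
    qed
    then show ?thesis by auto
  qed
  moreover have "(f has_sum (A + B)) (range int \<union> range (\<lambda>k. - int (Suc k)))"
    by (rule has_sum_Un_disjoint[OF A B]) auto
  ultimately have S: "S = A + B" using assms has_sum_unique by metis
  have "((\<lambda>k. f (int k)) has_sum A) UNIV"
    using A by (subst has_sum_reindex_bij_betw[of int UNIV "range int"]) (auto simp: bij_betw_def inj_on_def)
  then have 1: "(\<lambda>k. f (int k)) sums A" by (rule has_sum_imp_sums)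
  have "((\<lambda>k. f (- int (Suc k))) has_sum B) UNIV"
    using B by (subst has_sum_reindex_bij_betw[of "\<lambda>k. - int (Suc k)" UNIV "range (\<lambda>k. - int (Suc k))"])
      (auto simp: bij_betw_def inj_on_def)
  then have "(\<lambda>k. f (- int (Suc k))) sums B" by (rule has_sum_imp_sums)
  then have "(\<lambda>k. if Suc k = 0 then 0 else f (- int (Suc k))) sums B" by (simp only: Suc_not_Zero if_False)
  then have 2: "(\<lambda>k. if k = 0 then 0 else f (- int k)) sums B"
    by (rule sums_Suc_imp[where f = "\<lambda>k. if k = 0 then 0 else f (- int k)", OF if_P[OF refl]])
  have "(\<lambda>k. f (int k) + (if k = 0 then 0 else f (- int k))) = (\<lambda>k. if k = 0 then f 0 else f (int k) + f (- int k))"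
    by (rule ext) simp
  then show ?thesis using sums_add[OF 1 2] unfolding S by simp
qed

lemma summable_on_inverse_weight_sq: "(\<lambda>j. 1 / (weight j)\<^sup>2) summable_on UNIV"
proof -
  have "summable (\<lambda>n. inverse (real (Suc n) ^ 2))"
    by (subst summable_Suc_iff) (rule inverse_power_summable, simp)
  then have sm: "summable (\<lambda>n. 1 / (1 + real n)\<^sup>2)" by (simp add: inverse_eq_divide)
  have 1: "(\<lambda>n. 1 / (1 + real n)\<^sup>2) summable_on UNIV"
    using sm by (intro summable_nonneg_imp_summable_on) auto
  have "(\<lambda>j. 1 / (weight j)\<^sup>2) summable_on range int"
    using 1 by (subst summable_on_reindex) (auto simp: o_def weight_of_nat)
  moreover have "(\<lambda>j. 1 / (weight j)\<^sup>2) summable_on range (\<lambda>k. - int k)"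
    using 1 by (subst summable_on_reindex) (auto simp: o_def weight_of_nat inj_on_def)
  ultimately have "(\<lambda>j. 1 / (weight j)\<^sup>2) summable_on (range int \<union> range (\<lambda>k. - int k))"
    by (rule summable_on_union)
  moreover have "range int \<union> range (\<lambda>k. - int k) = UNIV"
    by (auto simp: image_def) (metis int_cases2)
  ultimately show ?thesis by simp
qed

definition weight_sum :: real where
  "weight_sum = (\<Sum>\<^sub>\<infinity>j. 1 / (weight j)\<^sup>2)"

lemma inverse_weight_power_le:
  assumes "r \<ge> 2" shows "1 / weight j ^ r \<le> 1 / (weight j)\<^sup>2"
  using assms weight_ge_1 weight_pos[of j] by (intro divide_left_mono power_increasing) auto

text \<open>The factor by which the weights turn the convolution of Fourier coefficients into an
  operation on the stored sequences.\<close>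

definition conv_kernel :: "nat \<Rightarrow> int \<Rightarrow> int \<Rightarrow> real" where
  "conv_kernel r j i = weight j ^ r / (weight i ^ r * weight (j - i) ^ r)"

lemma conv_kernel_nonneg: "conv_kernel r j i \<ge> 0"
  using weight_pos by (simp add: conv_kernel_def less_imp_le)

text \<open>One of \<open>i\<close> and \<open>j - i\<close> carries at least half of the weight of
  \<open>j\<close>. Its power cancels up to \<open>2 ^ r\<close>, and the inverse power of the other
  is summable.\<close>

lemma conv_kernel_le:
  assumes r: "r \<ge> 2"
  shows "conv_kernel r j i \<le> 2 ^ r * (1 / (weight i)\<^sup>2 + 1 / (weight (j - i))\<^sup>2)"
proof -
  let ?a = "weight i" and ?b = "weight (j - i)"
  have "weight j \<le> ?a + ?b" unfolding weight_def of_int_diff by linarith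
  then have "weight j \<le> 2 * max ?a ?b" by linarith
  then have "weight j ^ r \<le> (2 * max ?a ?b) ^ r" using weight_pos by (intro power_mono) (auto simp: less_imp_le)
  also have "\<dots> = 2 ^ r * max ?a ?b ^ r" by (rule power_mult_distrib)
  also have "\<dots> \<le> 2 ^ r * (?a ^ r + ?b ^ r)"
    using weight_pos[of i] weight_pos[of "j - i"] by (intro mult_left_mono) (auto simp: max_def less_imp_le)
  finally have "weight j ^ r \<le> 2 ^ r * (?a ^ r + ?b ^ r)" .
  then have "conv_kernel r j i \<le> 2 ^ r * (?a ^ r + ?b ^ r) / (?a ^ r * ?b ^ r)"
    unfolding conv_kernel_def using weight_pos by (intro divide_right_mono) (auto simp: less_imp_le)
  also have "\<dots> = 2 ^ r * (1 / ?b ^ r + 1 / ?a ^ r)" using weight_nz by (simp add: field_simps)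
  also have "\<dots> \<le> 2 ^ r * (1 / ?b ^ 2 + 1 / ?a ^ 2)"
    using inverse_weight_power_le[OF r] by (intro mult_left_mono add_mono) auto
  finally show ?thesis by (simp add: add.commute)
qed

lemma summable_on_weight_shift: "(\<lambda>i. 1 / (weight (j - i))\<^sup>2) summable_on UNIV"
  and infsum_weight_shift: "(\<Sum>\<^sub>\<infinity>i. 1 / (weight (j - i))\<^sup>2) = weight_sum"
proof -
  have b: "bij_betw (\<lambda>i. j - i) UNIV UNIV" by (rule bij_betwI[where g = "\<lambda>i. j - i"]) auto
  show "(\<lambda>i. 1 / (weight (j - i))\<^sup>2) summable_on UNIV"
    using summable_on_reindex_bij_betw[OF b, of "\<lambda>i. 1 / (weight i)\<^sup>2"] summable_on_inverse_weight_sq by simp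
  show "(\<Sum>\<^sub>\<infinity>i. 1 / (weight (j - i))\<^sup>2) = weight_sum"
    using infsum_reindex_bij_betw[OF b, of "\<lambda>i. 1 / (weight i)\<^sup>2"] by (simp add: weight_sum_def)
qed

text \<open>The integers are discrete, so continuity is automatic and this is the Banach space of
  all bounded real sequences.\<close>

type_synonym seq = "int \<Rightarrow>\<^sub>C real"

definition conv_coeff :: "nat \<Rightarrow> seq \<Rightarrow> seq \<Rightarrow> int \<Rightarrow> real" where
  "conv_coeff r u v j = (\<Sum>\<^sub>\<infinity>i. conv_kernel r j i * (u i * v (j - i)))"

lemma seq_le_norm: "\<bar>apply_bcontfun (u :: seq) j\<bar> \<le> norm u"
  using norm_bounded[of u j] by simp

lemma conv_term_le:
  assumes r: "r \<ge> 2"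
  shows "\<bar>conv_kernel r j i * (apply_bcontfun (u :: seq) i * apply_bcontfun (v :: seq) k)\<bar>
    \<le> 2 ^ r * norm u * norm v * (1 / (weight i)\<^sup>2 + 1 / (weight (j - i))\<^sup>2)"
proof -
  have "conv_kernel r j i * (\<bar>u i\<bar> * \<bar>v k\<bar>)
    \<le> (2 ^ r * (1 / (weight i)\<^sup>2 + 1 / (weight (j - i))\<^sup>2)) * (norm u * norm v)"
    using conv_kernel_le[OF r] seq_le_norm conv_kernel_nonneg by (intro mult_mono) auto
  then show ?thesis by (simp add: abs_mult conv_kernel_nonneg mult_ac)
qed

lemma conv_majorant:
  "(\<lambda>i. 2 ^ r * norm (u :: seq) * norm (v :: seq) * (1 / (weight i)\<^sup>2 + 1 / (weight (j - i))\<^sup>2)) summable_on UNIV"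
  by (intro summable_on_cmult_right summable_on_add summable_on_inverse_weight_sq summable_on_weight_shift)

lemma conv_abs_summable:
  assumes r: "r \<ge> 2"
  shows "(\<lambda>i. norm (conv_kernel r j i * (apply_bcontfun (u :: seq) i * apply_bcontfun (v :: seq) (j - i)))) summable_on UNIV"
  by (rule Infinite_Sum.abs_summable_on_comparison_test'[OF conv_majorant]) (use conv_term_le[OF r] in auto)

lemmas conv_summable = abs_summable_summable[OF conv_abs_summable]

lemma conv_coeff_le:
  assumes r: "r \<ge> 2"
  shows "\<bar>conv_coeff r u v j\<bar> \<le> norm u * norm v * (2 ^ (r + 1) * weight_sum)"
proof -
  have "norm (conv_coeff r u v j) \<le> (\<Sum>\<^sub>\<infinity>i. norm (conv_kernel r j i * (u i * v (j - i))))"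
    unfolding conv_coeff_def by (rule norm_infsum_bound[OF conv_abs_summable[OF r]])
  also have "\<dots> \<le> (\<Sum>\<^sub>\<infinity>i. 2 ^ r * norm u * norm v * (1 / (weight i)\<^sup>2 + 1 / (weight (j - i))\<^sup>2))"
    by (rule infsum_mono[OF conv_abs_summable[OF r] conv_majorant]) (use conv_term_le[OF r] in auto)
  also have "\<dots> = 2 ^ r * norm u * norm v * (weight_sum + weight_sum)"
    by (subst infsum_cmult_right', subst infsum_add[OF summable_on_inverse_weight_sq summable_on_weight_shift])
      (simp add: infsum_weight_shift weight_sum_def)
  finally show ?thesis by (simp add: mult_ac)
qed

definition conv :: "nat \<Rightarrow> seq \<Rightarrow> seq \<Rightarrow> seq" where
  "conv r u v = Bcontfun (conv_coeff r u v)"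

lemma conv_apply:
  assumes "r \<ge> 2" shows "conv r u v j = conv_coeff r u v j"
  unfolding conv_def
  by (subst Bcontfun_inverse) (use conv_coeff_le[OF assms] in \<open>auto intro!: bcontfun_normI\<close>)

lemma bounded_bilinear_conv:
  assumes r: "r \<ge> 2" shows "bounded_bilinear (conv r)"
proof
  show "conv r (u + u') v = conv r u v + conv r u' v" for u u' v
  proof (rule bcontfun_eqI)
    fix j
    have "conv_coeff r (u + u') v j = (\<Sum>\<^sub>\<infinity>i. conv_kernel r j i * (u i * v (j - i)) + conv_kernel r j i * (u' i * v (j - i)))"
      unfolding conv_coeff_def by (intro infsum_cong) (simp add: distrib_left distrib_right)
    also have "\<dots> = conv_coeff r u v j + conv_coeff r u' v j"
      unfolding conv_coeff_def by (rule infsum_add[OF conv_summable[OF r] conv_summable[OF r]])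
    finally show "conv r (u + u') v j = (conv r u v + conv r u' v) j" by (simp add: conv_apply[OF r])
  qed
  show "conv r u (v + v') = conv r u v + conv r u v'" for u v v'
  proof (rule bcontfun_eqI)
    fix j
    have "conv_coeff r u (v + v') j = (\<Sum>\<^sub>\<infinity>i. conv_kernel r j i * (u i * v (j - i)) + conv_kernel r j i * (u i * v' (j - i)))"
      unfolding conv_coeff_def by (intro infsum_cong) (simp add: distrib_left)
    also have "\<dots> = conv_coeff r u v j + conv_coeff r u v' j"
      unfolding conv_coeff_def by (rule infsum_add[OF conv_summable[OF r] conv_summable[OF r]])
    finally show "conv r u (v + v') j = (conv r u v + conv r u v') j" by (simp add: conv_apply[OF r])
  qed
  show "conv r (c *\<^sub>R u) v = c *\<^sub>R conv r u v" for c u v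
    by (rule bcontfun_eqI)
      (simp add: conv_apply[OF r] conv_coeff_def infsum_cmult_right'[symmetric] mult_ac)
  show "conv r u (c *\<^sub>R v) = c *\<^sub>R conv r u v" for c u v
    by (rule bcontfun_eqI)
      (simp add: conv_apply[OF r] conv_coeff_def infsum_cmult_right'[symmetric] mult_ac)
  show "\<exists>K. \<forall>u v. norm (conv r u v) \<le> norm u * norm v * K"
    using conv_coeff_le[OF r]
    by (intro exI[of _ "2 ^ (r + 1) * weight_sum"] allI norm_bound) (simp add: conv_apply[OF r])
qed

text \<open>Used with \<open>\<epsilon> = 1\<close> for products of even sequences and with
  \<open>\<epsilon> = - 1\<close> for the square of the odd slope sequence; the product is even in
  both cases.\<close>

lemma conv_coeff_reflect:
  assumes u: "\<And>j. apply_bcontfun u (- j) = \<epsilon> * apply_bcontfun u j"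
    and v: "\<And>j. apply_bcontfun v (- j) = \<epsilon> * apply_bcontfun v j" and \<epsilon>: "\<epsilon> * \<epsilon> = 1"
  shows "conv_coeff r u v (- j) = conv_coeff r u v j"
proof -
  have b: "bij_betw uminus (UNIV :: int set) UNIV" by (rule bij_betwI[where g = uminus]) auto
  have "conv_coeff r u v (- j) = (\<Sum>\<^sub>\<infinity>i. conv_kernel r (- j) (- i) * (u (- i) * v (- j - (- i))))"
    unfolding conv_coeff_def
    by (rule infsum_reindex_bij_betw[OF b, of "\<lambda>i. conv_kernel r (- j) i * (u i * v (- j - i))", symmetric])
  also have "\<dots> = conv_coeff r u v j"
    unfolding conv_coeff_def
  proof (rule infsum_cong)
    fix i
    have 1: "- j - (- i) = - (j - i)" by simp
    have "conv_kernel r (- j) (- i) = conv_kernel r j i" unfolding conv_kernel_def 1 weight_minus ..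
    moreover have "u (- i) * v (- j - (- i)) = \<epsilon> * \<epsilon> * (u i * v (j - i))" unfolding 1 u v by (simp add: mult_ac)
    ultimately show "conv_kernel r (- j) (- i) * (u (- i) * v (- j - (- i))) = conv_kernel r j i * (u i * v (j - i))"
      using \<epsilon> by simp
  qed
  finally show ?thesis .
qed

section \<open>Fourier multipliers and the functions represented by sequences\<close>

definition seq_mult :: "(int \<Rightarrow> real) \<Rightarrow> seq \<Rightarrow> seq" where
  "seq_mult m u = Bcontfun (\<lambda>j. m j * u j)"

lemma seq_mult_apply:
  assumes "\<And>j. \<bar>m j\<bar> \<le> C" shows "seq_mult m u j = m j * u j"
  unfolding seq_mult_def
proof (subst Bcontfun_inverse)
  have "norm (m j * u j) \<le> C * norm u" for j
    unfolding norm_mult using assms seq_le_norm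
    by (intro mult_mono) (auto intro: order_trans[OF abs_ge_zero])
  then show "(\<lambda>j. m j * u j) \<in> bcontfun" by (intro bcontfun_normI) auto
qed simp

lemma bounded_linear_seq_mult:
  assumes "\<And>j. \<bar>m j\<bar> \<le> C" shows "bounded_linear (seq_mult m)"
proof (rule bounded_linear_intro)
  show "seq_mult m (u + v) = seq_mult m u + seq_mult m v" for u v
    by (rule bcontfun_eqI) (simp add: seq_mult_apply[OF assms] distrib_left)
  show "seq_mult m (c *\<^sub>R u) = c *\<^sub>R seq_mult m u" for c u
    by (rule bcontfun_eqI) (simp add: seq_mult_apply[OF assms])
  show "norm (seq_mult m u) \<le> norm u * C" for u
  proof (rule norm_bound)
    show "norm (seq_mult m u j) \<le> norm u * C" for j
      unfolding seq_mult_apply[OF assms] norm_mult mult.commute[of "norm (m j)"]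
      using assms seq_le_norm by (intro mult_mono) (auto intro: order_trans[OF abs_ge_zero])
  qed
qed

definition synth :: "nat \<Rightarrow> seq \<Rightarrow> real \<Rightarrow> complex" where
  "synth r u t = (\<Sum>\<^sub>\<infinity>j. complex_of_real (u j / weight j ^ r) * cis (real_of_int j * t))"

lemma synth_abs_summable:
  assumes r: "r \<ge> 2"
  shows "(\<lambda>j. norm (complex_of_real (apply_bcontfun u j / weight j ^ r) * cis (real_of_int j * t))) summable_on UNIV"
proof (rule Infinite_Sum.abs_summable_on_comparison_test'[of "\<lambda>j. norm u * (1 / (weight j)\<^sup>2)"])
  show "(\<lambda>j. norm u * (1 / (weight j)\<^sup>2)) summable_on UNIV"
    by (intro summable_on_cmult_right summable_on_inverse_weight_sq)
  fix j
  have "\<bar>u j\<bar> * (1 / weight j ^ r) \<le> norm u * (1 / (weight j)\<^sup>2)"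
    using seq_le_norm inverse_weight_power_le[OF r] weight_pos by (intro mult_mono) (auto simp: less_imp_le)
  then show "norm (complex_of_real (u j / weight j ^ r) * cis (real_of_int j * t)) \<le> norm u * (1 / (weight j)\<^sup>2)"
    using weight_pos[of j] by (simp add: norm_mult norm_divide norm_power)
qed

lemmas synth_summable = abs_summable_summable[OF synth_abs_summable]

text \<open>Absolute convergence of the double series permits reindexing \<open>(i, k)\<close> by
  \<open>(i + k, i)\<close> and summing in either order.\<close>

lemma infsum_cauchy_product:
  fixes f g :: "int \<Rightarrow> complex"
  assumes f: "(\<lambda>i. norm (f i)) summable_on UNIV" and g: "(\<lambda>i. norm (g i)) summable_on UNIV"
  shows "infsum f UNIV * infsum g UNIV = (\<Sum>\<^sub>\<infinity>j. \<Sum>\<^sub>\<infinity>i. f i * g (j - i))"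
proof -
  define H where "H = (\<lambda>(i, k). f i * g k)"
  have "(\<lambda>i. norm (f i) * (\<Sum>\<^sub>\<infinity>k. norm (g k))) summable_on UNIV"
    by (rule summable_on_cmult_left) (use f in simp)
  then have "(\<lambda>p. norm (H p)) summable_on (UNIV \<times> UNIV)"
    using g unfolding Infinite_Sum.abs_summable_on_Sigma_iff H_def
    by (auto simp: norm_mult infsum_cmult_right' abs_mult infsum_nonneg intro!: summable_on_cmult_right)
  then have H: "H summable_on (UNIV \<times> UNIV)" by (rule abs_summable_summable)
  have b: "bij_betw (\<lambda>(j, i). (i, j - i)) (UNIV \<times> UNIV) (UNIV \<times> (UNIV :: int set))"
    by (rule bij_betwI[where g = "\<lambda>(i, k). (i + k, i)"]) auto
  have "infsum H (UNIV \<times> UNIV) = (\<Sum>\<^sub>\<infinity>i. \<Sum>\<^sub>\<infinity>k. f i * g k)"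
    using infsum_Sigma_banach[OF H] by (simp add: H_def)
  also have "\<dots> = infsum f UNIV * infsum g UNIV"
    by (simp add: infsum_cmult_right' infsum_cmult_left')
  finally have "infsum f UNIV * infsum g UNIV = infsum H (UNIV \<times> UNIV)" by simp
  also have "\<dots> = infsum (\<lambda>p. H (case p of (j, i) \<Rightarrow> (i, j - i))) (UNIV \<times> UNIV)"
    by (rule infsum_reindex_bij_betw[OF b, symmetric])
  also have "\<dots> = (\<Sum>\<^sub>\<infinity>j. \<Sum>\<^sub>\<infinity>i. H (case (j, i) of (j, i) \<Rightarrow> (i, j - i)))"
  proof (rule infsum_Sigma_banach[symmetric])
    show "(\<lambda>p. H (case p of (j, i) \<Rightarrow> (i, j - i))) summable_on (UNIV \<times> UNIV)"
      using summable_on_reindex_bij_betw[OF b, of H] H by simp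
  qed
  finally show ?thesis by (simp add: H_def)
qed

text \<open>The weights inside the kernel cancel those of the two factors and leave the weight of
  the product.\<close>

lemma synth_conv:
  assumes r: "r \<ge> 2"
  shows "synth r (conv r u v) t = synth r u t * synth r v t"
proof -
  have "synth r u t * synth r v t = (\<Sum>\<^sub>\<infinity>j. \<Sum>\<^sub>\<infinity>i. (complex_of_real (u i / weight i ^ r) * cis (real_of_int i * t)) *
      (complex_of_real (v (j - i) / weight (j - i) ^ r) * cis (real_of_int (j - i) * t)))"
    unfolding synth_def by (rule infsum_cauchy_product[OF synth_abs_summable[OF r] synth_abs_summable[OF r]])
  also have "\<dots> = synth r (conv r u v) t"
    unfolding synth_def
  proof (rule infsum_cong)
    fix j
    have "(complex_of_real (u i / weight i ^ r) * cis (real_of_int i * t)) *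
        (complex_of_real (v (j - i) / weight (j - i) ^ r) * cis (real_of_int (j - i) * t))
      = complex_of_real (1 / weight j ^ r) * cis (real_of_int j * t) *
        complex_of_real (conv_kernel r j i * (u i * v (j - i)))" for i
    proof -
      have "cis (real_of_int i * t) * cis (real_of_int (j - i) * t) = cis (real_of_int j * t)"
        by (simp add: cis_mult algebra_simps)
      moreover have "complex_of_real (u i / weight i ^ r) * complex_of_real (v (j - i) / weight (j - i) ^ r)
        = complex_of_real (1 / weight j ^ r) * complex_of_real (conv_kernel r j i * (u i * v (j - i)))"
        unfolding of_real_mult[symmetric] conv_kernel_def using weight_nz[of j] by simp
      moreover have "A * B * (C * D) = E * F * G" if "B * D = F" "A * C = E * G" for A B C D E F G :: complex
      proof -
        have "A * B * (C * D) = (A * C) * (B * D)" by (simp only: mult_ac)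
        also have "\<dots> = E * F * G" unfolding that by (simp only: mult_ac)
        finally show ?thesis .
      qed
      ultimately show ?thesis by blast
    qed
    then have "(\<Sum>\<^sub>\<infinity>i. (complex_of_real (u i / weight i ^ r) * cis (real_of_int i * t)) *
        (complex_of_real (v (j - i) / weight (j - i) ^ r) * cis (real_of_int (j - i) * t)))
      = complex_of_real (1 / weight j ^ r) * cis (real_of_int j * t) *
        (\<Sum>\<^sub>\<infinity>i. complex_of_real (conv_kernel r j i * (u i * v (j - i))))"
      by (simp only: infsum_cmult_right')
    also have "(\<Sum>\<^sub>\<infinity>i. complex_of_real (conv_kernel r j i * (u i * v (j - i)))) = complex_of_real (conv r u v j)"
      unfolding conv_apply[OF r] conv_coeff_def
      by (rule infsumI[OF has_sum_of_real[OF has_sum_infsum[OF conv_summable[OF r]]]])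
    finally show "(\<Sum>\<^sub>\<infinity>i. (complex_of_real (u i / weight i ^ r) * cis (real_of_int i * t)) *
        (complex_of_real (v (j - i) / weight (j - i) ^ r) * cis (real_of_int (j - i) * t)))
      = complex_of_real (conv r u v j / weight j ^ r) * cis (real_of_int j * t)"
      by (simp add: mult_ac)
  qed
  finally show ?thesis by simp
qed

lemma synth_add:
  assumes r: "r \<ge> 2" shows "synth r (u + v) t = synth r u t + synth r v t"
  unfolding synth_def infsum_add[OF synth_summable[OF r] synth_summable[OF r], symmetric]
  by (intro infsum_cong) (simp add: add_divide_distrib distrib_right)

lemma synth_scaleR: "synth r (c *\<^sub>R u) t = of_real c * synth r u t"
  unfolding synth_def infsum_cmult_right'[symmetric] by (intro infsum_cong) simp

lemma synth_diff:
  assumes r: "r \<ge> 2" shows "synth r (u - v) t = synth r u t - synth r v t"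
  using synth_add[OF r, of u "(- 1) *\<^sub>R v" t] synth_scaleR[of r "- 1" v t] by simp

text \<open>The entries at \<open>k\<close> and \<open>- k\<close> combine, hence the factor 2 away
  from the mean. For odd sequences the same numbers are sine coefficients.\<close>

definition even_coeff :: "nat \<Rightarrow> seq \<Rightarrow> nat \<Rightarrow> real" where
  "even_coeff r u k = (if k = 0 then 1 else 2) * u (int k) / (1 + real k) ^ r"

lemma synth_even:
  assumes r: "r \<ge> 2" and u: "\<And>j. apply_bcontfun u (- j) = apply_bcontfun u j"
  shows "(\<lambda>k. even_coeff r u k * cos (real k * t)) sums Re (synth r u t)" and "Im (synth r u t) = 0"
proof -
  have "(\<lambda>k. if k = 0 then complex_of_real (u 0 / weight 0 ^ r) * cis (real_of_int 0 * t)
      else complex_of_real (u (int k) / weight (int k) ^ r) * cis (real_of_int (int k) * t)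
        + complex_of_real (u (- int k) / weight (- int k) ^ r) * cis (real_of_int (- int k) * t)) sums synth r u t"
    unfolding synth_def by (rule has_sum_int_sums[OF has_sum_infsum[OF synth_summable[OF r]]])
  then have s: "(\<lambda>k. complex_of_real (even_coeff r u k * cos (real k * t))) sums synth r u t"
    by (rule sums_cong[THEN iffD1, rotated])
      (auto simp: even_coeff_def u weight_of_nat weight_def complex_eq_iff)
  from sums_Re[OF s] show "(\<lambda>k. even_coeff r u k * cos (real k * t)) sums Re (synth r u t)" by simp
  from sums_Im[OF s] show "Im (synth r u t) = 0" by (simp add: sums_0 sums_unique2 sums_iff)
qed

lemma synth_odd:
  assumes r: "r \<ge> 2" and u: "\<And>j. apply_bcontfun u (- j) = - apply_bcontfun u j"
  shows "(\<lambda>k. even_coeff r u k * sin (real k * t)) sums Im (synth r u t)" and "Re (synth r u t) = 0"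
proof -
  have u0: "u 0 = 0" using u[of 0] by simp
  have "(\<lambda>k. if k = 0 then complex_of_real (u 0 / weight 0 ^ r) * cis (real_of_int 0 * t)
      else complex_of_real (u (int k) / weight (int k) ^ r) * cis (real_of_int (int k) * t)
        + complex_of_real (u (- int k) / weight (- int k) ^ r) * cis (real_of_int (- int k) * t)) sums synth r u t"
    unfolding synth_def by (rule has_sum_int_sums[OF has_sum_infsum[OF synth_summable[OF r]]])
  then have s: "(\<lambda>k. \<i> * complex_of_real (even_coeff r u k * sin (real k * t))) sums synth r u t"
    by (rule sums_cong[THEN iffD1, rotated])
      (auto simp: even_coeff_def u u0 weight_of_nat weight_def complex_eq_iff)
  from sums_Im[OF s] show "(\<lambda>k. even_coeff r u k * sin (real k * t)) sums Im (synth r u t)" by simp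
  from sums_Re[OF s] show "Re (synth r u t) = 0" by (simp add: sums_0 sums_unique2 sums_iff)
qed

section \<open>A contraction depending on a small parameter\<close>

definition lip_on :: "'a :: metric_space set \<Rightarrow> ('a \<Rightarrow> 'b :: metric_space) \<Rightarrow> bool" where
  "lip_on S f \<longleftrightarrow> (\<exists>L. L-lipschitz_on S f)"

lemma lip_on_const: "lip_on S (\<lambda>_. c)"
  unfolding lip_on_def using lipschitz_on_constant by blast

lemma lip_on_add:
  fixes f g :: "'a :: metric_space \<Rightarrow> 'b :: real_normed_vector"
  shows "lip_on S f \<Longrightarrow> lip_on S g \<Longrightarrow> lip_on S (\<lambda>x. f x + g x)"
  unfolding lip_on_def using lipschitz_on_add by blast

lemma lip_on_diff:
  fixes f g :: "'a :: metric_space \<Rightarrow> 'b :: real_normed_vector"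
  shows "lip_on S f \<Longrightarrow> lip_on S g \<Longrightarrow> lip_on S (\<lambda>x. f x - g x)"
  unfolding lip_on_def using lipschitz_on_diff by blast

lemma lip_on_linear:
  assumes "bounded_linear h" and "lip_on S f"
  shows "lip_on S (\<lambda>x. h (f x))"
proof -
  obtain B where "B-lipschitz_on (f ` S) h"
    using bounded_linear.lipschitz_boundE[OF assms(1)] by blast
  moreover obtain L where "L-lipschitz_on S f" using assms(2) by (auto simp: lip_on_def)
  ultimately show ?thesis unfolding lip_on_def using lipschitz_on_compose2 by blast
qed

lemma lip_on_bound:
  fixes f :: "'a :: metric_space \<Rightarrow> 'b :: real_normed_vector"
  assumes S: "bounded S" and f: "lip_on S f"
  obtains K where "K \<ge> 0" and "\<And>x. x \<in> S \<Longrightarrow> norm (f x) \<le> K"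
proof (cases "S = {}")
  case True then show ?thesis using that[of 0] by simp
next
  case False
  then obtain x0 where x0: "x0 \<in> S" by blast
  obtain L where L: "L-lipschitz_on S f" using f by (auto simp: lip_on_def)
  obtain e where e: "\<And>x. x \<in> S \<Longrightarrow> dist x0 x \<le> e"
    using S x0 unfolding bounded_any_center[where a = x0] by blast
  have L0: "L \<ge> 0" using L by (rule lipschitz_on_nonneg)
  have e0: "e \<ge> 0" using e[OF x0] by simp
  have "norm (f x) \<le> norm (f x0) + L * e" if "x \<in> S" for x
  proof -
    have "dist (f x) (f x0) \<le> L * dist x x0" using L that x0 by (rule lipschitz_onD)
    also have "\<dots> \<le> L * e" using e[OF that] L0 by (intro mult_left_mono) (simp_all add: dist_commute)
    finally show ?thesis using norm_triangle_sub[of "f x" "f x0"] by (simp add: dist_norm)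
  qed
  then show ?thesis using that[of "norm (f x0) + L * e"] L0 e0 by simp
qed

text \<open>The product rule for differences; boundedness of \<open>S\<close> bounds the factor that
  is held fixed.\<close>

lemma lip_on_bilinear:
  fixes f :: "'a :: metric_space \<Rightarrow> 'b :: real_normed_vector" and g :: "'a \<Rightarrow> 'c :: real_normed_vector"
  assumes B: "bounded_bilinear B" and S: "bounded S" and f: "lip_on S f" and g: "lip_on S g"
  shows "lip_on S (\<lambda>x. B (f x) (g x))"
proof -
  interpret bounded_bilinear B by fact
  obtain K where K: "K \<ge> 0" "\<And>u v. norm (B u v) \<le> norm u * norm v * K"
    using nonneg_bounded by blast
  obtain F where F: "F \<ge> 0" "\<And>x. x \<in> S \<Longrightarrow> norm (f x) \<le> F" using lip_on_bound[OF S f] by blast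
  obtain G where G: "G \<ge> 0" "\<And>x. x \<in> S \<Longrightarrow> norm (g x) \<le> G" using lip_on_bound[OF S g] by blast
  obtain L where L: "L-lipschitz_on S f" using f by (auto simp: lip_on_def)
  obtain M where M: "M-lipschitz_on S g" using g by (auto simp: lip_on_def)
  have L0: "L \<ge> 0" and M0: "M \<ge> 0" using L M by (auto intro: lipschitz_on_nonneg)
  have "((L * G + F * M) * K)-lipschitz_on S (\<lambda>x. B (f x) (g x))"
  proof (rule lipschitz_onI)
    show "(L * G + F * M) * K \<ge> 0" using K F G L0 M0 by simp
    fix x y assume x: "x \<in> S" and y: "y \<in> S"
    have df: "norm (f x - f y) \<le> L * dist x y" using lipschitz_onD[OF L x y] by (simp add: dist_norm)
    have dg: "norm (g x - g y) \<le> M * dist x y" using lipschitz_onD[OF M x y] by (simp add: dist_norm)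
    have eq: "B (f x) (g x) - B (f y) (g y) = B (f x - f y) (g x) + B (f y) (g x - g y)"
      by (simp add: diff_left diff_right)
    have "norm (B (f x) (g x) - B (f y) (g y)) \<le> norm (f x - f y) * norm (g x) * K + norm (f y) * norm (g x - g y) * K"
      unfolding eq by (rule order_trans[OF norm_triangle_ineq add_mono[OF K(2) K(2)]])
    also have "\<dots> \<le> (L * dist x y) * G * K + F * (M * dist x y) * K"
      using df dg F(2)[OF y] G(2)[OF x] F(1) G(1) K(1) L0 M0
      by (intro add_mono mult_right_mono mult_mono) auto
    finally show "dist (B (f x) (g x)) (B (f y) (g y)) \<le> (L * G + F * M) * K * dist x y"
      by (simp add: dist_norm algebra_simps)
  qed
  then show ?thesis by (auto simp: lip_on_def)
qed

text \<open>Since \<open>Q\<close> vanishes to second order at 0, its Lipschitz constant on a ball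
  is proportional to the radius, while the other term is small through \<open>s\<close>. The set
  \<open>V\<close> is where invariance is known; it will be the even sequences.\<close>

lemma parametrized_fixed_point:
  fixes Q :: "'a :: real_normed_vector \<Rightarrow> 'a" and R :: "real \<Rightarrow> 'a \<Rightarrow> 'a"
  assumes Q0: "Q 0 = 0"
    and Q: "\<And>r z z'. r \<le> 1 \<Longrightarrow> norm z \<le> r \<Longrightarrow> norm z' \<le> r \<Longrightarrow> norm (Q z - Q z') \<le> C * r * norm (z - z')"
    and R: "lip_on ({-1..1} \<times> cball 0 1) (\<lambda>(s, z). R s z)"
    and V: "complete V" "0 \<in> V" "\<And>s z. z \<in> V \<Longrightarrow> Q z + s *\<^sub>R R s z \<in> V"
  obtains \<epsilon> z L where "\<epsilon> > 0" "\<epsilon> \<le> 1" "z 0 = 0"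
    "\<And>s. \<bar>s\<bar> \<le> \<epsilon> \<Longrightarrow> z s \<in> V \<and> norm (z s) \<le> 1 \<and> Q (z s) + s *\<^sub>R R s (z s) = z s"
    "\<And>s s'. \<bar>s\<bar> \<le> \<epsilon> \<Longrightarrow> \<bar>s'\<bar> \<le> \<epsilon> \<Longrightarrow> norm (z s - z s') \<le> L * \<bar>s - s'\<bar>"
proof -
  let ?S = "{-1..1} \<times> cball 0 1 :: (real \<times> 'a) set"
  obtain M where M: "M-lipschitz_on ?S (\<lambda>(s, z). R s z)" using R by (auto simp: lip_on_def)
  have M0: "M \<ge> 0" using M by (rule lipschitz_on_nonneg)
  have "bounded ?S" by (intro bounded_Times bounded_closed_interval bounded_cball)
  then obtain B where B: "B \<ge> 0" "\<And>x. x \<in> ?S \<Longrightarrow> norm ((\<lambda>(s, z). R s z) x) \<le> B"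
    using lip_on_bound[OF _ R] by blast
  have RB: "norm (R s z) \<le> B" if "\<bar>s\<bar> \<le> 1" "norm z \<le> 1" for s z
    using B(2)[of "(s, z)"] that by (simp add: abs_le_iff)
  have Rz: "norm (R s z - R s z') \<le> M * norm (z - z')" if "\<bar>s\<bar> \<le> 1" "norm z \<le> 1" "norm z' \<le> 1" for s z z'
    using lipschitz_onD[OF M, of "(s, z)" "(s, z')"] that by (simp add: dist_Pair_Pair dist_norm abs_le_iff)
  have Rs: "norm (R s z - R s' z) \<le> M * \<bar>s - s'\<bar>" if "\<bar>s\<bar> \<le> 1" "\<bar>s'\<bar> \<le> 1" "norm z \<le> 1" for s s' z
    using lipschitz_onD[OF M, of "(s, z)" "(s', z)"] that by (simp add: dist_Pair_Pair dist_norm abs_le_iff)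
  define r where "r = 1 / (4 * (\<bar>C\<bar> + 1))"
  have r: "r > 0" "r \<le> 1" by (auto simp: r_def divide_le_eq)
  have "\<bar>C\<bar> * r \<le> 1 / 4" by (simp add: r_def field_simps)
  then have Cr: "C * r \<le> 1 / 4" using r(1) abs_ge_self[of C] mult_right_mono[of C "\<bar>C\<bar>" r] by linarith
  \<comment> \<open>The three bounds keep \<open>s\<close> in the domain of \<open>R\<close>, hold
    the share of \<open>R\<close> in the contraction constant to \<open>1 / 4\<close>, and place the
    image of 0 within half the radius.\<close>
  define \<epsilon> where "\<epsilon> = min 1 (min (1 / (4 * (M + 1))) (r / (2 * (B + 1))))"
  have \<epsilon>: "\<epsilon> > 0" "\<epsilon> \<le> 1" using M0 B(1) r by (auto simp: \<epsilon>_def)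
  have \<epsilon>M: "\<epsilon> * M \<le> 1 / 4"
  proof -
    have "\<epsilon> * M \<le> 1 / (4 * (M + 1)) * M" using M0 by (intro mult_right_mono) (auto simp: \<epsilon>_def)
    also have "\<dots> \<le> 1 / 4" using M0 by (simp add: field_simps)
    finally show ?thesis .
  qed
  have \<epsilon>B: "\<epsilon> * B \<le> r / 2"
  proof -
    have "\<epsilon> * B \<le> r / (2 * (B + 1)) * B" using B(1) by (intro mult_right_mono) (auto simp: \<epsilon>_def)
    also have "\<dots> \<le> r / 2" using B(1) r by (simp add: field_simps)
    finally show ?thesis .
  qed
  define T where "T = (\<lambda>s z. Q z + s *\<^sub>R R s z)"
  define X where "X = V \<inter> cball 0 r"
  have X: "complete X" "0 \<in> X" using V r by (auto simp: X_def intro: complete_Int_closed)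
  have T_lip: "norm (T s z - T s z') \<le> 1 / 2 * norm (z - z')" if s: "\<bar>s\<bar> \<le> \<epsilon>" and z: "norm z \<le> r" "norm z' \<le> r" for s z z'
  proof -
    have "norm (Q z - Q z') \<le> 1 / 4 * norm (z - z')"
      using Q[OF r(2) z] mult_right_mono[OF Cr, of "norm (z - z')"] by simp
    moreover have "norm (s *\<^sub>R (R s z - R s z')) \<le> 1 / 4 * norm (z - z')"
    proof -
      have "\<bar>s\<bar> * norm (R s z - R s z') \<le> \<epsilon> * (M * norm (z - z'))"
        using s z r \<epsilon> Rz[of s z z'] by (intro mult_mono) auto
      also have "\<dots> \<le> 1 / 4 * norm (z - z')" using mult_right_mono[OF \<epsilon>M, of "norm (z - z')"] by (simp add: mult_ac)
      finally show ?thesis by simp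
    qed
    moreover have "T s z - T s z' = (Q z - Q z') + s *\<^sub>R (R s z - R s z')"
      by (simp add: T_def scaleR_diff_right)
    ultimately show ?thesis using norm_triangle_ineq[of "Q z - Q z'" "s *\<^sub>R (R s z - R s z')"] by simp
  qed
  have T_X: "T s z \<in> X" if s: "\<bar>s\<bar> \<le> \<epsilon>" and z: "z \<in> X" for s z
  proof -
    have zr: "norm z \<le> r" using z by (auto simp: X_def)
    have "norm (T s z - T s 0) \<le> 1 / 2 * norm z" using T_lip[OF s zr, of 0] r by simp
    moreover have "norm (T s 0) \<le> r / 2"
    proof -
      have "\<bar>s\<bar> * norm (R s 0) \<le> \<epsilon> * B" using s \<epsilon> RB[of s 0] by (intro mult_mono) auto
      then show ?thesis using \<epsilon>B by (simp add: T_def Q0)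
    qed
    ultimately have "norm (T s z) \<le> r" using zr norm_triangle_sub[of "T s z" "T s 0"] by linarith
    then show ?thesis using V(3) z by (auto simp: X_def T_def)
  qed
  have ex: "\<exists>!z. z \<in> X \<and> T s z = z" if s: "\<bar>s\<bar> \<le> \<epsilon>" for s
  proof -
    have "\<exists>!z\<in>X. T s z = z"
    proof (rule Banach_fix[of X "1 / 2"])
      show "dist (T s z) (T s z') \<le> 1 / 2 * dist z z'" if "z \<in> X" "z' \<in> X" for z z'
        using T_lip[OF s, of z z'] that by (auto simp: X_def dist_norm)
    qed (use X T_X[OF s] in auto)
    then show ?thesis by blast
  qed
  define z where "z = (\<lambda>s. THE z. z \<in> X \<and> T s z = z)"
  have z: "z s \<in> X" "T s (z s) = z s" if "\<bar>s\<bar> \<le> \<epsilon>" for s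
    using theI'[OF ex[OF that]] by (auto simp: z_def)
  have "z 0 = 0"
  proof -
    have "T 0 0 = 0" by (simp add: T_def Q0)
    then show ?thesis using ex[of 0] z[of 0] X(2) \<epsilon> by (metis abs_zero less_imp_le)
  qed
  moreover have "norm (z s - z s') \<le> 2 * (B + M) * \<bar>s - s'\<bar>" if s: "\<bar>s\<bar> \<le> \<epsilon>" and s': "\<bar>s'\<bar> \<le> \<epsilon>" for s s'
  proof -
    have n: "norm (z s) \<le> r" "norm (z s') \<le> r" using z s s' by (auto simp: X_def)
    have 1: "norm (T s (z s) - T s (z s')) \<le> 1 / 2 * norm (z s - z s')" by (rule T_lip[OF s n])
    have "T s (z s') - T s' (z s') = (s - s') *\<^sub>R R s (z s') + s' *\<^sub>R (R s (z s') - R s' (z s'))"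
      by (simp add: T_def algebra_simps)
    then have "norm (T s (z s') - T s' (z s')) \<le> \<bar>s - s'\<bar> * norm (R s (z s')) + \<bar>s'\<bar> * norm (R s (z s') - R s' (z s'))"
      by (metis norm_scaleR norm_triangle_ineq)
    also have "\<dots> \<le> \<bar>s - s'\<bar> * B + 1 * (M * \<bar>s - s'\<bar>)"
      using s s' \<epsilon> n r RB[of s "z s'"] Rs[of s s' "z s'"] by (intro add_mono mult_mono) auto
    finally have 2: "norm (T s (z s') - T s' (z s')) \<le> (B + M) * \<bar>s - s'\<bar>" by (simp add: algebra_simps)
    \<comment> \<open>Changing the point costs at most half the distance, which is absorbed on the
      left; changing the parameter costs \<open>B + M\<close> per unit. This gives the factor
      2.\<close>
    have eq: "z s - z s' = (T s (z s) - T s (z s')) + (T s (z s') - T s' (z s'))"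
      using z(2)[OF s] z(2)[OF s'] by simp
    have "norm (z s - z s') \<le> 1 / 2 * norm (z s - z s') + (B + M) * \<bar>s - s'\<bar>"
      by (subst eq) (rule order_trans[OF norm_triangle_ineq add_mono[OF 1 2]])
    then show ?thesis unfolding mult.assoc[of 2] by linarith
  qed
  moreover have "z s \<in> V \<and> norm (z s) \<le> 1 \<and> Q (z s) + s *\<^sub>R R s (z s) = z s" if "\<bar>s\<bar> \<le> \<epsilon>" for s
    using z[OF that] r by (auto simp: X_def T_def)
  ultimately show ?thesis using that[OF \<epsilon>] by blast
qed

section \<open>Bounds for the symbol\<close>

lemma sinh_mult_le:
  assumes "(x::real) \<ge> 0" shows "sinh (real m * x) \<le> real m * sinh x * cosh (real m * x)"
proof (induction m)
  case (Suc m)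
  have eq: "real (Suc m) * x = real m * x + x" by (simp add: algebra_simps)
  have s: "sinh x \<ge> 0" "sinh (real m * x) \<ge> 0" using assms by auto
  have c: "cosh (real m * x) * cosh x \<le> cosh (real (Suc m) * x)" unfolding eq cosh_add using s by simp
  have c': "cosh (real m * x) \<le> cosh (real (Suc m) * x)"
    using assms by (subst cosh_real_nonneg_le_iff) (auto intro: mult_right_mono)
  have "sinh (real (Suc m) * x) = sinh (real m * x) * cosh x + cosh (real m * x) * sinh x"
    unfolding eq sinh_add by simp
  also have "\<dots> \<le> (real m * sinh x * cosh (real m * x)) * cosh x + cosh (real (Suc m) * x) * sinh x"
    using Suc c' s by (intro add_mono mult_right_mono) auto
  also have "\<dots> = real m * sinh x * (cosh (real m * x) * cosh x) + cosh (real (Suc m) * x) * sinh x" by simp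
  also have "\<dots> \<le> real m * sinh x * cosh (real (Suc m) * x) + cosh (real (Suc m) * x) * sinh x"
    using c s by (intro add_mono mult_left_mono) auto
  finally show ?case by (simp add: algebra_simps)
qed simp

text \<open>A quantitative form of monotonicity, linear in \<open>k\<close>. After clearing
  denominators the subtraction formula leaves \<open>sinh (real m * x)\<close> with
  \<open>m = k - 1\<close>, which \<open>sinh_mult_le\<close> controls.\<close>

lemma coth_gap:
  assumes x: "(x::real) > 0" and k: "k \<ge> 1"
  shows "real k * (cosh (real k * x) / sinh (real k * x)) - cosh x / sinh x
    \<ge> real (k - 1) * (1 - 1 / cosh x)"
proof -
  define m where "m = k - 1"
  have km: "real k = real m + 1" using k by (simp add: m_def)
  have eq: "real k * x = real m * x + x" by (simp add: km algebra_simps)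
  have pos: "sinh x > 0" "sinh (real k * x) > 0" "cosh x > 0" "cosh (real k * x) > 0" "sinh (real m * x) \<ge> 0"
    using x k by auto
  have "sinh (real m * x) = sinh (real k * x) * cosh x - cosh (real k * x) * sinh x"
    using sinh_diff[of "real k * x" x] by (simp add: eq)
  then have num: "real k * cosh (real k * x) * sinh x - cosh x * sinh (real k * x)
      = real m * cosh (real k * x) * sinh x - sinh (real m * x)"
    by (simp add: km algebra_simps)
  have "cosh (real m * x) * cosh x \<le> cosh (real k * x)" unfolding eq cosh_add using pos by simp
  then have "cosh (real m * x) \<le> cosh (real k * x) / cosh x" using pos by (simp add: le_divide_eq)
  then have "real m * sinh x * cosh (real m * x) \<le> real m * sinh x * (cosh (real k * x) / cosh x)"
    using pos by (intro mult_left_mono) auto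
  then have "real m * cosh (real k * x) * sinh x - sinh (real m * x)
      \<ge> real m * sinh x * cosh (real k * x) * (1 - 1 / cosh x)"
    using sinh_mult_le[of x m] x by (simp add: algebra_simps)
  moreover have "real m * sinh x * cosh (real k * x) * (1 - 1 / cosh x)
      \<ge> real m * sinh x * sinh (real k * x) * (1 - 1 / cosh x)"
    using pos sinh_le_cosh_real[of "real k * x"] cosh_real_ge_1[of x]
    by (intro mult_right_mono mult_left_mono) (auto simp: divide_le_eq)
  ultimately have "real m * (1 - 1 / cosh x) * (sinh x * sinh (real k * x))
      \<le> real k * cosh (real k * x) * sinh x - cosh x * sinh (real k * x)"
    unfolding num by (simp add: mult_ac)
  then have "real m * (1 - 1 / cosh x)
      \<le> (real k * cosh (real k * x) * sinh x - cosh x * sinh (real k * x)) / (sinh x * sinh (real k * x))"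
    using pos by (subst pos_le_divide_eq) auto
  also have "\<dots> = real k * (cosh (real k * x) / sinh (real k * x)) - cosh x / sinh x"
  proof -
    have "(c * S - d * T) / (S * T) = c / T - d / S" if "S \<noteq> 0" "T \<noteq> 0" for c d S T :: real
      using that by (simp add: field_simps)
    from this[of "sinh x" "sinh (real k * x)" "real k * cosh (real k * x)" "cosh x"]
    show ?thesis using pos k by simp
  qed
  finally show ?thesis by (simp add: m_def)
qed

context wave_frame
begin

lemma dn_symbol_pos_eq: "k \<noteq> 0 \<Longrightarrow> dn_symbol k = real k * \<kappa> * (cosh (real k * (\<kappa> * h)) / sinh (real k * (\<kappa> * h)))"
  by (simp add: dn_symbol_def profile_def mult.assoc)

lemma dn_symbol_le: "\<bar>dn_symbol k\<bar> \<le> profile_bound * (1 + \<kappa>) * (1 + real k)"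
  using profile_le[of 0 1 k] h by (simp add: dn_symbol_def)

lemma dn_symbol_gap:
  obtains c where "c > 0" and "\<And>k. k \<ge> 2 \<Longrightarrow> dn_symbol k - dn_symbol 1 \<ge> c * (1 + real k)"
proof
  define \<delta> where "\<delta> = 1 - 1 / cosh (\<kappa> * h)"
  have "cosh (\<kappa> * h) > 1" using \<kappa> h cosh_real_nonneg_less_iff[of 0 "\<kappa> * h"] by simp
  then have \<delta>: "\<delta> > 0" by (simp add: \<delta>_def)
  show "\<kappa> * \<delta> / 3 > 0" using \<delta> \<kappa> by simp
  fix k :: nat assume k: "k \<ge> 2"
  have "\<kappa> * (real (k - 1) * \<delta>) \<le> \<kappa> * (real k * (cosh (real k * (\<kappa> * h)) / sinh (real k * (\<kappa> * h))) - cosh (\<kappa> * h) / sinh (\<kappa> * h))"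
    using coth_gap[of "\<kappa> * h" k] k \<kappa> h by (intro mult_left_mono) (auto simp: \<delta>_def)
  also have "\<dots> = dn_symbol k - dn_symbol 1" using k by (simp add: dn_symbol_pos_eq algebra_simps)
  also have "\<kappa> * (real (k - 1) * \<delta>) \<ge> \<kappa> * \<delta> / 3 * (1 + real k)"
  proof -
    \<comment> \<open>An equality at \<open>k = 2\<close>, the first mode beyond the critical one;
      this is the origin of the factor \<open>1 / 3\<close>.\<close>
    have "(1 + real k) / 3 \<le> real (k - 1)" using k by (simp add: of_nat_diff)
    then have "\<kappa> * \<delta> * ((1 + real k) / 3) \<le> \<kappa> * \<delta> * real (k - 1)" using \<kappa> \<delta> by (intro mult_left_mono) auto
    then show ?thesis by (simp add: mult_ac)
  qed
  finally show "\<kappa> * \<delta> / 3 * (1 + real k) \<le> dn_symbol k - dn_symbol 1" .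
qed

end

section \<open>Bifurcation of periodic waves\<close>

definition even_seq :: "seq \<Rightarrow> bool" where
  "even_seq u \<longleftrightarrow> (\<forall>j. u (- j) = u j)"

lemma even_seqD: "even_seq u \<Longrightarrow> apply_bcontfun u (- j) = apply_bcontfun u j"
  by (simp add: even_seq_def)

lemma bounded_linear_seq_eval: "bounded_linear (\<lambda>u :: seq. apply_bcontfun u j)"
  by (rule bounded_linear_intro[of _ 1]) (use seq_le_norm in auto)

lemma closed_even_seq: "closed {u. even_seq u}"
  unfolding even_seq_def
  by (intro closed_Collect_all closed_Collect_eq linear_continuous_on bounded_linear_seq_eval)

lemma complete_seq: "complete (UNIV :: seq set)"
  unfolding complete_def
proof (intro allI impI)
  fix f :: "nat \<Rightarrow> seq" assume "(\<forall>n. f n \<in> UNIV) \<and> Cauchy f"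
  then have "Cauchy f" by simp
  have "uniformly_Cauchy_on UNIV (\<lambda>m. apply_bcontfun (f m))"
  proof (rule uniformly_Cauchy_onI)
    fix e :: real assume "e > 0"
    with \<open>Cauchy f\<close> obtain M where M: "\<And>m k. m \<ge> M \<Longrightarrow> k \<ge> M \<Longrightarrow> dist (f m) (f k) < e"
      unfolding Cauchy_def by blast
    then show "\<exists>M. \<forall>x\<in>UNIV. \<forall>m\<ge>M. \<forall>k\<ge>M. dist (f m x) (f k x) < e"
      by (intro exI[of _ M] ballI allI impI dist_fun_lt_imp_dist_val_lt)
  qed
  then obtain g where "uniform_limit UNIV (\<lambda>m. apply_bcontfun (f m)) g sequentially"
    using Cauchy_uniformly_convergent unfolding uniformly_convergent_on_def by blast
  then obtain l :: seq where "f \<longlonglongrightarrow> l" by (rule uniform_limit_bcontfunE) simp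
  then show "\<exists>l\<in>(UNIV :: seq set). f \<longlonglongrightarrow> l" by blast
qed

lemma complete_even_seq: "complete {u. even_seq u}"
  by (rule complete_closed_subset[OF closed_even_seq subset_UNIV complete_seq])

lemma even_seq_zero: "even_seq 0"
  and even_seq_add: "even_seq u \<Longrightarrow> even_seq v \<Longrightarrow> even_seq (u + v)"
  and even_seq_diff: "even_seq u \<Longrightarrow> even_seq v \<Longrightarrow> even_seq (u - v)"
  and even_seq_scaleR: "even_seq u \<Longrightarrow> even_seq (c *\<^sub>R u)"
  by (simp_all add: even_seq_def)

lemma even_seq_mult:
  assumes "\<And>j. \<bar>m j\<bar> \<le> C" and "\<And>j. m (- j) = m j" and "even_seq u"
  shows "even_seq (seq_mult m u)"
  using assms by (simp add: even_seq_def seq_mult_apply[OF assms(1)])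

lemma even_seq_conv:
  assumes "r \<ge> 2" and "even_seq u" and "even_seq v"
  shows "even_seq (conv r u v)"
  unfolding even_seq_def conv_apply[OF assms(1)]
  using conv_coeff_reflect[of u 1 v r] assms(2,3) by (simp add: even_seq_def)

lemma even_seq_conv_odd:
  assumes "r \<ge> 2" and "\<And>j. apply_bcontfun u (- j) = - apply_bcontfun u j"
    and "\<And>j. apply_bcontfun v (- j) = - apply_bcontfun v j"
  shows "even_seq (conv r u v)"
  unfolding even_seq_def conv_apply[OF assms(1)]
  using conv_coeff_reflect[of u "- 1" v r] assms(2,3) by simp

lemma Re_synth_conv_even:
  assumes "r \<ge> 2" and "even_seq u" and "even_seq v"
  shows "Re (synth r (conv r u v) t) = Re (synth r u t) * Re (synth r v t)"
  using synth_even(2)[OF assms(1), of u t] assms by (simp add: synth_conv even_seq_def)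

lemma Re_synth_conv_odd:
  assumes "r \<ge> 2" and "\<And>j. apply_bcontfun u (- j) = - apply_bcontfun u j"
    and "\<And>j. apply_bcontfun v (- j) = - apply_bcontfun v j"
  shows "Re (synth r (conv r u v) t) = - (Im (synth r u t) * Im (synth r v t))"
  using synth_odd(2)[OF assms(1,2), of t] assms(1) by (simp add: synth_conv)

section \<open>Wave profiles represented by weighted sequences\<close>

context wave_frame
begin

lemma summable_inverse_square: "summable (\<lambda>k. 2 / (1 + real k)\<^sup>2)"
proof -
  have "summable (\<lambda>n. inverse (real (Suc n) ^ 2))"
    by (subst summable_Suc_iff) (rule inverse_power_summable, simp)
  then have "summable (\<lambda>n. 2 * (1 / (1 + real n)\<^sup>2))" by (intro summable_mult) (simp add: inverse_eq_divide)
  then show ?thesis by simp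
qed

definition norm_const :: real where
  "norm_const = (\<Sum>k. 2 / (1 + real k)\<^sup>2)"

lemma norm_const_nonneg: "norm_const \<ge> 0"
  unfolding norm_const_def by (intro suminf_nonneg summable_inverse_square) auto

text \<open>The exponent \<open>n + 3\<close> exceeds that of \<open>admissible\<close> by two, and
  the surplus turns boundedness of \<open>u\<close> into summability.\<close>

lemma even_coeff_le: "\<bar>even_coeff (n + 3) u k\<bar> * (1 + real k) ^ (n + 1) \<le> norm u * (2 / (1 + real k)\<^sup>2)"
proof -
  have "(1 + real k) ^ (n + 3) = (1 + real k) ^ (n + 1) * (1 + real k)\<^sup>2"
    by (simp add: numeral_3_eq_3 power2_eq_square)
  then have "\<bar>even_coeff (n + 3) u k\<bar> * (1 + real k) ^ (n + 1) = (if k = 0 then 1 else 2) * \<bar>u (int k)\<bar> / (1 + real k)\<^sup>2"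
    by (simp add: even_coeff_def abs_mult)
  also have "\<dots> \<le> 2 * norm u / (1 + real k)\<^sup>2"
    using seq_le_norm[of u "int k"] by (intro divide_right_mono) auto
  finally show ?thesis by (simp add: mult.commute)
qed

lemma even_coeff_admissible: "admissible (even_coeff (n + 3) u)"
  unfolding admissible_def
  by (rule summable_comparison_test'[OF summable_mult[OF summable_inverse_square], of 0 _ "norm u"])
    (use even_coeff_le[of u] in simp)

lemma coeff_norm_even_coeff_le: "coeff_norm (even_coeff (n + 3) u) \<le> norm_const * norm u"
proof -
  have "coeff_norm (even_coeff (n + 3) u) \<le> (\<Sum>k. norm u * (2 / (1 + real k)\<^sup>2))"
    unfolding coeff_norm_def
    using even_coeff_admissible[of u] unfolding admissible_def
    by (intro suminf_le even_coeff_le summable_mult summable_inverse_square)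
  also have "\<dots> = norm u * norm_const"
    unfolding norm_const_def by (rule suminf_mult[OF summable_inverse_square])
  finally show ?thesis by (simp add: mult.commute)
qed

definition wave :: "seq \<Rightarrow> real \<Rightarrow> real" where
  "wave u = cos_series (even_coeff (n + 3) u)"

lemma wave_diff: "wave (u - v) x = wave u x - wave v x"
  unfolding wave_def cos_series_def
  by (subst suminf_diff[OF cos_series_summable[OF even_coeff_admissible] cos_series_summable[OF even_coeff_admissible]])
    (intro suminf_cong, simp add: even_coeff_def diff_divide_distrib left_diff_distrib right_diff_distrib)

lemma wave_scaleR: "wave (c *\<^sub>R u) x = c * wave u x"
  unfolding wave_def cos_series_def
  by (subst suminf_mult[OF cos_series_summable[OF even_coeff_admissible], symmetric])
    (simp add: even_coeff_def mult_ac)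

definition wave_const :: real where
  "wave_const = (real n + 3) * (1 + \<kappa>) ^ (n + 1) * norm_const"

lemma wave_const_nonneg: "wave_const \<ge> 0"
  using \<kappa> norm_const_nonneg by (simp add: wave_const_def)

lemma holder_norm_wave_le: "holder_norm n a (wave u) \<le> wave_const * norm u"
proof -
  have "holder_norm n a (wave u) \<le> (real n + 3) * (1 + \<kappa>) ^ (n + 1) * coeff_norm (even_coeff (n + 3) u)"
    unfolding wave_def by (rule holder_norm_cos_series_le[OF even_coeff_admissible])
  also have "\<dots> \<le> (real n + 3) * (1 + \<kappa>) ^ (n + 1) * (norm_const * norm u)"
    using \<kappa> by (intro mult_left_mono coeff_norm_even_coeff_le) auto
  finally show ?thesis by (simp add: wave_const_def mult_ac)
qed

lemma wave_le: "\<bar>wave u x\<bar> \<le> wave_const * norm u"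
proof -
  have "\<bar>wave u x\<bar> \<le> 1 * ((1 + \<kappa>) ^ (n + 1) * coeff_norm (even_coeff (n + 3) u))"
    unfolding wave_def using cos_series_deriv_le[OF even_coeff_admissible, of 0 u x] by (simp add: cos_series_deriv_0)
  also have "\<dots> \<le> (real n + 3) * ((1 + \<kappa>) ^ (n + 1) * (norm_const * norm u))"
    using \<kappa> coeff_norm_nonneg[OF even_coeff_admissible[of u]]
    by (intro mult_mono mult_left_mono coeff_norm_even_coeff_le) auto
  finally show ?thesis by (simp add: wave_const_def mult_ac)
qed

definition symbol :: "int \<Rightarrow> real" where
  "symbol j = dn_symbol (nat \<bar>j\<bar>)"

lemma symbol_minus: "symbol (- j) = symbol j" by (simp add: symbol_def)

lemma weight_nat_abs: "weight j = 1 + real (nat \<bar>j\<bar>)" by (simp add: weight_def)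

lemma symbol_le: "\<bar>symbol j\<bar> \<le> profile_bound * (1 + \<kappa>) * weight j"
  using dn_symbol_le[of "nat \<bar>j\<bar>"] by (simp add: symbol_def weight_nat_abs)

text \<open>The division by the weight lowers the exponent from \<open>n + 3\<close> to
  \<open>n + 2\<close>: for \<open>elev_mult\<close> this leaves the function unchanged, for the two
  first-order operators it pays for the derivative.\<close>

definition elev_mult :: "int \<Rightarrow> real" where "elev_mult j = 1 / weight j"
definition dn_mult :: "int \<Rightarrow> real" where "dn_mult j = symbol j / weight j"
definition slope_mult :: "int \<Rightarrow> real" where "slope_mult j = \<kappa> * real_of_int j / weight j"
definition cut_mult :: "int \<Rightarrow> real" where "cut_mult j = (if \<bar>j\<bar> \<ge> 2 then 1 else 0)"

lemma elev_mult_le: "\<bar>elev_mult j\<bar> \<le> 1"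
  using weight_ge_1[of j] by (simp add: elev_mult_def)

lemma dn_mult_le: "\<bar>dn_mult j\<bar> \<le> profile_bound * (1 + \<kappa>)"
  using symbol_le[of j] weight_pos[of j] by (simp add: dn_mult_def divide_le_eq)

lemma slope_mult_le: "\<bar>slope_mult j\<bar> \<le> \<kappa>"
proof -
  have "\<kappa> * \<bar>real_of_int j\<bar> \<le> \<kappa> * weight j" using \<kappa> by (intro mult_left_mono) (auto simp: weight_def)
  then show ?thesis using weight_pos[of j] \<kappa> by (simp add: slope_mult_def divide_le_eq abs_mult)
qed

lemma cut_mult_le: "\<bar>cut_mult j\<bar> \<le> 1" by (simp add: cut_mult_def)

lemmas seq_mult_simps =
  seq_mult_apply[OF elev_mult_le] seq_mult_apply[OF dn_mult_le]
  seq_mult_apply[OF slope_mult_le] seq_mult_apply[OF cut_mult_le]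

lemma slope_odd: "even_seq u \<Longrightarrow> seq_mult slope_mult u (- j) = - seq_mult slope_mult u j"
  by (simp add: seq_mult_simps slope_mult_def even_seq_def)

lemma wave_eq_synth:
  assumes "even_seq u" shows "wave u x = Re (synth (n + 3) u (\<kappa> * x + \<theta>))"
  unfolding wave_def cos_series_def
  using synth_even(1)[of "n + 3" u] assms by (simp add: even_seq_def sums_unique[symmetric])

lemma synth_elev: "synth (n + 2) (seq_mult elev_mult u) t = synth (n + 3) u t"
  unfolding synth_def seq_mult_simps elev_mult_def
  by (intro infsum_cong) (simp add: power_Suc numeral_3_eq_3 numeral_2_eq_2)

lemma DN_wave:
  assumes u: "even_seq u"
  shows "DN n a h (wave u) x = Re (synth (n + 2) (seq_mult dn_mult u) (\<kappa> * x + \<theta>))"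
proof -
  have "even_seq (seq_mult dn_mult u)"
    by (rule even_seq_mult[OF dn_mult_le _ u]) (simp add: dn_mult_def symbol_minus)
  then have "(\<lambda>k. even_coeff (n + 2) (seq_mult dn_mult u) k * cos (real k * (\<kappa> * x + \<theta>)))
      sums Re (synth (n + 2) (seq_mult dn_mult u) (\<kappa> * x + \<theta>))"
    by (intro synth_even(1)) (simp_all add: even_seq_def)
  moreover have "even_coeff (n + 2) (seq_mult dn_mult u) k = even_coeff (n + 3) u k * dn_symbol k" for k
    by (simp add: even_coeff_def seq_mult_simps dn_mult_def symbol_def weight_of_nat numeral_3_eq_3 numeral_2_eq_2)
  ultimately show ?thesis
    unfolding wave_def DN_cos_series[OF even_coeff_admissible] by (simp add: sums_unique[symmetric])
qed

text \<open>To keep sequences real, \<open>slope_mult\<close> omits the imaginary unit of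
  differentiation. The synthesis of the odd slope sequence is purely imaginary, and the missing unit
  turns it into minus its imaginary part.\<close>

lemma deriv_wave:
  assumes u: "even_seq u"
  shows "deriv (wave u) x = - Im (synth (n + 2) (seq_mult slope_mult u) (\<kappa> * x + \<theta>))"
proof -
  have "(\<lambda>k. even_coeff (n + 2) (seq_mult slope_mult u) k * sin (real k * (\<kappa> * x + \<theta>)))
      sums Im (synth (n + 2) (seq_mult slope_mult u) (\<kappa> * x + \<theta>))"
    by (intro synth_odd(1) slope_odd[OF u]) simp
  then have "(\<lambda>k. - (even_coeff (n + 2) (seq_mult slope_mult u) k * sin (real k * (\<kappa> * x + \<theta>))))
      sums - Im (synth (n + 2) (seq_mult slope_mult u) (\<kappa> * x + \<theta>))" by (rule sums_minus)
  moreover have "- (even_coeff (n + 2) (seq_mult slope_mult u) k * sin (real k * (\<kappa> * x + \<theta>)))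
      = even_coeff (n + 3) u k * cos_term 1 k x" for k
    by (simp add: even_coeff_def seq_mult_simps slope_mult_def weight_of_nat numeral_3_eq_3 numeral_2_eq_2
        cos_term_def cos_add)
  moreover have "deriv (wave u) x = (\<Sum>k. even_coeff (n + 3) u k * cos_term 1 k x)"
    using deriv_cos_series[OF even_coeff_admissible, of 1 u] n
    by (simp add: wave_def cos_series_deriv_def fun_eq_iff)
  ultimately show ?thesis by (simp add: sums_unique[symmetric])
qed

text \<open>The cosine has coefficient \<open>1 / 2\<close> at both modes of modulus 1, and their
  weight 2 is raised to the power \<open>n + 3\<close>.\<close>

definition base :: seq where
  "base = Bcontfun (\<lambda>j. if \<bar>j\<bar> = 1 then 2 ^ (n + 2) else 0)"

lemma base_apply: "base j = (if \<bar>j\<bar> = 1 then 2 ^ (n + 2) else 0)"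
  unfolding base_def
  by (subst Bcontfun_inverse) (auto intro!: bcontfun_normI[of _ "2 ^ (n + 2)"])

definition unit_seq :: seq where
  "unit_seq = Bcontfun (\<lambda>j. if j = 0 then 1 else 0)"

lemma unit_seq_apply: "unit_seq j = (if j = 0 then 1 else 0)"
  unfolding unit_seq_def by (subst Bcontfun_inverse) (auto intro!: bcontfun_normI[of _ 1])

lemma even_base: "even_seq base" and even_unit: "even_seq unit_seq"
  by (simp_all add: even_seq_def base_apply unit_seq_apply)

lemma synth_unit: "synth r unit_seq t = 1"
proof -
  have "synth r unit_seq t = (\<Sum>\<^sub>\<infinity>j\<in>{0}. complex_of_real (unit_seq j / weight j ^ r) * cis (real_of_int j * t))"
    unfolding synth_def by (rule infsum_cong_neutral) (auto simp: unit_seq_apply)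
  also have "\<dots> = 1" by (simp add: unit_seq_apply weight_def)
  finally show ?thesis .
qed

lemma wave_base: "wave base x = cos (\<kappa> * x + \<theta>)"
proof -
  have "even_coeff (n + 3) base k = (if k = 1 then 1 else 0)" for k
    by (auto simp: even_coeff_def base_apply numeral_3_eq_3 numeral_2_eq_2)
  then have "wave base x = (\<Sum>k. if k = 1 then cos (real k * (\<kappa> * x + \<theta>)) else 0)"
    unfolding wave_def cos_series_def by (intro suminf_cong) simp
  also have "\<dots> = cos (\<kappa> * x + \<theta>)" by (subst suminf_finite[of "{1}"]) auto
  finally show ?thesis .
qed

end

text \<open>Writing \<open>w = s W\<close> and \<open>\<mu> = s \<nu>\<close> with \<open>W = cos (\<kappa> x + \<theta>) + v\<close> and \<open>\<lambda> = lam0 + \<ell>\<close>, the equation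
  divided by \<open>s\<close> reads \<open>\<nu> + 2 (\<lambda>\<^sup>2 G W + \<lambda> \<gamma> W - g W) + s R = 0\<close>. The unknowns \<open>\<nu>\<close>, \<open>\<ell>\<close>, \<open>v\<close> are the
  entries \<open>0\<close>, \<open>\<plusminus>1\<close>, and of modulus at least \<open>2\<close> of a single even sequence \<open>z\<close>; the equations for the
  corresponding modes are solved for them, by the dispersion relation.\<close>

locale stokes_frame = wave_frame +
  fixes g \<gamma> lam0 :: real
  assumes lam0: "lam0 \<noteq> 0"
    and dispersion: "lam0\<^sup>2 * dn_symbol 1 + lam0 * \<gamma> = g"
    and transversal: "2 * lam0 * dn_symbol 1 + \<gamma> \<noteq> 0"
begin

text \<open>The linearization at mode \<open>j\<close>, namely
  \<open>lam0\<^sup>2 * symbol j + lam0 * \<gamma> - g\<close>, after eliminating \<open>g\<close>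
  by the dispersion relation.\<close>

definition gap :: "int \<Rightarrow> real" where
  "gap j = lam0\<^sup>2 * (symbol j - dn_symbol 1)"

text \<open>With \<open>l\<close> the entry at 1, the solved equation of mode \<open>j\<close> has
  the coefficients \<open>lin_mult j\<close> for \<open>l * z j\<close>, \<open>sq_mult j\<close>
  for \<open>l * l * z j\<close>, and \<open>rem_mult j\<close> for \<open>s\<close> times the
  remainder. At modulus 1 the entry \<open>z j\<close> is \<open>l\<close> itself, so
  \<open>lin_mult\<close> already covers the square of \<open>l\<close>.\<close>

definition lin_mult :: "int \<Rightarrow> real" where
  "lin_mult j = (if j = 0 then 0 else if \<bar>j\<bar> = 1 then - dn_symbol 1 / (2 * lam0 * dn_symbol 1 + \<gamma>)
     else - (2 * lam0 * symbol j + \<gamma>) / gap j)"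

definition sq_mult :: "int \<Rightarrow> real" where
  "sq_mult j = (if \<bar>j\<bar> \<le> 1 then 0 else - symbol j / gap j)"

definition rem_mult :: "int \<Rightarrow> real" where
  "rem_mult j = (if j = 0 then - 1 else if \<bar>j\<bar> = 1 then - 1 / (2 ^ (n + 2) * (2 * lam0 * dn_symbol 1 + \<gamma>))
     else - weight j / (2 * gap j))"

lemma gap_ge:
  obtains c where "c > 0" and "\<And>j. \<bar>j\<bar> \<ge> 2 \<Longrightarrow> gap j \<ge> c * weight j"
proof -
  obtain c where c: "c > 0" "\<And>k. k \<ge> 2 \<Longrightarrow> dn_symbol k - dn_symbol 1 \<ge> c * (1 + real k)"
    using dn_symbol_gap by blast
  have "gap j \<ge> lam0\<^sup>2 * c * weight j" if "\<bar>j\<bar> \<ge> 2" for j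
    unfolding gap_def symbol_def weight_nat_abs mult.assoc
    using c(2)[of "nat \<bar>j\<bar>"] that by (intro mult_left_mono) auto
  moreover have "lam0\<^sup>2 * c > 0" using c(1) lam0 by simp
  ultimately show ?thesis using that by blast
qed

lemma gap_pos: "\<bar>j\<bar> \<ge> 2 \<Longrightarrow> gap j > 0"
  using gap_ge weight_pos by (metis less_le_trans mult_pos_pos)

text \<open>Symbol and weight grow at most like the first power of the mode and \<open>gap\<close>
  at least like it, so the quotients stay bounded: this recovers the lost derivative.\<close>

lemma mult_bounds:
  obtains C where "\<And>j. \<bar>lin_mult j\<bar> \<le> C" "\<And>j. \<bar>sq_mult j\<bar> \<le> C" "\<And>j. \<bar>rem_mult j\<bar> \<le> C"
proof -
  obtain c where c: "c > 0" "\<And>j. \<bar>j\<bar> \<ge> 2 \<Longrightarrow> gap j \<ge> c * weight j" using gap_ge by blast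
  define A where "A = profile_bound * (1 + \<kappa>)"
  have A: "A \<ge> 0" using profile_bound_ge(1) \<kappa> by (simp add: A_def)
  have div: "\<bar>x / gap j\<bar> \<le> K / c" if "\<bar>j\<bar> \<ge> 2" "\<bar>x\<bar> \<le> K * weight j" for x K j
  proof -
    have "\<bar>x\<bar> / gap j \<le> (K * weight j) / (c * weight j)"
      using that c weight_pos[of j] by (intro frac_le) auto
    also have "\<dots> = K / c" using weight_nz[of j] by simp
    finally show ?thesis using gap_pos[OF that(1)] by simp
  qed
  have S: "\<bar>symbol j\<bar> \<le> A * weight j" for j unfolding A_def by (rule symbol_le)
  define C where "C = max (\<bar>dn_symbol 1 / (2 * lam0 * dn_symbol 1 + \<gamma>)\<bar>)
    (max ((2 * \<bar>lam0\<bar> * A + \<bar>\<gamma>\<bar>) / c) (max (A / c) (max 1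
    (max \<bar>1 / (2 ^ (n + 2) * (2 * lam0 * dn_symbol 1 + \<gamma>))\<bar> (1 / c)))))"
  have Cge: "\<bar>dn_symbol 1 / (2 * lam0 * dn_symbol 1 + \<gamma>)\<bar> \<le> C" "(2 * \<bar>lam0\<bar> * A + \<bar>\<gamma>\<bar>) / c \<le> C" "A / c \<le> C"
    "1 \<le> C" "\<bar>1 / (2 ^ (n + 2) * (2 * lam0 * dn_symbol 1 + \<gamma>))\<bar> \<le> C" "1 / c \<le> C"
    unfolding C_def le_max_iff_disj by simp_all
  have "\<bar>lin_mult j\<bar> \<le> C" for j
  proof (cases "\<bar>j\<bar> \<ge> 2")
    case True
    have "\<bar>2 * lam0 * symbol j + \<gamma>\<bar> \<le> 2 * \<bar>lam0\<bar> * \<bar>symbol j\<bar> + \<bar>\<gamma>\<bar>"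
      by (rule order_trans[OF abs_triangle_ineq]) (simp add: abs_mult)
    also have "\<dots> \<le> 2 * \<bar>lam0\<bar> * (A * weight j) + \<bar>\<gamma>\<bar> * weight j"
      using S[of j] mult_left_mono[OF weight_ge_1[of j], of "\<bar>\<gamma>\<bar>"] by (intro add_mono mult_left_mono) auto
    finally have "\<bar>- (2 * lam0 * symbol j + \<gamma>)\<bar> \<le> (2 * \<bar>lam0\<bar> * A + \<bar>\<gamma>\<bar>) * weight j"
      by (simp add: algebra_simps)
    from div[OF True this] Cge(2) True show ?thesis by (simp add: lin_mult_def)
  next
    case False
    then consider "j = 0" | "\<bar>j\<bar> = 1" by linarith
    then show ?thesis using Cge by cases (auto simp: lin_mult_def)
  qed
  moreover have "\<bar>sq_mult j\<bar> \<le> C" for j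
  proof (cases "\<bar>j\<bar> \<ge> 2")
    case True
    with div[OF True, of "- symbol j" A] S[of j] Cge(3) show ?thesis by (simp add: sq_mult_def)
  next
    case False
    then show ?thesis using Cge(4) by (simp add: sq_mult_def)
  qed
  moreover have "\<bar>rem_mult j\<bar> \<le> C" for j
  proof (cases "\<bar>j\<bar> \<ge> 2")
    case True
    have "\<bar>- weight j / 2\<bar> \<le> 1 * weight j" using weight_pos[of j] by simp
    from div[OF True this] Cge(4,6) True show ?thesis by (simp add: rem_mult_def)
  next
    case False
    then consider "j = 0" | "\<bar>j\<bar> = 1" by linarith
    then show ?thesis using Cge by cases (auto simp: rem_mult_def)
  qed
  ultimately show ?thesis using that by blast
qed

section \<open>The nonlinear terms and the fixed point map\<close>

definition elevation :: "seq \<Rightarrow> seq" where "elevation z = base + seq_mult cut_mult z"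
definition eta :: "seq \<Rightarrow> seq" where "eta z = seq_mult elev_mult (elevation z)"
definition dn_eta :: "seq \<Rightarrow> seq" where "dn_eta z = seq_mult dn_mult (elevation z)"
definition slope :: "seq \<Rightarrow> seq" where "slope z = seq_mult slope_mult (elevation z)"
text \<open>The square of a purely imaginary synthesis is negative, so the minus sign adds the
  squared slope.\<close>

definition grad_sq :: "seq \<Rightarrow> seq" where
  "grad_sq z = conv (n + 2) (dn_eta z) (dn_eta z) - conv (n + 2) (slope z) (slope z)"
text \<open>The square is formed at exponent \<open>n + 3\<close> because the operator applied to it
  costs one power; the other product is already at \<open>n + 2\<close>.\<close>

definition quad :: "seq \<Rightarrow> seq" where
  "quad z = (1 / 2) *\<^sub>R seq_mult dn_mult (conv (n + 3) (elevation z) (elevation z)) - conv (n + 2) (eta z) (dn_eta z)"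
text \<open>Right side minus left side of the wave equation, divided by \<open>s\<close>, has a part
  free of \<open>s\<close>; this is the rest, divided by \<open>s\<close> once more.\<close>

definition rmd :: "real \<Rightarrow> seq \<Rightarrow> seq" where
  "rmd s z = ((lam0 + z 1) * (lam0 + z 1)) *\<^sub>R grad_sq z
     + conv (n + 2) (z 0 *\<^sub>R unit_seq - (2 * g) *\<^sub>R eta z) (2 *\<^sub>R dn_eta z + s *\<^sub>R grad_sq z)
     - (2 * (lam0 + z 1) * \<gamma>) *\<^sub>R quad z
     - (\<gamma> * \<gamma>) *\<^sub>R conv (n + 2) (s *\<^sub>R quad z - eta z) (s *\<^sub>R quad z - eta z)"
definition lead :: "seq \<Rightarrow> seq" where
  "lead z = z 1 *\<^sub>R seq_mult lin_mult z + (z 1 * z 1) *\<^sub>R seq_mult sq_mult z"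

lemma even_parts:
  assumes z: "even_seq z"
  shows even_elevation: "even_seq (elevation z)" and even_eta: "even_seq (eta z)"
    and even_dn_eta: "even_seq (dn_eta z)" and odd_slope: "slope z (- j) = - slope z j"
    and even_grad_sq: "even_seq (grad_sq z)" and even_quad: "even_seq (quad z)"
    and even_rmd: "even_seq (rmd s z)"
proof -
  show 1: "even_seq (elevation z)" unfolding elevation_def
    by (intro even_seq_add even_base even_seq_mult[OF cut_mult_le _ z]) (simp add: cut_mult_def)
  show 2: "even_seq (eta z)" unfolding eta_def
    by (rule even_seq_mult[OF elev_mult_le _ 1]) (simp add: elev_mult_def)
  show 3: "even_seq (dn_eta z)" unfolding dn_eta_def
    by (rule even_seq_mult[OF dn_mult_le _ 1]) (simp add: dn_mult_def symbol_minus)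
  have 4: "slope z (- j) = - slope z j" for j unfolding slope_def by (rule slope_odd[OF 1])
  then show "slope z (- j) = - slope z j" .
  show 5: "even_seq (grad_sq z)" unfolding grad_sq_def
    by (intro even_seq_diff even_seq_conv even_seq_conv_odd 3 4) auto
  show 6: "even_seq (quad z)" unfolding quad_def
    by (intro even_seq_diff even_seq_scaleR even_seq_mult[OF dn_mult_le] even_seq_conv 1 2 3)
      (auto simp: dn_mult_def symbol_minus)
  show "even_seq (rmd s z)" unfolding rmd_def
    by (intro even_seq_add even_seq_diff even_seq_scaleR even_seq_conv even_unit 2 3 5 6) auto
qed

lemma even_step:
  assumes z: "even_seq z" shows "even_seq (lead z + s *\<^sub>R seq_mult rem_mult (rmd s z))"
proof -
  obtain C where C: "\<And>j. \<bar>lin_mult j\<bar> \<le> C" "\<And>j. \<bar>sq_mult j\<bar> \<le> C" "\<And>j. \<bar>rem_mult j\<bar> \<le> C"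
    using mult_bounds by blast
  have "lin_mult (- j) = lin_mult j" "sq_mult (- j) = sq_mult j" "rem_mult (- j) = rem_mult j" for j
    by (auto simp: lin_mult_def sq_mult_def rem_mult_def gap_def symbol_minus)
  then show ?thesis unfolding lead_def
    by (intro even_seq_add even_seq_scaleR even_seq_mult[OF C(1)] even_seq_mult[OF C(2)]
        even_seq_mult[OF C(3)] z even_rmd[OF z])
qed

text \<open>A polynomial in \<open>s\<close> and \<open>z\<close> built from bounded linear and
  bilinear maps is Lipschitz on bounded sets.\<close>

lemma rmd_lipschitz: "lip_on ({-1..1} \<times> cball 0 1) (\<lambda>(s, z). seq_mult rem_mult (rmd s z))"
proof -
  obtain C where "\<And>j. \<bar>lin_mult j\<bar> \<le> C" "\<And>j. \<bar>sq_mult j\<bar> \<le> C" and C: "\<And>j. \<bar>rem_mult j\<bar> \<le> C"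
    using mult_bounds by blast
  let ?S = "{-1..1} \<times> cball 0 1 :: (real \<times> seq) set"
  have S: "bounded ?S" by (intro bounded_Times bounded_closed_interval bounded_cball)
  have id: "lip_on ?S (\<lambda>x. x)" unfolding lip_on_def using lipschitz_on_id by blast
  note z = lip_on_linear[OF bounded_linear_snd id]
  note s = lip_on_linear[OF bounded_linear_fst id]
  note ev = lip_on_linear[OF bounded_linear_seq_eval z]
  note mul = lip_on_bilinear[OF bounded_bilinear_mult S] and sc = lip_on_bilinear[OF bounded_bilinear_scaleR S]
  have cq: "lip_on ?S (\<lambda>x. conv (n + 2) (f x) (f' x))" if "lip_on ?S f" "lip_on ?S f'" for f f'
    by (rule lip_on_bilinear[OF bounded_bilinear_conv S that]) simp
  have cp: "lip_on ?S (\<lambda>x. conv (n + 3) (f x) (f' x))" if "lip_on ?S f" "lip_on ?S f'" for f f'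
    by (rule lip_on_bilinear[OF bounded_bilinear_conv S that]) simp
  have el: "lip_on ?S (\<lambda>x. elevation (snd x))" unfolding elevation_def
    by (intro lip_on_add lip_on_const lip_on_linear[OF bounded_linear_seq_mult[OF cut_mult_le] z])
  have eta: "lip_on ?S (\<lambda>x. eta (snd x))" unfolding eta_def
    by (rule lip_on_linear[OF bounded_linear_seq_mult[OF elev_mult_le] el])
  have dn: "lip_on ?S (\<lambda>x. dn_eta (snd x))" unfolding dn_eta_def
    by (rule lip_on_linear[OF bounded_linear_seq_mult[OF dn_mult_le] el])
  have sl: "lip_on ?S (\<lambda>x. slope (snd x))" unfolding slope_def
    by (rule lip_on_linear[OF bounded_linear_seq_mult[OF slope_mult_le] el])
  have gr: "lip_on ?S (\<lambda>x. grad_sq (snd x))" unfolding grad_sq_def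
    by (intro lip_on_diff cq dn sl)
  have qu: "lip_on ?S (\<lambda>x. quad (snd x))" unfolding quad_def
    by (intro lip_on_diff sc lip_on_const lip_on_linear[OF bounded_linear_seq_mult[OF dn_mult_le]] cp cq el eta dn)
  have "lip_on ?S (\<lambda>x. rmd (fst x) (snd x))" unfolding rmd_def
    by (intro lip_on_diff lip_on_add sc mul cq lip_on_const ev gr qu eta dn s)
  from lip_on_linear[OF bounded_linear_seq_mult[OF C] this] show ?thesis
    by (simp add: case_prod_unfold)
qed

text \<open>Every term contains \<open>z 1\<close> besides \<open>z\<close>, hence is at least
  quadratic; \<open>r \<le> 1\<close> bounds the cubic part like a quadratic one.\<close>

lemma lead_estimate:
  obtains C where "\<And>r z z'. r \<le> 1 \<Longrightarrow> norm z \<le> r \<Longrightarrow> norm z' \<le> r \<Longrightarrow>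
    norm (lead z - lead z') \<le> C * r * norm (z - z')"
proof -
  obtain C where C: "\<And>j. \<bar>lin_mult j\<bar> \<le> C" "\<And>j. \<bar>sq_mult j\<bar> \<le> C" "\<And>j. \<bar>rem_mult j\<bar> \<le> C"
    using mult_bounds by blast
  define M1 where "M1 = seq_mult lin_mult"
  define M2 where "M2 = seq_mult sq_mult"
  interpret M1: bounded_linear M1 unfolding M1_def by (rule bounded_linear_seq_mult[OF C(1)])
  interpret M2: bounded_linear M2 unfolding M2_def by (rule bounded_linear_seq_mult[OF C(2)])
  obtain A where A: "A \<ge> 0" "\<And>u. norm (M1 u) \<le> norm u * A" using M1.nonneg_bounded by blast
  obtain B where B: "B \<ge> 0" "\<And>u. norm (M2 u) \<le> norm u * B" using M2.nonneg_bounded by blast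
  have "norm (lead z - lead z') \<le> (2 * A + 3 * B) * r * norm (z - z')"
    if r: "r \<le> 1" and z: "norm z \<le> r" and z': "norm z' \<le> r" for r z z'
  proof -
    let ?d = "norm (z - z')"
    have r0: "r \<ge> 0" using z norm_ge_zero order_trans by blast
    have e: "\<bar>z 1\<bar> \<le> r" "\<bar>z' 1\<bar> \<le> r" "\<bar>z 1 - z' 1\<bar> \<le> ?d"
      using seq_le_norm[of z 1] seq_le_norm[of z' 1] seq_le_norm[of "z - z'" 1] z z' by auto
    have q: "\<bar>z 1 * z 1 - z' 1 * z' 1\<bar> \<le> 2 * ?d"
    proof -
      have "\<bar>z 1 * z 1 - z' 1 * z' 1\<bar> = \<bar>z 1 - z' 1\<bar> * \<bar>z 1 + z' 1\<bar>"
        unfolding abs_mult[symmetric] by (simp add: algebra_simps)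
      also have "\<dots> \<le> ?d * 2" using e r by (intro mult_mono) auto
      finally show ?thesis by simp
    qed
    have q': "\<bar>z' 1 * z' 1\<bar> \<le> r"
    proof -
      have "\<bar>z' 1\<bar> * \<bar>z' 1\<bar> \<le> r * 1" using e r r0 by (intro mult_mono) auto
      then show ?thesis by (simp add: abs_mult)
    qed
    have eq: "lead z - lead z' = ((z 1 - z' 1) *\<^sub>R M1 z + z' 1 *\<^sub>R M1 (z - z'))
        + ((z 1 * z 1 - z' 1 * z' 1) *\<^sub>R M2 z + (z' 1 * z' 1) *\<^sub>R M2 (z - z'))"
      by (simp add: lead_def M1_def[symmetric] M2_def[symmetric] M1.diff M2.diff algebra_simps)
    have n1: "norm ((z 1 - z' 1) *\<^sub>R M1 z) \<le> ?d * (r * A)"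
      unfolding norm_scaleR real_norm_def
      using e A z by (intro mult_mono order_trans[OF A(2)] mult_right_mono) auto
    have n2: "norm (z' 1 *\<^sub>R M1 (z - z')) \<le> r * (?d * A)"
      unfolding norm_scaleR real_norm_def using e A r0 by (intro mult_mono) auto
    have n3: "norm ((z 1 * z 1 - z' 1 * z' 1) *\<^sub>R M2 z) \<le> 2 * ?d * (r * B)"
      unfolding norm_scaleR real_norm_def
      using q B z by (intro mult_mono order_trans[OF B(2)] mult_right_mono) auto
    have n4: "norm ((z' 1 * z' 1) *\<^sub>R M2 (z - z')) \<le> r * (?d * B)"
      unfolding norm_scaleR real_norm_def using q' B r0 by (intro mult_mono) auto
    have "norm (lead z - lead z') \<le> (?d * (r * A) + r * (?d * A)) + (2 * ?d * (r * B) + r * (?d * B))"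
      unfolding eq
      by (intro order_trans[OF norm_triangle_ineq] add_mono order_trans[OF norm_triangle_ineq add_mono[OF n1 n2]]
          order_trans[OF norm_triangle_ineq add_mono[OF n3 n4]])
    then show ?thesis by (simp add: algebra_simps)
  qed
  then show ?thesis using that by blast
qed

lemma fixed_point_equation:
  assumes z: "even_seq z" and fp: "lead z + s *\<^sub>R seq_mult rem_mult (rmd s z) = z"
  shows "z 0 *\<^sub>R unit_seq + (2 * (lam0 + z 1)\<^sup>2) *\<^sub>R dn_eta z + (2 * (lam0 + z 1) * \<gamma> - 2 * g) *\<^sub>R eta z
    + s *\<^sub>R rmd s z = 0"
proof (rule bcontfun_eqI)
  fix j
  obtain C where C: "\<And>j. \<bar>lin_mult j\<bar> \<le> C" "\<And>j. \<bar>sq_mult j\<bar> \<le> C" "\<And>j. \<bar>rem_mult j\<bar> \<le> C"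
    using mult_bounds by blast
  define l where "l = z 1"
  define \<rho> where "\<rho> = rmd s z j"
  define G where "G = symbol j"
  have el: "elevation z j = base j + cut_mult j * z j" by (simp add: elevation_def seq_mult_simps)
  have fpj: "l * (lin_mult j * z j) + l * l * (sq_mult j * z j) + s * (rem_mult j * \<rho>) = z j"
    using arg_cong[OF fp, of "\<lambda>u. u j"]
    by (simp add: lead_def seq_mult_apply[OF C(1)] seq_mult_apply[OF C(2)] seq_mult_apply[OF C(3)] l_def \<rho>_def)
  have "z 0 * unit_seq j + (2 * (lam0 + l)\<^sup>2) * (G / weight j * elevation z j)
     + (2 * (lam0 + l) * \<gamma> - 2 * g) * (elevation z j / weight j) + s * \<rho> = 0"
  proof -
    consider "j = 0" | "\<bar>j\<bar> = 1" | "\<bar>j\<bar> \<ge> 2" by linarith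
    then show ?thesis
    proof cases
      case 1
      \<comment> \<open>Both \<open>base\<close> and \<open>cut_mult\<close> vanish at 0: the
        profile has zero mean, and the equation of this mode determines \<open>z 0\<close>.\<close>
      then have "elevation z j = 0" unfolding el by (simp add: base_apply cut_mult_def)
      moreover have "- (s * \<rho>) = z 0" using fpj 1 by (simp add: lin_mult_def sq_mult_def rem_mult_def)
      ultimately show ?thesis using 1 by (simp add: unit_seq_apply)
    next
      case 2
      \<comment> \<open>Evenness identifies the entries at both modes of modulus 1 with the
        correction of the parameter.\<close>
      have zj: "z j = l" using 2 even_seqD[OF z, of 1] by (auto simp: l_def abs_if split: if_splits)
      have w: "weight j = 2" using 2 by (auto simp: weight_def)
      have G: "G = dn_symbol 1" using 2 by (simp add: G_def symbol_def)
      define \<tau> where "\<tau> = 2 * lam0 * dn_symbol 1 + \<gamma>"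
      have \<tau>: "\<tau> \<noteq> 0" using transversal by (simp add: \<tau>_def)
      have elj: "elevation z j = 2 ^ (n + 2)" using 2 by (simp add: el base_apply cut_mult_def)
      have "j \<noteq> 0" using 2 by auto
      then have ml: "lin_mult j = - G / \<tau>" "sq_mult j = 0" "rem_mult j = - 1 / (2 ^ (n + 2) * \<tau>)"
        using 2 by (simp_all add: lin_mult_def sq_mult_def rem_mult_def G \<tau>_def)
      have "l * (- G / \<tau> * l) + s * (- 1 / (2 ^ (n + 2) * \<tau>) * \<rho>) = l"
        using fpj unfolding ml zj by (simp only: mult_zero_left mult_zero_right add_0_right)
      then have "2 ^ (n + 2) * \<tau> * (l * (- G / \<tau> * l) + s * (- 1 / (2 ^ (n + 2) * \<tau>) * \<rho>)) = 2 ^ (n + 2) * \<tau> * l"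
        by simp
      moreover have "2 ^ (n + 2) * \<tau> * (l * (- G / \<tau> * l) + s * (- 1 / (2 ^ (n + 2) * \<tau>) * \<rho>))
        = - (2 ^ (n + 2) * l * G * l) - s * \<rho>"
        using \<tau> by (simp add: field_simps)
      ultimately have 3: "2 ^ (n + 2) * (\<tau> * l + l * G * l) + s * \<rho> = 0" by (simp add: algebra_simps)
      \<comment> \<open>By the dispersion relation the terms free of \<open>l\<close> cancel, and
        the transversality constant is the coefficient of \<open>l\<close>.\<close>
      have "(2 * (lam0 + l)\<^sup>2) * (G / weight j * elevation z j) + (2 * (lam0 + l) * \<gamma> - 2 * g) * (elevation z j / weight j)
        = 2 ^ (n + 2) * (\<tau> * l + l * G * l)"
        unfolding elj w G \<tau>_def dispersion[symmetric] by (simp add: power2_eq_square algebra_simps)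
      then show ?thesis using 2 3 by (auto simp: unit_seq_apply)
    next
      case 3
      have m: "gap j > 0" by (rule gap_pos[OF 3])
      have w: "weight j > 0" by (rule weight_pos)
      have elj: "elevation z j = z j" using 3 by (auto simp: el base_apply cut_mult_def)
      have "l * (- (2 * lam0 * G + \<gamma>) / gap j * z j) + l * l * (- G / gap j * z j) + s * (- weight j / (2 * gap j) * \<rho>) = z j"
      proof -
        have "lin_mult j = - (2 * lam0 * G + \<gamma>) / gap j" "sq_mult j = - G / gap j" "rem_mult j = - weight j / (2 * gap j)"
          using 3 by (auto simp: lin_mult_def sq_mult_def rem_mult_def G_def)
        then show ?thesis using fpj by (simp only:)
      qed
      then have "2 * gap j * (l * (- (2 * lam0 * G + \<gamma>) / gap j * z j) + l * l * (- G / gap j * z j)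
        + s * (- weight j / (2 * gap j) * \<rho>)) = 2 * gap j * z j" by simp
      moreover have "2 * gap j * (l * (- (2 * lam0 * G + \<gamma>) / gap j * z j) + l * l * (- G / gap j * z j)
        + s * (- weight j / (2 * gap j) * \<rho>)) = - 2 * l * (2 * lam0 * G + \<gamma>) * z j - 2 * l * l * G * z j - s * weight j * \<rho>"
        using m by (simp add: field_simps)
      ultimately have 4: "2 * gap j * z j + 2 * l * (2 * lam0 * G + \<gamma>) * z j + 2 * l * l * G * z j + s * weight j * \<rho> = 0"
        by (simp add: algebra_simps)
      have "weight j * ((2 * (lam0 + l)\<^sup>2) * (G / weight j * elevation z j)
        + (2 * (lam0 + l) * \<gamma> - 2 * g) * (elevation z j / weight j) + s * \<rho>)
        = (2 * (lam0 + l)\<^sup>2 * G + (2 * (lam0 + l) * \<gamma> - 2 * g)) * z j + s * weight j * \<rho>"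
        unfolding elj using w by (simp add: field_simps)
      \<comment> \<open>The dispersion relation turns
        \<open>lam0\<^sup>2 * G + lam0 * \<gamma> - g\<close> into \<open>gap j\<close>.\<close>
      also have "\<dots> = 2 * gap j * z j + 2 * l * (2 * lam0 * G + \<gamma>) * z j + 2 * l * l * G * z j + s * weight j * \<rho>"
        unfolding gap_def G_def[symmetric] dispersion[symmetric] by (simp add: power2_eq_square algebra_simps)
      finally have "weight j * ((2 * (lam0 + l)\<^sup>2) * (G / weight j * elevation z j)
        + (2 * (lam0 + l) * \<gamma> - 2 * g) * (elevation z j / weight j) + s * \<rho>) = 0" using 4 by simp
      then show ?thesis using w 3 by (auto simp: unit_seq_apply)
    qed
  qed
  then show "(z 0 *\<^sub>R unit_seq + (2 * (lam0 + z 1)\<^sup>2) *\<^sub>R dn_eta z + (2 * (lam0 + z 1) * \<gamma> - 2 * g) *\<^sub>R eta z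
    + s *\<^sub>R rmd s z) j = apply_bcontfun 0 j"
    by (simp add: dn_eta_def eta_def seq_mult_simps dn_mult_def elev_mult_def l_def G_def \<rho>_def)
qed

end

text \<open>All other summands are nonnegative, and membership in the Hoelder class makes the
  suprema genuine. It serves to squeeze norms to 0 and to tell waves from the trivial
  solution.\<close>

lemma holder_norm_ge:
  assumes f: "f \<in> holder n a"
  shows "\<bar>f x\<bar> \<le> holder_norm n a f"
proof -
  have bd: "bdd_above (range (\<lambda>x. \<bar>(deriv ^^ k) f x\<bar>))" if "k \<le> n" for k
  proof -
    have "bounded (range ((deriv ^^ k) f))" using f that by (simp add: holder_def)
    then obtain C where "\<forall>y\<in>range ((deriv ^^ k) f). norm y \<le> C" unfolding bounded_iff by blast
    then show ?thesis by (intro bdd_aboveI[of _ C]) auto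
  qed
  have ge: "\<bar>(deriv ^^ k) f y\<bar> \<le> (SUP x. \<bar>(deriv ^^ k) f x\<bar>)" if "k \<le> n" for k y
    by (rule cSUP_upper[OF UNIV_I bd[OF that]])
  have "\<bar>f x\<bar> \<le> (SUP x. \<bar>(deriv ^^ 0) f x\<bar>)" using ge[of 0 x] by simp
  also have "\<dots> \<le> (\<Sum>k\<le>n. SUP x. \<bar>(deriv ^^ k) f x\<bar>)"
    by (rule member_le_sum[where f = "\<lambda>k. SUP x. \<bar>(deriv ^^ k) f x\<bar>"])
      (use ge[of _ 0] in \<open>auto intro: order_trans[OF abs_ge_zero]\<close>)
  finally have 1: "\<bar>f x\<bar> \<le> (\<Sum>k\<le>n. SUP x. \<bar>(deriv ^^ k) f x\<bar>)" .
  obtain C where C: "\<And>x y. \<bar>(deriv ^^ n) f x - (deriv ^^ n) f y\<bar> \<le> C * \<bar>x - y\<bar> powr a"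
    using f by (auto simp: holder_def)
  define q where "q = (\<lambda>(x::real, y). \<bar>(deriv ^^ n) f x - (deriv ^^ n) f y\<bar> / \<bar>x - y\<bar> powr a)"
  have "q p \<le> C" if "p \<in> {(x, y). x \<noteq> y}" for p
    using C that by (auto simp: q_def divide_le_eq)
  then have "bdd_above (q ` {(x, y). x \<noteq> y})" by (intro bdd_aboveI[of _ C]) auto
  moreover have "(0 :: real, 1) \<in> {(x, y). x \<noteq> y}" by simp
  ultimately have "q (0, 1) \<le> (SUP p \<in> {(x, y). x \<noteq> y}. q p)" by (intro cSUP_upper)
  moreover have "q (0, 1) \<ge> 0" by (simp add: q_def)
  ultimately show ?thesis using 1 unfolding holder_norm_def q_def by linarith
qed

context wave_frame
begin

lemma wave_holder: "wave u \<in> holder n a"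
  unfolding wave_def by (rule cos_series_holder[OF even_coeff_admissible])

lemma wave_holder_norm_nonneg: "holder_norm n a (wave u) \<ge> 0"
  using holder_norm_ge[OF wave_holder, of u 0] by linarith

lemma wave_zero: "wave 0 = (\<lambda>_. 0)"
  by (rule ext) (simp add: wave_def cos_series_def even_coeff_def)

lemma seq_mult_dn_scaleR: "seq_mult dn_mult (c *\<^sub>R u) = c *\<^sub>R seq_mult dn_mult u"
  and seq_mult_slope_scaleR: "seq_mult slope_mult (c *\<^sub>R u) = c *\<^sub>R seq_mult slope_mult u"
  using bounded_linear_seq_mult[OF dn_mult_le] bounded_linear_seq_mult[OF slope_mult_le]
  by (simp_all add: bounded_linear.linear linear_scale)

lemma wave_sq:
  assumes u: "even_seq u"
  shows "(\<lambda>x. (wave u x)\<^sup>2 / 2) = wave ((1 / 2) *\<^sub>R conv (n + 3) u u)"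
  using assms even_seq_conv[OF _ u u, of "n + 3"]
  by (intro ext) (simp add: wave_scaleR wave_eq_synth Re_synth_conv_even power2_eq_square)

lemma wave_AP_space0:
  assumes "freq_match \<alpha> \<beta>" and "apply_bcontfun u 0 = 0"
  shows "wave u \<in> AP_space0 \<alpha> \<beta> n a"
  unfolding wave_def
  by (rule cos_series_AP_space0[OF even_coeff_admissible _ assms(1)]) (simp add: even_coeff_def assms(2))

lemma trivial_wave_solution:
  assumes "freq_match \<alpha> \<beta>"
  shows "wave_solution \<alpha> \<beta> n a g h \<gamma> lam 0 (\<lambda>_. 0)"
proof -
  have ap: "(\<lambda>_. 0) \<in> AP_space0 \<alpha> \<beta> n a" using wave_AP_space0[OF assms, of 0] by (simp add: wave_zero)
  have "seq_mult dn_mult 0 = 0" using seq_mult_dn_scaleR[of 0 0] by simp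
  then have "DN n a h (\<lambda>_. 0) x = 0" for x
    using DN_wave[OF even_seq_zero, of x] by (simp add: wave_zero synth_def)
  then show ?thesis unfolding wave_solution_def using ap h by simp
qed

end

section \<open>From fixed points to curves of water waves\<close>

context stokes_frame
begin

text \<open>The terms \<open>l\<^sup>2\<close> of order 0 cancel between the two sides, and their
  difference is \<open>s\<close> times the synthesis of the vanishing sequence in
  \<open>fixed_point_equation\<close>.\<close>

lemma wave_equation:
  assumes z: "even_seq z" and fp: "lead z + s *\<^sub>R seq_mult rem_mult (rmd s z) = z"
  defines "w \<equiv> wave (s *\<^sub>R elevation z)" and "lam \<equiv> lam0 + apply_bcontfun z 1" and "mu \<equiv> s * apply_bcontfun z 0"
  shows "(lam + \<gamma> * (DN n a h (\<lambda>t. (w t)\<^sup>2 / 2) x - w x - w x * DN n a h w x))\<^sup>2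
        = (lam\<^sup>2 + mu - 2 * g * w x) * ((deriv w x)\<^sup>2 + (DN n a h w x)\<^sup>2 + 2 * DN n a h w x + 1)"
proof -
  define t where "t = \<kappa> * x + \<theta>"
  define S where "S = (\<lambda>u. Re (synth (n + 2) u t))"
  have q2: "n + 2 \<ge> 2" and p2: "n + 3 \<ge> 2" by auto
  have S_lin: "S (u + v) = S u + S v" "S (u - v) = S u - S v" "S (c *\<^sub>R u) = c * S u" for u v c
    unfolding S_def synth_add[OF q2] synth_diff[OF q2] synth_scaleR by simp_all
  have S_conv: "S (conv (n + 2) u v) = S u * S v" if "even_seq u" "even_seq v" for u v
    unfolding S_def by (rule Re_synth_conv_even[OF q2 that])
  note ev = even_parts[OF z]
  define W where "W = Re (synth (n + 3) (elevation z) t)"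
  define Q where "Q = S (dn_eta z)"
  define I where "I = Im (synth (n + 2) (slope z) t)"
  define N where "N = S (seq_mult dn_mult (conv (n + 3) (elevation z) (elevation z)))"
  define l where "l = lam0 + z 1"
  have sW: "even_seq (s *\<^sub>R elevation z)" by (rule even_seq_scaleR[OF ev(1)])
  have eta: "S (eta z) = W" unfolding S_def W_def eta_def synth_elev ..
  have w: "w x = s * W"
    unfolding w_def wave_scaleR wave_eq_synth[OF ev(1)] W_def t_def ..
  have dn: "DN n a h w x = s * Q"
    unfolding w_def DN_wave[OF sW] seq_mult_dn_scaleR t_def[symmetric]
    using S_lin(3) by (simp add: S_def Q_def dn_eta_def)
  have dw: "deriv w x = - (s * I)"
    unfolding w_def deriv_wave[OF sW] seq_mult_slope_scaleR t_def[symmetric]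
    by (simp add: I_def slope_def synth_scaleR)
  have w2: "DN n a h (\<lambda>t. (w t)\<^sup>2 / 2) x = s\<^sup>2 * N / 2"
  proof -
    interpret cv: bounded_bilinear "conv (n + 3)" by (rule bounded_bilinear_conv[OF p2])
    have e: "even_seq ((1 / 2) *\<^sub>R conv (n + 3) (s *\<^sub>R elevation z) (s *\<^sub>R elevation z))"
      by (intro even_seq_scaleR even_seq_conv[OF p2] ev(1))
    show ?thesis unfolding w_def wave_sq[OF sW] DN_wave[OF e] t_def[symmetric]
      using S_lin(3) by (simp add: seq_mult_dn_scaleR cv.scaleR_left cv.scaleR_right S_def N_def power2_eq_square)
  qed
  have D: "S (grad_sq z) = Q * Q + I * I"
  proof -
    have "S (conv (n + 2) (slope z) (slope z)) = - (I * I)"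
      unfolding S_def I_def by (rule Re_synth_conv_odd[OF q2 ev(4) ev(4)])
    then show ?thesis unfolding grad_sq_def S_lin S_conv[OF ev(3) ev(3)] Q_def by simp
  qed
  have P: "S (quad z) = N / 2 - W * Q"
    unfolding quad_def S_lin S_conv[OF ev(2) ev(3)] eta N_def Q_def by simp
  have e1: "even_seq (z 0 *\<^sub>R unit_seq - (2 * g) *\<^sub>R eta z)" "even_seq (2 *\<^sub>R dn_eta z + s *\<^sub>R grad_sq z)"
    "even_seq (s *\<^sub>R quad z - eta z)"
    by (intro even_seq_add even_seq_diff even_seq_scaleR ev even_unit)+
  have U: "S unit_seq = 1" by (simp add: S_def synth_unit)
  have R: "S (rmd s z) = l * l * (Q * Q + I * I) + (z 0 - 2 * g * W) * (2 * Q + s * (Q * Q + I * I))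
      - 2 * l * \<gamma> * (N / 2 - W * Q) - \<gamma> * \<gamma> * ((s * (N / 2 - W * Q) - W) * (s * (N / 2 - W * Q) - W))"
    unfolding rmd_def l_def[symmetric]
    by (simp only: S_lin S_conv[OF e1(1,2)] S_conv[OF e1(3) e1(3)] D P U eta Q_def[symmetric] mult_1_right)
  have "S (z 0 *\<^sub>R unit_seq + (2 * (lam0 + z 1)\<^sup>2) *\<^sub>R dn_eta z + (2 * (lam0 + z 1) * \<gamma> - 2 * g) *\<^sub>R eta z + s *\<^sub>R rmd s z) = 0"
    unfolding fixed_point_equation[OF z fp] by (simp add: S_def synth_def)
  then have E: "z 0 + 2 * l\<^sup>2 * Q + (2 * l * \<gamma> - 2 * g) * W + s * S (rmd s z) = 0"
    by (simp only: S_lin U eta Q_def[symmetric] mult_1_right l_def[symmetric])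
  have "(l\<^sup>2 + s * z 0 - 2 * g * (s * W)) * ((- (s * I))\<^sup>2 + (s * Q)\<^sup>2 + 2 * (s * Q) + 1)
      - (l + \<gamma> * (s\<^sup>2 * N / 2 - s * W - s * W * (s * Q)))\<^sup>2
    = s * (z 0 + 2 * l\<^sup>2 * Q + (2 * l * \<gamma> - 2 * g) * W + s * S (rmd s z))"
    unfolding R by (simp add: power2_eq_square field_simps)
  then show ?thesis unfolding w dn dw w2 lam_def mu_def l_def[symmetric] E by simp
qed

lemma stokes_curve:
  assumes match: "freq_match \<alpha> \<beta>"
  shows "solution_curve \<alpha> \<beta> n a g h \<gamma> lam0 (\<lambda>x. cos (\<kappa> * x + \<theta>))"
proof -
  obtain C where C: "\<And>r z z'. r \<le> 1 \<Longrightarrow> norm z \<le> r \<Longrightarrow> norm z' \<le> r \<Longrightarrow>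
      norm (lead z - lead z') \<le> C * r * norm (z - z')"
    using lead_estimate by blast
  have lead0: "lead 0 = 0" by (simp add: lead_def)
  have V: "0 \<in> {u. even_seq u}"
    "\<And>s z. z \<in> {u. even_seq u} \<Longrightarrow> lead z + s *\<^sub>R seq_mult rem_mult (rmd s z) \<in> {u. even_seq u}"
    by (simp_all add: even_seq_zero even_step)
  obtain \<epsilon>0 z L where \<epsilon>0: "\<epsilon>0 > 0" "\<epsilon>0 \<le> 1" and z0: "z 0 = 0"
    and z: "\<And>s. \<bar>s\<bar> \<le> \<epsilon>0 \<Longrightarrow> z s \<in> {u. even_seq u} \<and> norm (z s) \<le> 1 \<and>
      lead (z s) + s *\<^sub>R seq_mult rem_mult (rmd s (z s)) = z s"
    and zL: "\<And>s s'. \<bar>s\<bar> \<le> \<epsilon>0 \<Longrightarrow> \<bar>s'\<bar> \<le> \<epsilon>0 \<Longrightarrow> norm (z s - z s') \<le> L * \<bar>s - s'\<bar>"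
    by (rule parametrized_fixed_point[of lead C "\<lambda>s z. seq_mult rem_mult (rmd s z)" "{u. even_seq u}"],
        rule lead0, erule (2) C, rule rmd_lipschitz, rule complete_even_seq, rule V(1), erule V(2), rule that)
  define cut where "cut = seq_mult cut_mult"
  have lin: "bounded_linear cut" unfolding cut_def by (rule bounded_linear_seq_mult[OF cut_mult_le])
  have cut_le: "norm (cut u) \<le> norm u" for u
    by (rule norm_bound) (use seq_le_norm[of u] in \<open>auto simp: cut_def seq_mult_simps cut_mult_def\<close>)
  define B where "B = norm base + 1"
  have B: "B \<ge> 0" by (simp add: B_def)
  have elev_le: "norm (elevation (z s)) \<le> B" if "\<bar>s\<bar> \<le> \<epsilon>0" for s
    using norm_triangle_ineq[of base "cut (z s)"] cut_le[of "z s"] z[OF that]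
    by (simp add: elevation_def cut_def B_def)
  \<comment> \<open>The second bound keeps the amplitude below the depth:
    \<open>\<bar>w s x\<bar>\<close> is at most
    \<open>wave_const * (\<bar>s\<bar> * B)\<close>.\<close>
  define \<epsilon> where "\<epsilon> = min \<epsilon>0 (h / (wave_const * B + 1))"
  have wB: "wave_const * B \<ge> 0" using wave_const_nonneg B by simp
  have \<epsilon>: "\<epsilon> > 0" "\<epsilon> \<le> \<epsilon>0" using \<epsilon>0 h wB by (auto simp: \<epsilon>_def)
  define w where "w = (\<lambda>s. wave (s *\<^sub>R elevation (z s)))"
  have cont: "continuous_on {-\<epsilon><..<\<epsilon>} z"
  proof -
    have "\<bar>L\<bar>-lipschitz_on {-\<epsilon><..<\<epsilon>} z"
    proof (rule lipschitz_onI)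
      fix s s' assume "s \<in> {-\<epsilon><..<\<epsilon>}" "s' \<in> {-\<epsilon><..<\<epsilon>}"
      then have "norm (z s - z s') \<le> L * \<bar>s - s'\<bar>" using \<epsilon> by (intro zL) auto
      also have "\<dots> \<le> \<bar>L\<bar> * \<bar>s - s'\<bar>" by (intro mult_right_mono) auto
      finally show "dist (z s) (z s') \<le> \<bar>L\<bar> * dist s s'" by (simp add: dist_norm)
    qed simp
    then show ?thesis by (rule lipschitz_on_continuous_on)
  qed
  have isCont: "isCont z s0" if "\<bar>s0\<bar> < \<epsilon>" for s0
    using continuous_on_interior[OF cont, of s0] that by (auto simp: abs_less_iff)
  have cont_ev: "continuous_on {-\<epsilon><..<\<epsilon>} (\<lambda>s. z s j)" for j
    by (rule bounded_linear.continuous_on[OF bounded_linear_seq_eval cont])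
  have zlim: "(\<lambda>s. norm (z s)) \<midarrow>0\<rightarrow> 0"
    using isCont[of 0] \<epsilon> tendsto_norm[of z 0 "at 0"] by (simp add: isCont_def z0)
  have sol: "wave_solution \<alpha> \<beta> n a g h \<gamma> (lam0 + z s 1) (s * z s 0) (w s)" if s: "\<bar>s\<bar> < \<epsilon>" for s
    unfolding wave_solution_def
  proof (intro conjI allI)
    have s': "\<bar>s\<bar> \<le> \<epsilon>0" using s \<epsilon> by simp
    show "w s \<in> AP_space0 \<alpha> \<beta> n a" unfolding w_def
      by (rule wave_AP_space0[OF match])
        (simp add: elevation_def base_apply seq_mult_simps cut_mult_def)
    fix x
    show "(lam0 + z s 1 + \<gamma> * (DN n a h (\<lambda>t. (w s t)\<^sup>2 / 2) x - w s x - w s x * DN n a h (w s) x))\<^sup>2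
        = ((lam0 + z s 1)\<^sup>2 + s * z s 0 - 2 * g * w s x) *
          ((deriv (w s) x)\<^sup>2 + (DN n a h (w s) x)\<^sup>2 + 2 * DN n a h (w s) x + 1)"
      unfolding w_def using z[OF s'] by (intro wave_equation) auto
    have "\<bar>w s x\<bar> \<le> wave_const * (\<bar>s\<bar> * B)"
      unfolding w_def using elev_le[OF s'] wave_const_nonneg
      by (intro order_trans[OF wave_le] mult_left_mono) (auto intro: mult_left_mono)
    also have "\<dots> \<le> \<bar>s\<bar> * (wave_const * B + 1)" by (simp add: algebra_simps)
    also have "\<dots> < h"
    proof -
      have "\<bar>s\<bar> < h / (wave_const * B + 1)" using s by (simp add: \<epsilon>_def)
      then show ?thesis using wB by (simp add: less_divide_eq)
    qed
    finally show "w s x > - h" by simp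
  qed
  have tend: "((\<lambda>s. holder_norm n a (\<lambda>x. w s x - w s0 x)) \<longlongrightarrow> 0) (at s0)" if s0: "\<bar>s0\<bar> < \<epsilon>" for s0
  proof (rule Lim_null_comparison)
    have "(\<lambda>x. w s x - w s0 x) = wave (s *\<^sub>R elevation (z s) - s0 *\<^sub>R elevation (z s0))" for s
      by (rule ext) (simp add: w_def wave_diff)
    then show "\<forall>\<^sub>F s in at s0. norm (holder_norm n a (\<lambda>x. w s x - w s0 x))
        \<le> wave_const * norm (s *\<^sub>R elevation (z s) - s0 *\<^sub>R elevation (z s0))"
      using holder_norm_wave_le wave_holder_norm_nonneg by simp
    have "((\<lambda>s. elevation (z s)) \<longlongrightarrow> elevation (z s0)) (at s0)"
      using isCont[OF s0] unfolding isCont_def elevation_def cut_def[symmetric]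
      by (intro tendsto_intros bounded_linear.tendsto[OF lin])
    then have "((\<lambda>s. wave_const * norm (s *\<^sub>R elevation (z s) - s0 *\<^sub>R elevation (z s0)))
        \<longlongrightarrow> wave_const * norm (s0 *\<^sub>R elevation (z s0) - s0 *\<^sub>R elevation (z s0))) (at s0)"
      by (intro tendsto_intros)
    then show "((\<lambda>s. wave_const * norm (s *\<^sub>R elevation (z s) - s0 *\<^sub>R elevation (z s0))) \<longlongrightarrow> 0) (at s0)"
      by simp
  qed
  have w0: "w 0 = (\<lambda>_. 0)" by (simp add: w_def wave_zero)
  have mu0: "((\<lambda>s. s * z s 0 / s) \<longlongrightarrow> 0) (at 0)"
    by (rule Lim_null_comparison[OF _ zlim]) (use seq_le_norm in \<open>auto simp: eventually_at_filter\<close>)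
  have ws: "((\<lambda>s. holder_norm n a (\<lambda>x. w s x - s * cos (\<kappa> * x + \<theta>)) / s) \<longlongrightarrow> 0) (at 0)"
  proof (rule Lim_null_comparison)
    \<comment> \<open>Only the truncated correction survives, \<open>s\<close> times a sequence
      tending to 0; hence o(s).\<close>
    have eq: "(\<lambda>x. w s x - s * cos (\<kappa> * x + \<theta>)) = wave (s *\<^sub>R cut (z s))" for s
    proof (rule ext)
      fix x
      have "w s x - s * cos (\<kappa> * x + \<theta>) = wave (s *\<^sub>R elevation (z s) - s *\<^sub>R base) x"
        by (simp add: w_def wave_diff wave_scaleR[of s base] wave_base)
      also have "s *\<^sub>R elevation (z s) - s *\<^sub>R base = s *\<^sub>R cut (z s)"
        by (simp add: elevation_def cut_def scaleR_add_right)
      finally show "w s x - s * cos (\<kappa> * x + \<theta>) = wave (s *\<^sub>R cut (z s)) x" .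
    qed
    have "norm (holder_norm n a (wave (s *\<^sub>R cut (z s))) / s) \<le> wave_const * norm (z s)" if "s \<noteq> 0" for s
    proof -
      have "\<bar>holder_norm n a (wave (s *\<^sub>R cut (z s)))\<bar> \<le> wave_const * (\<bar>s\<bar> * norm (cut (z s)))"
        using holder_norm_wave_le[of "s *\<^sub>R cut (z s)"] wave_holder_norm_nonneg[of "s *\<^sub>R cut (z s)"] by simp
      also have "\<dots> \<le> wave_const * (\<bar>s\<bar> * norm (z s))"
        using cut_le wave_const_nonneg by (intro mult_left_mono) auto
      finally show ?thesis using that by (simp add: divide_le_eq mult_ac)
    qed
    then show "\<forall>\<^sub>F s in at 0. norm (holder_norm n a (\<lambda>x. w s x - s * cos (\<kappa> * x + \<theta>)) / s) \<le> wave_const * norm (z s)"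
      unfolding eq by (auto simp: eventually_at_filter)
    show "((\<lambda>s. wave_const * norm (z s)) \<longlongrightarrow> 0) (at 0)"
      using tendsto_mult_left[OF zlim, of wave_const] by simp
  qed
  show ?thesis
    unfolding solution_curve_def
  proof (rule exI[of _ \<epsilon>], intro conjI exI)
    show "\<forall>s. \<bar>s\<bar> < \<epsilon> \<longrightarrow> wave_solution \<alpha> \<beta> n a g h \<gamma> (lam0 + z s 1) (s * z s 0) (w s)" using sol by blast
    show "continuous_on {-\<epsilon><..<\<epsilon>} (\<lambda>s. lam0 + z s 1)" "continuous_on {-\<epsilon><..<\<epsilon>} (\<lambda>s. s * z s 0)"
      by (intro continuous_intros cont_ev)+
    show "\<forall>s0. \<bar>s0\<bar> < \<epsilon> \<longrightarrow> ((\<lambda>s. holder_norm n a (\<lambda>x. w s x - w s0 x)) \<longlongrightarrow> 0) (at s0)" using tend by blast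
    show "((\<lambda>s. s * z s 0 / s) \<longlongrightarrow> 0) (at 0)" by (rule mu0)
    show "((\<lambda>s. holder_norm n a (\<lambda>x. w s x - s * cos (\<kappa> * x + \<theta>)) / s) \<longlongrightarrow> 0) (at 0)" by (rule ws)
  qed (use \<epsilon> z0 w0 in auto)
qed

lemma stokes_bifurcation:
  assumes match: "freq_match \<alpha> \<beta>"
  shows "bifurcation_value \<alpha> \<beta> n a g h \<gamma> lam0"
  unfolding bifurcation_value_def
proof (intro conjI allI impI)
  show "wave_solution \<alpha> \<beta> n a g h \<gamma> lam 0 (\<lambda>_. 0)" for lam by (rule trivial_wave_solution[OF match])
  fix e :: real assume e: "e > 0"
  obtain \<epsilon> lam mu w where \<epsilon>: "\<epsilon> > 0" and sol: "\<forall>s. \<bar>s\<bar> < \<epsilon> \<longrightarrow> wave_solution \<alpha> \<beta> n a g h \<gamma> (lam s) (mu s) (w s)"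
    and cl: "continuous_on {-\<epsilon><..<\<epsilon>} lam" and cm: "continuous_on {-\<epsilon><..<\<epsilon>} mu"
    and cw: "\<forall>s0. \<bar>s0\<bar> < \<epsilon> \<longrightarrow> ((\<lambda>s. holder_norm n a (\<lambda>x. w s x - w s0 x)) \<longlongrightarrow> 0) (at s0)"
    and at0: "lam 0 = lam0" "mu 0 = 0" "w 0 = (\<lambda>_. 0)"
    and tw: "((\<lambda>s. holder_norm n a (\<lambda>x. w s x - s * cos (\<kappa> * x + \<theta>)) / s) \<longlongrightarrow> 0) (at 0)"
    using stokes_curve[OF match] unfolding solution_curve_def by blast
  have "isCont lam 0" "isCont mu 0"
    using continuous_on_interior[OF cl, of 0] continuous_on_interior[OF cm, of 0] \<epsilon> by auto
  then have "(lam \<longlongrightarrow> lam0) (at 0)" "(mu \<longlongrightarrow> 0) (at 0)" by (simp_all add: isCont_def at0)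
  then have ev1: "\<forall>\<^sub>F s in at 0. dist (lam s) lam0 < e" "\<forall>\<^sub>F s in at 0. dist (mu s) 0 < e / 2"
    using e tendstoD[of lam lam0 "at 0" e] tendstoD[of mu 0 "at 0" "e / 2"] by simp_all
  have "((\<lambda>s. holder_norm n a (w s)) \<longlongrightarrow> 0) (at 0)" using cw[rule_format, of 0] \<epsilon> by (simp add: at0)
  then have ev2: "\<forall>\<^sub>F s in at 0. dist (holder_norm n a (w s)) 0 < e / 2" using e tendstoD[of "\<lambda>s. holder_norm n a (w s)" 0 "at 0" "e / 2"] by simp
  have ev3: "\<forall>\<^sub>F s in at 0. dist (holder_norm n a (\<lambda>x. w s x - s * cos (\<kappa> * x + \<theta>)) / s) 0 < 1"
    using tw by (rule tendstoD) simp
  have ev4: "\<forall>\<^sub>F s in at 0. \<bar>s\<bar> < \<epsilon>" "\<forall>\<^sub>F s in at 0. s \<noteq> (0::real)"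
    using \<epsilon> by (auto simp: eventually_at intro!: exI[of _ \<epsilon>])
  have "\<forall>\<^sub>F s in at 0. dist (lam s) lam0 < e \<and> dist (mu s) 0 < e / 2 \<and> dist (holder_norm n a (w s)) 0 < e / 2
    \<and> dist (holder_norm n a (\<lambda>x. w s x - s * cos (\<kappa> * x + \<theta>)) / s) 0 < 1 \<and> \<bar>s\<bar> < \<epsilon> \<and> s \<noteq> (0::real)"
    using ev1 ev2 ev3 ev4 by (intro eventually_conj)
  from eventually_happens'[OF at_neq_bot this]
  obtain s where s: "dist (lam s) lam0 < e" "dist (mu s) 0 < e / 2" "dist (holder_norm n a (w s)) 0 < e / 2"
    "dist (holder_norm n a (\<lambda>x. w s x - s * cos (\<kappa> * x + \<theta>)) / s) 0 < 1" "\<bar>s\<bar> < \<epsilon>" "s \<noteq> 0"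
    by blast
  have "w s \<noteq> (\<lambda>_. 0)"
  proof
    assume 0: "w s = (\<lambda>_. 0)"
    have eq: "(\<lambda>x. w s x - s * cos (\<kappa> * x + \<theta>)) = wave ((- s) *\<^sub>R base)"
      unfolding 0 by (rule ext) (simp only: wave_scaleR wave_base diff_0 mult_minus_left)
    \<comment> \<open>At the crest \<open>- \<theta> / \<kappa>\<close> the cosine is 1, so the
      deviation of a zero wave from the leading mode would have norm at least
      \<open>\<bar>s\<bar>\<close>, contrary to the ratio below 1.\<close>
    have "\<bar>wave ((- s) *\<^sub>R base) (- \<theta> / \<kappa>)\<bar> \<le> holder_norm n a (wave ((- s) *\<^sub>R base))"
      by (rule holder_norm_ge[OF wave_holder])
    then have "\<bar>s\<bar> \<le> holder_norm n a (wave ((- s) *\<^sub>R base))"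
      unfolding wave_scaleR wave_base using \<kappa> by simp
    then show False using s(4,6) unfolding eq by (simp add: abs_if field_simps split: if_splits)
  qed
  moreover have "\<bar>mu s\<bar> + holder_norm n a (w s) < e" using s(2,3) by (simp add: dist_real_def)
  ultimately show "\<exists>lam mu w. wave_solution \<alpha> \<beta> n a g h \<gamma> lam mu w \<and> (mu, w) \<noteq> (0, \<lambda>_. 0) \<and>
      \<bar>lam - lam0\<bar> < e \<and> \<bar>mu\<bar> + holder_norm n a w < e"
    using sol s(1,5) by (intro exI[of _ "lam s"] exI[of _ "mu s"] exI[of _ "w s"]) (auto simp: dist_real_def)
qed

end

lemma dispersion_root:
  fixes g \<gamma> \<tau> \<sigma> :: real
  assumes "g > 0" "\<tau> > 0" "\<sigma> * \<sigma> = 1"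
    and l: "l = - (\<gamma> * \<tau>) / 2 + \<sigma> * sqrt (\<gamma>\<^sup>2 * \<tau>\<^sup>2 / 4 + g * \<tau>)"
  shows "l \<noteq> 0" and "l\<^sup>2 * (1 / \<tau>) + l * \<gamma> = g" and "2 * l * (1 / \<tau>) + \<gamma> \<noteq> 0"
proof -
  define r where "r = sqrt (\<gamma>\<^sup>2 * \<tau>\<^sup>2 / 4 + g * \<tau>)"
  have pos: "\<gamma>\<^sup>2 * \<tau>\<^sup>2 / 4 + g * \<tau> > 0" using assms(1,2) by (intro add_nonneg_pos) auto
  have r: "r > 0" "r * r = \<gamma>\<^sup>2 * \<tau>\<^sup>2 / 4 + g * \<tau>" using pos by (auto simp: r_def)
  have lr: "l + \<gamma> * \<tau> / 2 = \<sigma> * r" using l by (simp add: r_def)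
  have "(l + \<gamma> * \<tau> / 2) * (l + \<gamma> * \<tau> / 2) = (\<sigma> * \<sigma>) * (r * r)" unfolding lr by (simp add: mult_ac)
  then have eq: "l\<^sup>2 + l * \<gamma> * \<tau> = g * \<tau>"
    unfolding assms(3) r(2) by (simp add: power2_eq_square algebra_simps)
  then show "l\<^sup>2 * (1 / \<tau>) + l * \<gamma> = g" using assms(2) by (simp add: field_simps)
  show "l \<noteq> 0" using eq assms(1,2) by auto
  \<comment> \<open>The transversality constant is \<open>2 * \<sigma> / \<tau>\<close> times the
    square root, so it is nonzero because the roots are simple.\<close>
  have "2 * l * (1 / \<tau>) + \<gamma> = 2 * (l + \<gamma> * \<tau> / 2) / \<tau>" using assms(2) by (simp add: field_simps)
  also have "\<dots> = 2 * (\<sigma> * r) / \<tau>" unfolding lr ..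
  finally show "2 * l * (1 / \<tau>) + \<gamma> \<noteq> 0" using r(1) assms(2,3) by auto
qed

lemma mode_bifurcation:
  fixes k g h \<gamma> a \<theta> \<sigma> :: real
  assumes g: "g > 0" and h: "h > 0" and n: "n \<ge> 1" and a: "0 < a" "a < 1" and k: "k \<noteq> 0"
    and match: "wave_frame.freq_match \<bar>k\<bar> \<theta> \<alpha> \<beta>" and \<sigma>: "\<sigma> * \<sigma> = 1"
    and l: "l = - (\<gamma> * tanh (k * h)) / (2 * k) + \<sigma> * sqrt (\<gamma>\<^sup>2 * (tanh (k * h))\<^sup>2 / (4 * k\<^sup>2) + g * (tanh (k * h) / k))"
  shows "bifurcation_value \<alpha> \<beta> n a g h \<gamma> l \<and> solution_curve \<alpha> \<beta> n a g h \<gamma> l (\<lambda>x. cos (\<bar>k\<bar> * x + \<theta>))"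
proof -
  interpret F: wave_frame "\<bar>k\<bar>" \<theta> h a n by unfold_locales (use assms in auto)
  \<comment> \<open>Even in \<open>k\<close>, which reduces negative frequencies to the wave number
    \<open>\<bar>k\<bar>\<close>; it is the reciprocal of the symbol at mode 1.\<close>
  define \<tau> where "\<tau> = tanh (k * h) / k"
  have \<tau>_abs: "\<tau> = tanh (\<bar>k\<bar> * h) / \<bar>k\<bar>" by (cases "k \<ge> 0") (simp_all add: \<tau>_def)
  have \<tau>: "\<tau> > 0" unfolding \<tau>_abs using k h by simp
  have dn: "F.dn_symbol 1 = 1 / \<tau>"
    using k unfolding \<tau>_abs by (simp add: F.dn_symbol_pos_eq tanh_def)
  have l': "l = - (\<gamma> * \<tau>) / 2 + \<sigma> * sqrt (\<gamma>\<^sup>2 * \<tau>\<^sup>2 / 4 + g * \<tau>)"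
    unfolding l \<tau>_def by (simp add: power_divide mult.commute)
  interpret stokes_frame "\<bar>k\<bar>" \<theta> h a n g \<gamma> l
    by unfold_locales (use dispersion_root[OF g \<tau> \<sigma> l'] dn in simp_all)
  show ?thesis using stokes_bifurcation[OF match] stokes_curve[OF match] by blast
qed

lemma freq_pairs_sums:
  assumes "(\<alpha>, \<beta>) \<in> freq_pairs"
  shows "\<exists>i. \<alpha> i = \<alpha> k + \<alpha> l" and "\<exists>i. \<alpha> i = \<beta> k + \<beta> l" and "\<exists>i. \<beta> i = \<alpha> k + \<beta> l"
  using assms unfolding freq_pairs_def by (auto, metis+)

lemma freq_match_alpha:
  fixes h a :: real and n :: nat
  assumes fp: "(\<alpha>, \<beta>) \<in> freq_pairs" and nz: "\<alpha> k0 \<noteq> 0" and "h > 0" "0 < a" "a < 1" "n \<ge> 1"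
  shows "wave_frame.freq_match \<bar>\<alpha> k0\<bar> 0 \<alpha> \<beta>"
proof -
  interpret wave_frame "\<bar>\<alpha> k0\<bar>" 0 h a n by unfold_locales (use assms in auto)
  have multiple: "\<exists>i. \<alpha> i = real (Suc k) * \<alpha> k0" for k
  proof (induction k)
    case (Suc k)
    then obtain i where "\<alpha> i = real (Suc k) * \<alpha> k0" by blast
    then show ?case using freq_pairs_sums(1)[OF fp, of i k0] by (simp add: algebra_simps)
  qed auto
  show ?thesis unfolding freq_match_def
  proof (intro allI impI)
    fix k :: nat assume "k \<ge> 1"
    then obtain i where i: "\<alpha> i = real k * \<alpha> k0" using multiple[of "k - 1"] by auto
    have "cos (real k * (\<bar>\<alpha> k0\<bar> * x + 0)) = cos (\<alpha> i * x)" for x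
      unfolding i by (cases "\<alpha> k0 \<ge> 0") (simp_all add: mult.assoc)
    then show "\<exists>i \<sigma>. (real k * \<bar>\<alpha> k0\<bar> = \<bar>\<alpha> i\<bar> \<and> (\<forall>x. cos (real k * (\<bar>\<alpha> k0\<bar> * x + 0)) = \<sigma> * cos (\<alpha> i * x))) \<or>
       (real k * \<bar>\<alpha> k0\<bar> = \<bar>\<beta> i\<bar> \<and> (\<forall>x. cos (real k * (\<bar>\<alpha> k0\<bar> * x + 0)) = \<sigma> * sin (\<beta> i * x)))"
      using i by (intro exI[of _ i] exI[of _ 1]) (simp add: abs_mult)
  qed
qed

lemma cos_abs_shift:
  fixes k b :: real
  assumes "b \<noteq> 0"
  shows "cos (k * (\<bar>b\<bar> * x + - sgn b * (pi / 2))) = cos (k * b * x) * cos (k * (pi / 2)) + sin (k * b * x) * sin (k * (pi / 2))"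
proof -
  have "k * (\<bar>b\<bar> * x + - sgn b * (pi / 2)) = sgn b * (k * b * x - k * (pi / 2))"
    by (simp add: abs_sgn algebra_simps)
  moreover have "cos (sgn b * t) = cos t" for t using assms by (cases "b > 0") (auto simp: sgn_if)
  ultimately show ?thesis by (simp add: cos_diff)
qed

text \<open>Even multiples of \<open>\<beta>\<^sub>k\<close> lie in \<open>\<alpha>\<close> and odd ones in \<open>\<beta>\<close>, so the cosine series shifted by a quarter
  period contains only the admitted cosines and sines.\<close>

lemma freq_match_beta:
  fixes h a :: real and n :: nat
  assumes fp: "(\<alpha>, \<beta>) \<in> freq_pairs" and nz: "\<beta> k0 \<noteq> 0" and "h > 0" "0 < a" "a < 1" "n \<ge> 1"
  shows "wave_frame.freq_match \<bar>\<beta> k0\<bar> (- sgn (\<beta> k0) * (pi / 2)) \<alpha> \<beta>"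
proof -
  interpret wave_frame "\<bar>\<beta> k0\<bar>" "- sgn (\<beta> k0) * (pi / 2)" h a n by unfold_locales (use assms in auto)
  \<comment> \<open>The multiple is \<open>Suc k\<close>, so \<open>even k\<close> marks the odd
    multiples. Adding \<open>\<beta> k0\<close> moves from one list to the other.\<close>
  have multiple: "\<exists>i. (if even k then \<beta> i else \<alpha> i) = real (Suc k) * \<beta> k0" for k
  proof (induction k)
    case (Suc k)
    then obtain i where "(if even k then \<beta> i else \<alpha> i) = real (Suc k) * \<beta> k0" by blast
    then show ?case
      using freq_pairs_sums(2)[OF fp, of i k0] freq_pairs_sums(3)[OF fp, of i k0]
      by (cases "even k") (simp_all add: algebra_simps)
  qed auto
  show ?thesis unfolding freq_match_def
  proof (intro allI impI)
    fix k :: nat assume k: "k \<ge> 1"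
    then obtain i where i: "(if odd k then \<beta> i else \<alpha> i) = real k * \<beta> k0"
      using multiple[of "k - 1"] by (cases k) auto
    \<comment> \<open>One summand vanishes for each parity, and the other is the sign of the
      surviving term.\<close>
    let ?\<sigma> = "cos (real k * (pi / 2)) + sin (real k * (pi / 2))"
    have half: "real k * (pi / 2) = real k * pi / 2" by simp
    show "\<exists>i \<sigma>. (real k * \<bar>\<beta> k0\<bar> = \<bar>\<alpha> i\<bar> \<and> (\<forall>x. cos (real k * (\<bar>\<beta> k0\<bar> * x + - sgn (\<beta> k0) * (pi / 2))) = \<sigma> * cos (\<alpha> i * x))) \<or>
       (real k * \<bar>\<beta> k0\<bar> = \<bar>\<beta> i\<bar> \<and> (\<forall>x. cos (real k * (\<bar>\<beta> k0\<bar> * x + - sgn (\<beta> k0) * (pi / 2))) = \<sigma> * sin (\<beta> i * x)))"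
    proof (cases "even k")
      case True
      then obtain m where m: "k = 2 * m" by blast
      have "sin (real k * (pi / 2)) = 0" unfolding m using sin_npi[of m] by simp
      then show ?thesis using True i unfolding cos_abs_shift[OF nz]
        by (intro exI[of _ i] exI[of _ ?\<sigma>]) (simp add: abs_mult)
    next
      case False
      then obtain m where m: "k = 2 * m + 1" by (elim oddE)
      have "real k * (pi / 2) = real m * pi + pi / 2" unfolding m by (simp add: field_simps)
      then have "cos (real k * (pi / 2)) = cos (real m * pi + pi / 2)" by (rule arg_cong)
      also have "\<dots> = 0" by (simp add: cos_add)
      finally have "cos (real k * (pi / 2)) = 0" .
      then show ?thesis using False i unfolding cos_abs_shift[OF nz]
        by (intro exI[of _ i] exI[of _ ?\<sigma>]) (simp add: abs_mult)
    qed
  qed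
qed

text \<open>For \<open>\<alpha> k0 = 0\<close> the leading mode would be the constant 1, whose mean
  is not 0, and the formulas for the first two values would divide by 0; this explains the condition
  on the cosine branch.\<close>

theorem mainTheorem2:
  fixes g h \<gamma> a :: real and n k0 :: nat and \<alpha> \<beta> :: "nat \<Rightarrow> real"
    and lam1 lam2 lam3 lam4 :: real
  assumes "g > 0" and "h > 0" and "n \<ge> 1" and "0 < a" and "a < 1"
    and "(\<alpha>, \<beta>) \<in> freq_pairs"
    and "\<forall>k. \<alpha> k0 \<noteq> \<beta> k"
    and "lam1 = - (\<gamma> * tanh (\<alpha> k0 * h)) / (2 * \<alpha> k0) + sqrt (\<gamma>\<^sup>2 * (tanh (\<alpha> k0 * h))\<^sup>2 / (4 * (\<alpha> k0)\<^sup>2) + g * (tanh (\<alpha> k0 * h) / \<alpha> k0))"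
    and "lam2 = - (\<gamma> * tanh (\<alpha> k0 * h)) / (2 * \<alpha> k0) - sqrt (\<gamma>\<^sup>2 * (tanh (\<alpha> k0 * h))\<^sup>2 / (4 * (\<alpha> k0)\<^sup>2) + g * (tanh (\<alpha> k0 * h) / \<alpha> k0))"
    and "lam3 = - (\<gamma> * tanh (\<beta> k0 * h)) / (2 * \<beta> k0) + sqrt (\<gamma>\<^sup>2 * (tanh (\<beta> k0 * h))\<^sup>2 / (4 * (\<beta> k0)\<^sup>2) + g * (tanh (\<beta> k0 * h) / \<beta> k0))"
    and "lam4 = - (\<gamma> * tanh (\<beta> k0 * h)) / (2 * \<beta> k0) - sqrt (\<gamma>\<^sup>2 * (tanh (\<beta> k0 * h))\<^sup>2 / (4 * (\<beta> k0)\<^sup>2) + g * (tanh (\<beta> k0 * h) / \<beta> k0))"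
  shows "(\<alpha> k0 \<noteq> 0 \<longrightarrow> (\<forall>l\<in>{lam1, lam2}.
            bifurcation_value \<alpha> \<beta> n a g h \<gamma> l \<and>
            solution_curve \<alpha> \<beta> n a g h \<gamma> l (\<lambda>x. cos (\<alpha> k0 * x)))) \<and>
         (\<forall>l\<in>{lam3, lam4}.
            bifurcation_value \<alpha> \<beta> n a g h \<gamma> l \<and>
            solution_curve \<alpha> \<beta> n a g h \<gamma> l (\<lambda>x. sin (\<beta> k0 * x)))"
proof (intro conjI impI)
  note bif = mode_bifurcation[OF assms(1,2,3,4,5)]
  have signs: "(1 :: real) * 1 = 1" "(- 1 :: real) * (- 1) = 1" by simp_all
  show "\<forall>l\<in>{lam1, lam2}. bifurcation_value \<alpha> \<beta> n a g h \<gamma> l \<and>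
      solution_curve \<alpha> \<beta> n a g h \<gamma> l (\<lambda>x. cos (\<alpha> k0 * x))" if nz: "\<alpha> k0 \<noteq> 0"
  proof -
    have "(\<lambda>x. cos (\<bar>\<alpha> k0\<bar> * x + 0)) = (\<lambda>x. cos (\<alpha> k0 * x))"
      by (rule ext) (cases "\<alpha> k0 \<ge> 0"; simp)
    moreover note match = freq_match_alpha[OF assms(6) nz assms(2,4,5,3)]
    ultimately show ?thesis
      using bif[OF nz match signs(1), of lam1 \<gamma>] bif[OF nz match signs(2), of lam2 \<gamma>] assms(8,9) by simp
  qed
  show "\<forall>l\<in>{lam3, lam4}. bifurcation_value \<alpha> \<beta> n a g h \<gamma> l \<and>
      solution_curve \<alpha> \<beta> n a g h \<gamma> l (\<lambda>x. sin (\<beta> k0 * x))"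
  proof -
    \<comment> \<open>Otherwise \<open>\<alpha> k0 + \<beta> k0 = \<alpha> k0\<close> would occur
      among the sine frequencies, against the choice of \<open>k0\<close>.\<close>
    have nz: "\<beta> k0 \<noteq> 0"
    proof
      assume "\<beta> k0 = 0"
      then show False using freq_pairs_sums(3)[OF assms(6), of k0 k0] assms(7) by (metis add.right_neutral)
    qed
    have "(\<lambda>x. cos (\<bar>\<beta> k0\<bar> * x + - sgn (\<beta> k0) * (pi / 2))) = (\<lambda>x. sin (\<beta> k0 * x))"
      using cos_abs_shift[OF nz, of 1] by simp
    moreover note match = freq_match_beta[OF assms(6) nz assms(2,4,5,3)]
    ultimately show ?thesis
      using bif[OF nz match signs(1), of lam3 \<gamma>] bif[OF nz match signs(2), of lam4 \<gamma>] assms(10,11) by simp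
  qed
qed

end
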